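(* Let $X$ be a subordinator with drift $\delta>0$ and Lévy measure $\Pi$ with $\beta(\Pi)<1$. If $\mathbb{E}[X_1]<\infty$, then $$\lim_{x\to\infty}u'(x+)=\lim_{x\to\infty}u'(x-)=0 .$$
   Context: A subordinator is a Lévy process $X=(X_t)_{t\ge0}$ with $X_0=0$ and almost surely non-decreasing paths; $X_t=\delta t+\sum_{s\le t}\Delta_s$ with drift $\delta$ and jumps $\Delta_s$ governed by a Poisson random measure with Lévy measure $\Pi$, a measure on $(0,\infty)$ with $\int_0^\infty(1\wedge x)\,\Pi(dx)<\infty$. The Blumenthal–Getoor index is $\beta(\Pi)=\inf\{\gamma>0:\int_0^1x^\gamma\,\Pi(dx)<\infty\}$. The potential measure is $U(dx)=\mathbb{E}\left[\int_0^\infty\mathbf 1_{\{X_t\in dx\}}\,dt\right]$. When $\delta>0$ it has a bounded continuous density $u$ with respect to Lebesgue measure (the renewal density); $u'(x+)$ and $u'(x-)$ denote its right and left derivatives at $x>0$ (which exist). *)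

theory Defs
  imports "HOL-Probability.Probability"
begin

definition levy_process :: "'a measure \<Rightarrow> (real \<Rightarrow> 'a \<Rightarrow> real) \<Rightarrow> bool" where
  "levy_process M X \<longleftrightarrow>
     prob_space M \<and>
     (\<forall>t\<ge>0. X t \<in> borel_measurable M) \<and>
     (AE \<omega> in M. X 0 \<omega> = 0) \<and>
     (\<forall>(\<tau> :: nat \<Rightarrow> real) n. 0 \<le> \<tau> 0 \<longrightarrow> mono \<tau> \<longrightarrow>
        prob_space.indep_vars M (\<lambda>_. borel) (\<lambda>i \<omega>. X (\<tau> (Suc i)) \<omega> - X (\<tau> i) \<omega>) {..<n}) \<and>
     (\<forall>s\<ge>0. \<forall>t\<ge>0. distr M borel (\<lambda>\<omega>. X (s + t) \<omega> - X s \<omega>) = distr M borel (X t)) \<and>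
     (AE \<omega> in M. \<forall>t\<ge>0. ((\<lambda>s. X s \<omega>) \<longlongrightarrow> X t \<omega>) (at_right t)) \<and>
     (AE \<omega> in M. \<forall>t>0. \<exists>l. ((\<lambda>s. X s \<omega>) \<longlongrightarrow> l) (at_left t))"

definition subordinator :: "'a measure \<Rightarrow> (real \<Rightarrow> 'a \<Rightarrow> real) \<Rightarrow> bool" where
  "subordinator M X \<longleftrightarrow>
     levy_process M X \<and> (AE \<omega> in M. mono_on {0..} (\<lambda>t. X t \<omega>))"

definition jump :: "(real \<Rightarrow> 'a \<Rightarrow> real) \<Rightarrow> real \<Rightarrow> 'a \<Rightarrow> real" where
  "jump X s \<omega> = X s \<omega> - Lim (at_left s) (\<lambda>r. X r \<omega>)"

text \<open>The random measure that counts the pairs (time, size) of the jumps of a path.\<close>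

definition jump_measure :: "(real \<Rightarrow> 'a \<Rightarrow> real) \<Rightarrow> 'a \<Rightarrow> (real \<times> real) measure" where
  "jump_measure X \<omega> =
     distr (count_space {s. 0 < s \<and> jump X s \<omega> \<noteq> 0}) borel (\<lambda>s. (s, jump X s \<omega>))"

text \<open>A set of infinite intensity almost surely carries infinite mass, which is the usual
  convention for the Poisson law with parameter \<open>\<infinity>\<close>.  Finite disjoint families are covered
  by padding the sequence with empty sets.  The Poisson weights are written out because
  \<open>poisson_pmf\<close> requires a positive parameter, and here \<open>\<mu> A = 0\<close> is possible.\<close>

definition poisson_random_measure ::
    "'a measure \<Rightarrow> 'b measure \<Rightarrow> ('a \<Rightarrow> 'b measure) \<Rightarrow> bool" where
  "poisson_random_measure M \<mu> N \<longleftrightarrow>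
     (\<forall>\<omega>\<in>space M. sets (N \<omega>) = sets \<mu>) \<and>
     (\<forall>A\<in>sets \<mu>. (\<lambda>\<omega>. emeasure (N \<omega>) A) \<in> borel_measurable M) \<and>
     (\<forall>A\<in>sets \<mu>. emeasure \<mu> A = \<infinity> \<longrightarrow> (AE \<omega> in M. emeasure (N \<omega>) A = \<infinity>)) \<and>
     (\<forall>A\<in>sets \<mu>. emeasure \<mu> A < \<infinity> \<longrightarrow> (\<forall>k :: nat.
        measure M {\<omega> \<in> space M. emeasure (N \<omega>) A = of_nat k} =
        measure \<mu> A ^ k / fact k * exp (- measure \<mu> A))) \<and>
     (\<forall>A :: nat \<Rightarrow> 'b set. range A \<subseteq> sets \<mu> \<longrightarrow> disjoint_family A \<longrightarrow>
        prob_space.indep_vars M (\<lambda>_. borel) (\<lambda>i \<omega>. emeasure (N \<omega>) (A i)) UNIV)"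

text \<open>Measures on \<open>(0, \<infinity>)\<close> are represented as Borel measures on the real line that do not
  charge \<open>(-\<infinity>, 0]\<close>.\<close>

definition levy_measure :: "real measure \<Rightarrow> bool" where
  "levy_measure \<nu> \<longleftrightarrow>
     sets \<nu> = sets borel \<and> emeasure \<nu> {..0} = 0 \<and> (\<integral>\<^sup>+x. ennreal (min 1 x) \<partial>\<nu>) < \<infinity>"

text \<open>The random measure \<open>N\<close> is only a version of the jump measure: the latter need not be
  measurable on the null set where the path is irregular.\<close>

definition has_drift_and_levy_measure ::
    "'a measure \<Rightarrow> (real \<Rightarrow> 'a \<Rightarrow> real) \<Rightarrow> real \<Rightarrow> real measure \<Rightarrow> bool" where
  "has_drift_and_levy_measure M X \<delta> \<nu> \<longleftrightarrow>
     levy_measure \<nu> \<and>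
     (\<exists>N. poisson_random_measure M (density lborel (indicator {0<..}) \<Otimes>\<^sub>M \<nu>) N \<and>
          (AE \<omega> in M. N \<omega> = jump_measure X \<omega>)) \<and>
     (AE \<omega> in M. \<forall>t\<ge>0. ((\<lambda>s. jump X s \<omega>) has_sum (X t \<omega> - \<delta> * t)) {0<..t})"

definition blumenthal_getoor_index :: "real measure \<Rightarrow> real" where
  "blumenthal_getoor_index \<nu> =
     Inf {\<gamma>. 0 < \<gamma> \<and> (\<integral>\<^sup>+x\<in>{0<..1}. ennreal (x powr \<gamma>) \<partial>\<nu>) < \<infinity>}"

definition potential_measure :: "'a measure \<Rightarrow> (real \<Rightarrow> 'a \<Rightarrow> real) \<Rightarrow> real measure" where
  "potential_measure M X =
     measure_of UNIV (sets borel)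
       (\<lambda>A. \<integral>\<^sup>+\<omega>. (\<integral>\<^sup>+t\<in>{0..}. indicator A (X t \<omega>) \<partial>lborel) \<partial>M)"

text \<open>The values of \<open>u\<close> outside \<open>(0, \<infinity>)\<close> are irrelevant.  Nonnegativity has to be required
  because \<open>ennreal\<close> maps negative numbers to 0.\<close>

definition renewal_density ::
    "'a measure \<Rightarrow> (real \<Rightarrow> 'a \<Rightarrow> real) \<Rightarrow> (real \<Rightarrow> real) \<Rightarrow> bool" where
  "renewal_density M X u \<longleftrightarrow>
     continuous_on {0<..} u \<and> bounded (u ` {0<..}) \<and> (\<forall>x>0. 0 \<le> u x) \<and>
     potential_measure M X = density lborel (\<lambda>x. indicator {0<..} x * ennreal (u x))"

end

theory Submission imports Defs
begin

text \<open>
  Let \<open>\<phi>(l) = \<delta> l + \<integral> (1 - e^(- l y)) \<nu>(dy)\<close> be the Laplace exponent of the subordinator and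
  \<open>k(x) = \<nu>(x, \<infinity>) / \<delta>\<close>, a decreasing function on \<open>(0, \<infinity>)\<close>.  The Laplace transform of the
  renewal density \<open>u\<close> is \<open>1 / \<phi>\<close>, and \<open>\<phi>(l) / (\<delta> l)\<close> is 1 plus the Laplace transform of \<open>k\<close>.
  Therefore \<open>u\<close> solves the Volterra equation \<open>u + k * u = 1 / \<delta>\<close> on \<open>(0, \<infinity>)\<close>
  (\<open>renewal_equation\<close>).  If \<open>h\<close> is the resolvent of \<open>k\<close>, that is, \<open>h + k * h = - k\<close>, then
  \<open>u(x) = (1 + H(x)) / \<delta>\<close> with \<open>H(x)\<close> the integral of \<open>h\<close> over \<open>[0, x]\<close>
  (\<open>solution_representation\<close>).  In \<open>h = - k - k * h\<close> the first term is monotone and the second is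
  continuous, so \<open>h\<close> has one-sided limits, and these divided by \<open>\<delta>\<close> are the one-sided derivatives of
  \<open>u\<close>.  It remains to construct \<open>h\<close> and to show that it tends to 0.

  The condition on the Blumenthal-Getoor index is used for the construction.  It gives
  \<open>k(x) \<le> C x^(- \<gamma>)\<close> with some \<open>\<gamma> < 1\<close>.  If \<open>l\<close> is large, convolution with the tilted kernel
  \<open>e^(- l x) k(x)\<close> is a contraction on the functions that are \<open>O(x^(- \<gamma>))\<close>, and its Neumann series
  converges pointwise; tilting back gives \<open>h\<close> (\<open>ex_resolvent\<close>).

  The condition \<open>E [X 1] < \<infinity>\<close> makes \<open>k\<close> integrable over the whole half-line, and the decay
  rests on this.  The first step is the renewal theorem: \<open>u\<close> converges at infinity.  Convolution with the integrable decreasing kernel \<open>k\<close>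
  makes bounded functions uniformly continuous, so \<open>u\<close> is uniformly continuous.  The law of \<open>X\<close> at an
  independent exponential time has a density \<open>r\<close> with \<open>u = r + r * u\<close>, so far out \<open>u\<close> is nearly an
  average of its values further left, and \<open>r\<close> charges every interval near 0.  Hence if \<open>u(z n)\<close> tends to
  the upper limit \<open>m\<close> of \<open>u\<close>, so does \<open>u(z n - y)\<close> for every \<open>y \<ge> 0\<close>.  Inserting this into the
  Volterra equation gives \<open>m (1 + \<integral> k) = 1 / \<delta>\<close>; the lower limit satisfies the same equation.  The second
  step is a Tauberian argument for \<open>h\<close>: since \<open>H\<close> converges and \<open>k\<close> is monotone, the second mean value
  theorem shows that the part of \<open>(k * h)(x)\<close> over \<open>[0, x - \<eta>]\<close> tends to 0, while the part over
  \<open>[x - \<eta>, x]\<close> is at most a quarter of the supremum of \<open>\<bar>h\<bar>\<close> there if \<open>\<eta>\<close> is small.  So the upper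
  limit of \<open>\<bar>h\<bar>\<close> is at most a quarter of itself, once \<open>h\<close> is known to be bounded
  (\<open>h_tendsto_0\<close>).

  The Laplace transforms come from the exponential formula for the Poisson random measure of the jumps
  (\<open>poisson_random_measure_laplace_functional\<close>), and identities between them are inverted by
  \<open>laplace_transform_unique\<close>.
\<close>

section \<open>The exponential formula for Poisson random measures\<close>

text \<open>The function \<open>e^(- x)\<close> on \<open>[0, \<infinity>]\<close>.  The value 0 at infinity makes the exponential formula below
  hold without a case distinction for sets of infinite intensity.\<close>

definition exp_neg :: "ennreal \<Rightarrow> real" where
  "exp_neg x = (if x = \<top> then 0 else exp (- enn2real x))"

lemma exp_neg_measurable [measurable]: "exp_neg \<in> borel_measurable borel"
  unfolding exp_neg_def by measurable

lemma exp_neg_ennreal [simp]: "0 \<le> a \<Longrightarrow> exp_neg (ennreal a) = exp (- a)"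
  by (simp add: exp_neg_def)

lemma exp_neg_top [simp]: "exp_neg \<top> = 0"
  by (simp add: exp_neg_def)

lemma exp_neg_0 [simp]: "exp_neg 0 = 1"
  by (simp add: exp_neg_def)

lemma exp_neg_nonneg [simp]: "0 \<le> exp_neg x"
  by (simp add: exp_neg_def)

lemma exp_neg_le_1 [simp]: "exp_neg x \<le> 1"
  by (simp add: exp_neg_def)

lemma exp_neg_add: "exp_neg (x + y) = exp_neg x * exp_neg y"
  by (cases x; cases y) (auto simp: exp_add[symmetric] ennreal_plus[symmetric] simp del: ennreal_plus)

lemma exp_neg_sum: "finite I \<Longrightarrow> exp_neg (\<Sum>i\<in>I. f i) = (\<Prod>i\<in>I. exp_neg (f i))"
  by (induction I rule: finite_induct) (auto simp: exp_neg_add)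

lemma exp_neg_antimono: "x \<le> y \<Longrightarrow> exp_neg y \<le> exp_neg x"
  by (cases x; cases y) (auto simp: top_unique)

lemma tendsto_exp_neg:
  assumes "(f \<longlongrightarrow> x) F"
  shows "((\<lambda>n. exp_neg (f n)) \<longlongrightarrow> exp_neg x) F"
proof (cases "x = \<top>")
  case True
  have "\<forall>\<^sub>F n in F. dist (exp_neg (f n)) 0 < e" if "e > 0" for e
  proof -
    have "\<forall>\<^sub>F n in F. f n > ennreal (max 0 (- ln e))"
      using assms True by (intro order_tendstoD) auto
    then show ?thesis
    proof eventually_elim
      case (elim n)
      show ?case
      proof (cases "f n")
        case (real r)
        then have "max 0 (- ln e) < r" using elim unfolding real by (simp only: ennreal_less_iff max.cobounded1)
        then have "exp (- r) < e"
          using that by (metis exp_less_cancel_iff exp_ln max_less_iff_conj minus_less_iff)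
        then show ?thesis using real by simp
      qed (use that in auto)
    qed
  qed
  then show ?thesis using True by (simp add: tendsto_iff)
next
  case False
  have ev: "\<forall>\<^sub>F n in F. f n < \<top>"
    using assms False by (intro order_tendstoD) (auto simp: top.not_eq_extremum)
  have "((\<lambda>n. enn2real (f n)) \<longlongrightarrow> enn2real x) F"
    using assms False by (intro tendsto_enn2real) (auto simp: less_top)
  then have "((\<lambda>n. exp (- enn2real (f n))) \<longlongrightarrow> exp (- enn2real x)) F"
    by (intro tendsto_exp tendsto_minus)
  moreover have "\<forall>\<^sub>F n in F. exp (- enn2real (f n)) = exp_neg (f n)"
    using ev by eventually_elim (auto simp: exp_neg_def)
  ultimately show ?thesis
    using False by (auto simp: exp_neg_def[of x] intro: Lim_transform_eventually)
qed

text \<open>The Poisson weights sum to 1, so \<open>N\<close> is almost surely a natural number, and the expectation is an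
  exponential series over its possible values.\<close>

lemma (in prob_space) poisson_laplace_transform:
  fixes N :: "'a \<Rightarrow> ennreal"
  assumes [measurable]: "N \<in> borel_measurable M" and m: "0 \<le> m" and c: "0 \<le> c"
    and pois: "\<And>k. prob {\<omega> \<in> space M. N \<omega> = of_nat k} = m ^ k / fact k * exp (- m)"
  shows "(\<integral>\<^sup>+\<omega>. ennreal (exp_neg (ennreal c * N \<omega>)) \<partial>M) = ennreal (exp (- ((1 - exp (- c)) * m)))"
proof -
  define E where "E k = {\<omega> \<in> space M. N \<omega> = of_nat k}" for k :: nat
  have Em[measurable]: "E k \<in> sets M" for k unfolding E_def by measurable
  have disj: "disjoint_family E" by (auto simp: disjoint_family_on_def E_def)
  have "(\<lambda>k. prob (E k)) sums prob (\<Union>k. E k)"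
    by (rule finite_measure_UNION) (use disj in auto)
  moreover have "(\<lambda>k. prob (E k)) sums 1"
    using sums_mult2[OF exp_converges[of m], of "exp (- m)"]
    unfolding E_def pois by (simp add: exp_minus_inverse field_simps)
  ultimately have "prob (\<Union>k. E k) = 1" using sums_unique2 by blast
  then have "AE \<omega> in M. \<omega> \<in> (\<Union>k. E k)" by (subst (asm) prob_eq_1) auto
  then have "(\<integral>\<^sup>+\<omega>. ennreal (exp_neg (ennreal c * N \<omega>)) \<partial>M) =
      (\<integral>\<^sup>+\<omega>. (\<Sum>k. ennreal (exp (- c) ^ k) * indicator (E k) \<omega>) \<partial>M)"
  proof (intro nn_integral_cong_AE, eventually_elim)
    case (elim \<omega>)
    then obtain k where k: "\<omega> \<in> E k" by auto
    then have "ennreal c * N \<omega> = ennreal (c * real k)"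
      using c by (simp add: E_def ennreal_mult ennreal_of_nat_eq_real_of_nat)
    then have "exp_neg (ennreal c * N \<omega>) = exp (- c) ^ k"
      using c by (simp add: exp_of_nat_mult[symmetric] mult.commute)
    then show ?case using suminf_cmult_indicator[OF disj k] by simp
  qed
  also have "\<dots> = (\<Sum>k. ennreal (exp (- c) ^ k) * emeasure M (E k))"
    by (subst nn_integral_suminf) (auto simp: nn_integral_cmult_indicator)
  also have "\<dots> = (\<Sum>k. ennreal (exp (- c) ^ k * (m ^ k / fact k * exp (- m))))"
    using m by (intro suminf_cong) (simp only: emeasure_eq_measure E_def pois ennreal_mult[symmetric]
      zero_le_power exp_ge_zero mult_nonneg_nonneg divide_nonneg_nonneg fact_ge_zero)
  also have "\<dots> = ennreal (exp (exp (- c) * m) * exp (- m))"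
  proof (rule suminf_ennreal_eq)
    show "(\<lambda>k. exp (- c) ^ k * (m ^ k / fact k * exp (- m))) sums (exp (exp (- c) * m) * exp (- m))"
      using sums_mult2[OF exp_converges[of "exp (- c) * m"], of "exp (- m)"]
      by (simp add: power_mult_distrib field_simps)
  qed (use m in auto)
  also have "exp (exp (- c) * m) * exp (- m) = exp (- ((1 - exp (- c)) * m))"
    by (simp add: exp_add[symmetric] algebra_simps)
  finally show ?thesis .
qed

text \<open>The masses of disjoint sets are independent, so the expectation factors into transforms of Poisson
  variables.  A set of infinite intensity contributes the factor 0 to both sides, or 1 if its coefficient
  vanishes.\<close>

lemma poisson_random_measure_laplace_simple:
  fixes A :: "nat \<Rightarrow> 'b set" and c :: "nat \<Rightarrow> real"
  assumes M: "prob_space M" and N: "poisson_random_measure M \<mu> N"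
    and A: "range A \<subseteq> sets \<mu>" "disjoint_family A" and c: "\<And>i. 0 \<le> c i"
  shows "(\<integral>\<^sup>+\<omega>. ennreal (exp_neg (\<Sum>i<n. ennreal (c i) * emeasure (N \<omega>) (A i))) \<partial>M) =
    ennreal (exp_neg (\<Sum>i<n. ennreal (1 - exp (- c i)) * emeasure \<mu> (A i)))"
proof -
  interpret prob_space M by fact
  have meas[measurable]: "(\<lambda>\<omega>. emeasure (N \<omega>) (A i)) \<in> borel_measurable M" for i
    using N A unfolding poisson_random_measure_def by auto
  have "indep_vars (\<lambda>_. borel) (\<lambda>i \<omega>. emeasure (N \<omega>) (A i)) UNIV"
    using N A unfolding poisson_random_measure_def by blast
  then have indep: "indep_vars (\<lambda>_. borel) (\<lambda>i \<omega>. ennreal (exp_neg (ennreal (c i) * emeasure (N \<omega>) (A i)))) {..<n}"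
    by (intro indep_vars_subset[OF indep_vars_compose2[where X = "\<lambda>i \<omega>. emeasure (N \<omega>) (A i)"
          and Y = "\<lambda>i x. ennreal (exp_neg (ennreal (c i) * x))"]]) auto
  have one: "(\<integral>\<^sup>+\<omega>. ennreal (exp_neg (ennreal (c i) * emeasure (N \<omega>) (A i))) \<partial>M) =
    ennreal (exp_neg (ennreal (1 - exp (- c i)) * emeasure \<mu> (A i)))" for i
  proof (cases "emeasure \<mu> (A i) = \<top>")
    case True
    then have "AE \<omega> in M. emeasure (N \<omega>) (A i) = \<top>"
      using N A unfolding poisson_random_measure_def by auto
    then have "(\<integral>\<^sup>+\<omega>. ennreal (exp_neg (ennreal (c i) * emeasure (N \<omega>) (A i))) \<partial>M)
        = (\<integral>\<^sup>+\<omega>. ennreal (exp_neg (ennreal (c i) * \<top>)) \<partial>M)"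
      by (intro nn_integral_cong_AE) auto
    also have "\<dots> = ennreal (exp_neg (ennreal (c i) * \<top>))"
      by (simp add: emeasure_space_1)
    finally show ?thesis using True c[of i] by (cases "c i = 0") (auto simp: ennreal_mult_top)
  next
    case False
    then obtain m where m: "0 \<le> m" "emeasure \<mu> (A i) = ennreal m" by (cases "emeasure \<mu> (A i)") auto
    have "(\<integral>\<^sup>+\<omega>. ennreal (exp_neg (ennreal (c i) * emeasure (N \<omega>) (A i))) \<partial>M)
       = ennreal (exp (- ((1 - exp (- c i)) * m)))"
    proof (rule poisson_laplace_transform)
      show "prob {\<omega> \<in> space M. emeasure (N \<omega>) (A i) = of_nat k} = m ^ k / fact k * exp (- m)" for k
        using N A m False unfolding poisson_random_measure_def
        by (auto simp: measure_def top.not_eq_extremum[symmetric] image_subset_iff)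
    qed (use m c in auto)
    then show ?thesis using m c[of i] by (simp add: ennreal_mult[symmetric])
  qed
  have "(\<integral>\<^sup>+\<omega>. ennreal (exp_neg (\<Sum>i<n. ennreal (c i) * emeasure (N \<omega>) (A i))) \<partial>M) =
     (\<integral>\<^sup>+\<omega>. (\<Prod>i<n. ennreal (exp_neg (ennreal (c i) * emeasure (N \<omega>) (A i)))) \<partial>M)"
    by (simp add: exp_neg_sum prod_ennreal)
  also have "\<dots> = (\<Prod>i<n. ennreal (exp_neg (ennreal (1 - exp (- c i)) * emeasure \<mu> (A i))))"
    using indep by (subst indep_vars_nn_integral) (auto simp: one)
  finally show ?thesis by (simp add: exp_neg_sum prod_ennreal)
qed

text \<open>Independence of a Poisson random measure is stated for sequences of disjoint sets, so the level sets of
  a simple function are numbered and padded with empty sets.  The function \<open>h\<close> lets one numbering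
  serve both \<open>g\<close> and \<open>1 - e^(- g)\<close>, the integrands on the two sides of the exponential formula.\<close>

lemma simple_function_as_finite_sum:
  fixes g :: "'b \<Rightarrow> ennreal"
  assumes g: "simple_function \<mu> g" and fin: "\<And>x. g x < \<top>"
  obtains A :: "nat \<Rightarrow> 'b set" and c :: "nat \<Rightarrow> real" and n :: nat
  where "range A \<subseteq> sets \<mu>" "disjoint_family A" "\<And>i. 0 \<le> c i"
    "\<And>x (h :: real \<Rightarrow> ennreal). x \<in> space \<mu> \<Longrightarrow> h (enn2real (g x)) = (\<Sum>i<n. h (c i) * indicator (A i) x)"
proof -
  define S where "S = enn2real ` g ` space \<mu>"
  have "finite S" using g by (simp add: S_def simple_functionD)
  then obtain b n where b: "bij_betw b {..<n::nat} S"
    using ex_bij_betw_nat_finite[of S] by (auto simp: atLeast0LessThan)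
  define A where "A i = (if i < n then g -` {ennreal (b i)} \<inter> space \<mu> else {})" for i
  define c where "c i = (if i < n then b i else 0)" for i
  have bS: "b i \<in> S" if "i < n" for i using b that by (auto simp: bij_betw_def)
  have bpos: "0 \<le> b i" if "i < n" for i using bS[OF that] by (auto simp: S_def)
  show thesis
  proof
    show "range A \<subseteq> sets \<mu>" using g by (auto simp: A_def simple_functionD)
    show "disjoint_family A"
      using inj_onD[OF bij_betw_imp_inj_on[OF b]] bpos
      by (auto simp: disjoint_family_on_def A_def split: if_splits)
    show "0 \<le> c i" for i using bpos by (simp add: c_def)
    show "h (enn2real (g x)) = (\<Sum>i<n. h (c i) * indicator (A i) x)" if x: "x \<in> space \<mu>" for x and h :: "real \<Rightarrow> ennreal"
    proof -
      have "enn2real (g x) \<in> S" using x by (auto simp: S_def)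
      then obtain j where j: "j < n" "b j = enn2real (g x)" using b by (auto simp: bij_betw_def)
      have gx: "ennreal (b j) = g x" using j fin[of x] by simp
      have "indicator (A i) x = (if i = j then 1 else 0 :: ennreal)" if "i < n" for i
      proof -
        have "ennreal (b i) = g x \<longleftrightarrow> i = j"
          using inj_onD[OF bij_betw_imp_inj_on[OF b], of i j] that j(1) bpos
          unfolding gx[symmetric] by auto
        then have "g x = ennreal (b i) \<longleftrightarrow> i = j" by metis
        then show ?thesis using x that by (simp add: A_def indicator_def)
      qed
      then have "(\<Sum>i<n. h (c i) * indicator (A i) x) = (\<Sum>i<n. if i = j then h (c j) else 0)"
        by (intro sum.cong) auto
      then show ?thesis using j by (simp add: c_def)
    qed
  qed
qed

text \<open>The exponential formula.  It passes from simple functions to their increasing limits: by monotone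
  convergence inside both exponents and by dominated convergence in the outer expectation.\<close>

lemma poisson_random_measure_laplace_functional:
  fixes f :: "'b \<Rightarrow> ennreal"
  assumes M: "prob_space M" and N: "poisson_random_measure M \<mu> N"
    and f: "f \<in> borel_measurable \<mu>"
  shows "(\<integral>\<^sup>+\<omega>. ennreal (exp_neg (\<integral>\<^sup>+x. f x \<partial>N \<omega>)) \<partial>M) =
    ennreal (exp_neg (\<integral>\<^sup>+x. ennreal (1 - exp_neg (f x)) \<partial>\<mu>))"
proof -
  interpret prob_space M by fact
  have setsN: "sets (N \<omega>) = sets \<mu>" if "\<omega> \<in> space M" for \<omega>
    using N that unfolding poisson_random_measure_def by auto
  obtain g where g: "\<And>i. simple_function \<mu> (g i)" "incseq g" "\<And>i x. g i x < \<top>" "\<And>x. (SUP i. g i x) = f x"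
    by (rule borel_measurable_implies_simple_function_sequence'[OF f]) (rule that, assumption+)
  have gm[measurable]: "g i \<in> borel_measurable \<mu>" for i by (rule borel_measurable_simple_function[OF g(1)])
  have glim: "(\<lambda>i. g i x) \<longlonglongrightarrow> f x" for x
  proof -
    have "incseq (\<lambda>i. g i x)" using g(2) by (simp add: incseq_def le_fun_def)
    then have "(\<lambda>i. g i x) \<longlonglongrightarrow> (SUP i. g i x)" by (rule LIMSEQ_SUP)
    then show ?thesis by (simp only: g(4))
  qed
  have "(\<lambda>\<omega>. exp_neg (\<integral>\<^sup>+x. g i x \<partial>N \<omega>)) \<in> borel_measurable M \<and>
     (\<integral>\<^sup>+\<omega>. ennreal (exp_neg (\<integral>\<^sup>+x. g i x \<partial>N \<omega>)) \<partial>M) =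
    ennreal (exp_neg (\<integral>\<^sup>+x. ennreal (1 - exp_neg (g i x)) \<partial>\<mu>))" for i
  proof -
    obtain A :: "nat \<Rightarrow> 'b set" and c n where A: "range A \<subseteq> sets \<mu>" "disjoint_family A" "\<And>i. 0 \<le> c i"
      and rep: "\<And>x (h :: real \<Rightarrow> ennreal). x \<in> space \<mu> \<Longrightarrow> h (enn2real (g i x)) = (\<Sum>j<n. h (c j) * indicator (A j) x)"
      by (rule simple_function_as_finite_sum[OF g(1)[of i] g(3)[of i]]) (rule that, assumption+)
    have Am: "A j \<in> sets \<mu>" for j using A(1) by auto
    have 1: "(\<integral>\<^sup>+x. g i x \<partial>N \<omega>) = (\<Sum>j<n. ennreal (c j) * emeasure (N \<omega>) (A j))" if w: "\<omega> \<in> space M" for \<omega>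
    proof -
      have "(\<integral>\<^sup>+x. g i x \<partial>N \<omega>) = (\<integral>\<^sup>+x. (\<Sum>j<n. ennreal (c j) * indicator (A j) x) \<partial>N \<omega>)"
        using rep[of _ ennreal] g(3)[of i] sets_eq_imp_space_eq[OF setsN[OF w]]
        by (intro nn_integral_cong) simp
      then show ?thesis
        using Am setsN[OF w] by (simp only:) (subst nn_integral_sum, auto simp: nn_integral_cmult_indicator)
    qed
    have 2: "(\<integral>\<^sup>+x. ennreal (1 - exp_neg (g i x)) \<partial>\<mu>) = (\<Sum>j<n. ennreal (1 - exp (- c j)) * emeasure \<mu> (A j))"
    proof -
      have "(\<integral>\<^sup>+x. ennreal (1 - exp_neg (g i x)) \<partial>\<mu>) = (\<integral>\<^sup>+x. (\<Sum>j<n. ennreal (1 - exp (- c j)) * indicator (A j) x) \<partial>\<mu>)"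
        using rep[of _ "\<lambda>y. ennreal (1 - exp (- y))"] less_imp_neq[OF g(3)[of i]]
        by (intro nn_integral_cong) (simp only: exp_neg_def if_False)
      then show ?thesis using Am by (simp only:) (subst nn_integral_sum, auto simp: nn_integral_cmult_indicator)
    qed
    have [measurable]: "(\<lambda>\<omega>. emeasure (N \<omega>) (A j)) \<in> borel_measurable M" for j
      using N Am unfolding poisson_random_measure_def by auto
    have "(\<lambda>\<omega>. exp_neg (\<Sum>j<n. ennreal (c j) * emeasure (N \<omega>) (A j))) \<in> borel_measurable M"
      by measurable
    then have 3: "(\<lambda>\<omega>. exp_neg (\<integral>\<^sup>+x. g i x \<partial>N \<omega>)) \<in> borel_measurable M"
      by (rule measurable_cong[THEN iffD1, rotated]) (simp add: 1)
    have "(\<integral>\<^sup>+\<omega>. ennreal (exp_neg (\<integral>\<^sup>+x. g i x \<partial>N \<omega>)) \<partial>M) =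
        (\<integral>\<^sup>+\<omega>. ennreal (exp_neg (\<Sum>j<n. ennreal (c j) * emeasure (N \<omega>) (A j))) \<partial>M)"
      by (rule nn_integral_cong) (simp add: 1)
    also have "\<dots> = ennreal (exp_neg (\<Sum>j<n. ennreal (1 - exp (- c j)) * emeasure \<mu> (A j)))"
      by (rule poisson_random_measure_laplace_simple[OF M N A])
    finally show ?thesis using 3 by (simp add: 2)
  qed
  then have simple_meas: "(\<lambda>\<omega>. exp_neg (\<integral>\<^sup>+x. g i x \<partial>N \<omega>)) \<in> borel_measurable M"
    and simple_eq: "(\<integral>\<^sup>+\<omega>. ennreal (exp_neg (\<integral>\<^sup>+x. g i x \<partial>N \<omega>)) \<partial>M) =
    ennreal (exp_neg (\<integral>\<^sup>+x. ennreal (1 - exp_neg (g i x)) \<partial>\<mu>))" for i by simp_all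
  have lim1: "(\<lambda>i. exp_neg (\<integral>\<^sup>+x. g i x \<partial>N \<omega>)) \<longlonglongrightarrow> exp_neg (\<integral>\<^sup>+x. f x \<partial>N \<omega>)" if "\<omega> \<in> space M" for \<omega>
  proof (rule tendsto_exp_neg, rule nn_integral_LIMSEQ[OF g(2) _ glim])
    show "g i \<in> borel_measurable (N \<omega>)" for i
      using gm[of i] measurable_cong_sets[OF setsN[OF that], of borel borel] by blast
  qed
  have mf: "(\<lambda>\<omega>. exp_neg (\<integral>\<^sup>+x. f x \<partial>N \<omega>)) \<in> borel_measurable M"
  proof (rule borel_measurable_LIMSEQ_real[where u = "\<lambda>i \<omega>. exp_neg (\<integral>\<^sup>+x. g i x \<partial>N \<omega>)"])
    show "(\<lambda>\<omega>. exp_neg (\<integral>\<^sup>+x. g i x \<partial>N \<omega>)) \<in> borel_measurable M" for i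
      by (rule simple_meas)
    show "(\<lambda>i. exp_neg (\<integral>\<^sup>+x. g i x \<partial>N \<omega>)) \<longlonglongrightarrow> exp_neg (\<integral>\<^sup>+x. f x \<partial>N \<omega>)"
      if "\<omega> \<in> space M" for \<omega>
      using that by (rule lim1)
  qed
  have "(\<lambda>i. \<integral>\<^sup>+\<omega>. ennreal (exp_neg (\<integral>\<^sup>+x. g i x \<partial>N \<omega>)) \<partial>M) \<longlonglongrightarrow> (\<integral>\<^sup>+\<omega>. ennreal (exp_neg (\<integral>\<^sup>+x. f x \<partial>N \<omega>)) \<partial>M)"
    by (rule nn_integral_dominated_convergence[where w = "\<lambda>_. 1"])
       (use mf simple_meas lim1 in \<open>auto simp: emeasure_space_1 intro!: AE_I2 tendsto_ennrealI\<close>)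
  moreover have "(\<lambda>i. \<integral>\<^sup>+x. ennreal (1 - exp_neg (g i x)) \<partial>\<mu>) \<longlonglongrightarrow> (\<integral>\<^sup>+x. ennreal (1 - exp_neg (f x)) \<partial>\<mu>)"
  proof (rule nn_integral_LIMSEQ)
    show "incseq (\<lambda>i x. ennreal (1 - exp_neg (g i x)))"
      using g(2) by (auto simp: incseq_def le_fun_def intro!: ennreal_leI exp_neg_antimono)
    show "(\<lambda>i. ennreal (1 - exp_neg (g i x))) \<longlonglongrightarrow> ennreal (1 - exp_neg (f x))" for x
      by (intro tendsto_ennrealI tendsto_intros tendsto_exp_neg glim)
  qed auto
  then have "(\<lambda>i. ennreal (exp_neg (\<integral>\<^sup>+x. ennreal (1 - exp_neg (g i x)) \<partial>\<mu>))) \<longlonglongrightarrow> ennreal (exp_neg (\<integral>\<^sup>+x. ennreal (1 - exp_neg (f x)) \<partial>\<mu>))"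
    by (intro tendsto_ennrealI tendsto_exp_neg)
  ultimately show ?thesis
    unfolding simple_eq by (rule LIMSEQ_unique)
qed

section \<open>Uniqueness of Laplace transforms\<close>

text \<open>Equal moments give equal integrals of polynomials, hence of continuous functions by the Weierstrass
  theorem; piecewise linear functions then decrease to indicators of half-lines, which are the
  distribution functions.\<close>

lemma finite_measure_eqI_moments:
  fixes P Q :: "real measure"
  assumes P: "finite_borel_measure P" and Q: "finite_borel_measure Q"
    and P01: "AE x in P. x \<in> {0..1}" and Q01: "AE x in Q. x \<in> {0..1}"
    and moments: "\<And>n. (\<integral>x. x ^ n \<partial>P) = (\<integral>x. x ^ n \<partial>Q)"
  shows "P = Q"
proof -
  interpret P: finite_borel_measure P by fact
  interpret Q: finite_borel_measure Q by fact
  have intg: "integrable R f" if "finite_borel_measure R" "AE x in R. x \<in> {0..1}"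
    "continuous_on UNIV f" for R and f :: "real \<Rightarrow> real"
  proof -
    interpret R: finite_borel_measure R by fact
    have "compact (f ` {0..1})"
      by (intro compact_continuous_image continuous_on_subset[OF that(3)]) auto
    then obtain B where B: "\<And>x. x \<in> {0..1} \<Longrightarrow> \<bar>f x\<bar> \<le> B"
      using compact_imp_bounded[of "f ` {0..1}"] unfolding bounded_iff by (auto simp: image_iff) fastforce
    have "f \<in> borel_measurable R"
      using borel_measurable_continuous_onI[OF that(3)] by (simp add: measurable_def R.M_is_borel)
    then show ?thesis
      by (rule R.integrable_const_bound[rotated, of f B]) (use that(2) B in auto)
  qed
  have cont_eq: "(\<integral>x. f x \<partial>P) = (\<integral>x. f x \<partial>Q)" if f: "continuous_on UNIV f" for f :: "real \<Rightarrow> real"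
  proof -
    have "\<bar>(\<integral>x. f x \<partial>P) - (\<integral>x. f x \<partial>Q)\<bar> \<le> e * (measure P UNIV + measure Q UNIV)" if e: "e > 0" for e
    proof -
      obtain g where g: "real_polynomial_function g" "\<And>x. x \<in> {0..1} \<Longrightarrow> \<bar>f x - g x\<bar> < e"
        using Stone_Weierstrass_real_polynomial_function[of "{0..1::real}" f e] f e
          continuous_on_subset by blast
      obtain a n where gs: "g = (\<lambda>x. \<Sum>i\<le>n. a i * x ^ i)"
        using g(1) real_polynomial_function_iff_sum by blast
      have cg: "continuous_on UNIV g" unfolding gs by (intro continuous_intros)
      have ip: "integrable R (\<lambda>x. x ^ i)" if "finite_borel_measure R" "AE x in R. x \<in> {0..1}" for R and i :: nat
        by (intro intg that continuous_intros)
      have geq: "(\<integral>x. g x \<partial>P) = (\<integral>x. g x \<partial>Q)"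
        unfolding gs using ip[OF P P01] ip[OF Q Q01] moments by simp
      have bd: "\<bar>(\<integral>x. f x \<partial>R) - (\<integral>x. g x \<partial>R)\<bar> \<le> e * measure R UNIV"
        if R: "finite_borel_measure R" "AE x in R. x \<in> {0..1}" for R
      proof -
        interpret R: finite_borel_measure R by fact
        have "(\<integral>x. f x \<partial>R) - (\<integral>x. g x \<partial>R) = (\<integral>x. f x - g x \<partial>R)"
          using intg[OF R f] intg[OF R cg] by simp
        also have "\<bar>\<dots>\<bar> \<le> (\<integral>x. e \<partial>R)"
        proof -
          have "\<bar>\<integral>x. f x - g x \<partial>R\<bar> \<le> (\<integral>x. \<bar>f x - g x\<bar> \<partial>R)" by (rule integral_abs_bound)
          also have "\<dots> \<le> (\<integral>x. e \<partial>R)"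
            by (rule integral_mono_AE) (use intg[OF R f] intg[OF R cg] R(2) g(2) in \<open>auto intro: less_imp_le\<close>)
          finally show ?thesis .
        qed
        finally show ?thesis by (simp add: R.borel_UNIV mult.commute)
      qed
      show ?thesis using bd[OF P P01] bd[OF Q Q01] geq by (simp add: algebra_simps)
    qed
    then have *: "\<bar>(\<integral>x. f x \<partial>P) - (\<integral>x. f x \<partial>Q)\<bar> \<le> e * (measure P UNIV + measure Q UNIV + 1)" if "e > 0" for e
      using that by (smt (verit, best) mult_left_mono)
    have "\<bar>(\<integral>x. f x \<partial>P) - (\<integral>x. f x \<partial>Q)\<bar> \<le> e" if "e > 0" for e
      using *[of "e / (measure P UNIV + measure Q UNIV + 1)"] that
      by (smt (verit) divide_pos_pos measure_nonneg nonzero_mult_div_cancel_right times_divide_eq_left)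
    then show ?thesis using field_le_epsilon[of "\<bar>(\<integral>x. f x \<partial>P) - (\<integral>x. f x \<partial>Q)\<bar>" 0] by simp
  qed
  have "cdf P c = cdf Q c" for c
  proof -
    \<comment> \<open>Continuous piecewise linear functions that decrease to the indicator of \<open>(-\<infinity>, c]\<close>.\<close>
    define f where "f n x = max 0 (min 1 (1 - real n * (x - c)))" for n x
    have fc: "continuous_on UNIV (f n)" for n unfolding f_def by (intro continuous_intros)
    have lim: "(\<lambda>n. f n x) \<longlonglongrightarrow> indicator {..c} x" for x
    proof (cases "x \<le> c")
      case True
      then have "f n x = 1" for n by (simp add: f_def mult_nonneg_nonpos)
      then show ?thesis using True by simp
    next
      case False
      obtain N where N: "real N * (x - c) > 1" using False ex_less_of_nat_mult[of "x - c" 1] by auto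
      have "f n x = 0" if "n \<ge> N" for n
      proof -
        have "real N * (x - c) \<le> real n * (x - c)" using that False by (intro mult_right_mono) auto
        then show ?thesis using N by (simp add: f_def)
      qed
      then have "\<forall>\<^sub>F n in sequentially. f n x = 0" unfolding eventually_sequentially by blast
      then show ?thesis using False by (simp add: tendsto_eventually)
    qed
    have conv: "(\<lambda>n. \<integral>x. f n x \<partial>R) \<longlonglongrightarrow> cdf R c" if "finite_borel_measure R" for R
    proof -
      interpret R: finite_borel_measure R by fact
      have m: "f n \<in> borel_measurable R" for n
        using borel_measurable_continuous_onI[OF fc] by (simp add: measurable_def R.M_is_borel)
      have mi: "(indicator {..c} :: real \<Rightarrow> real) \<in> borel_measurable R"
        by (rule borel_measurable_indicator) (simp add: R.M_is_borel)
      have "(\<lambda>n. \<integral>x. f n x \<partial>R) \<longlonglongrightarrow> (\<integral>x. indicator {..c} x \<partial>R)"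
        by (rule integral_dominated_convergence[where w = "\<lambda>_. 1"])
           (use lim in \<open>auto simp: m mi, auto simp: f_def\<close>)
      then show ?thesis by (simp add: cdf_def R.borel_UNIV)
    qed
    have "(\<lambda>n. \<integral>x. f n x \<partial>P) = (\<lambda>n. \<integral>x. f n x \<partial>Q)" using cont_eq[OF fc] by auto
    then show ?thesis using conv[OF P] conv[OF Q] LIMSEQ_unique by auto
  qed
  then show ?thesis using cdf_unique'[OF P Q] by auto
qed

text \<open>Under the substitution \<open>s = e^(- x)\<close> the values of the Laplace transform at \<open>1, 2, 3, \<dots>\<close> become
  the moments of a finite measure on \<open>[0, 1]\<close>, namely of the image of \<open>e^(- x) f(x) dx\<close>.\<close>

lemma laplace_transform_unique:
  fixes f g :: "real \<Rightarrow> ennreal"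
  assumes f[measurable]: "f \<in> borel_measurable borel" and g[measurable]: "g \<in> borel_measurable borel"
    and f0: "\<And>x. x < 0 \<Longrightarrow> f x = 0" and g0: "\<And>x. x < 0 \<Longrightarrow> g x = 0"
    and eq: "\<And>l. l > 0 \<Longrightarrow> (\<integral>\<^sup>+x. ennreal (exp (- l * x)) * f x \<partial>lborel) = (\<integral>\<^sup>+x. ennreal (exp (- l * x)) * g x \<partial>lborel)"
    and fin: "\<And>l. l > 0 \<Longrightarrow> (\<integral>\<^sup>+x. ennreal (exp (- l * x)) * g x \<partial>lborel) < \<infinity>"
  shows "AE x in lborel. f x = g x"
proof -
  define A where "A f = density lborel (\<lambda>x. ennreal (exp (- x)) * f x)" for f :: "real \<Rightarrow> ennreal"
  define P where "P f = distr (A f) borel (\<lambda>x. exp (- x))" for f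
  have mA[measurable_cong]: "sets (A f) = sets borel" for f unfolding A_def by simp
  have key: "finite_borel_measure (P f) \<and> (AE x in P f. x \<in> {0..1}) \<and>
      (\<forall>n. (\<integral>x. x ^ n \<partial>P f) = enn2real (\<integral>\<^sup>+x. ennreal (exp (- real (Suc n) * x)) * f x \<partial>lborel)) \<and>
      A f = distr (P f) borel (\<lambda>x. - ln x)"
    if [measurable]: "f \<in> borel_measurable borel" and f0: "\<And>x. x < 0 \<Longrightarrow> f x = 0"
      and fin: "\<And>l. l > 0 \<Longrightarrow> (\<integral>\<^sup>+x. ennreal (exp (- l * x)) * f x \<partial>lborel) < \<infinity>" for f
  proof (intro conjI allI)
    have "emeasure (P f) (space (P f)) = (\<integral>\<^sup>+x. ennreal (exp (- 1 * x)) * f x \<partial>lborel)"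
      unfolding P_def A_def by (simp add: emeasure_distr emeasure_density)
    then show "finite_borel_measure (P f)"
      using fin[of 1] by (intro finite_borel_measure.intro finite_measureI finite_borel_measure_axioms.intro)
        (auto simp: P_def)
    have "AE x in A f. exp (- x) \<in> {0..1}"
      unfolding A_def by (subst AE_density, simp) (use f0 in \<open>auto intro!: AE_I2 simp: linorder_not_le[symmetric] dest: contrapos_nn[OF _ f0]\<close>)
    then show "AE x in P f. x \<in> {0..1}"
      unfolding P_def by (subst AE_distr_iff) auto
    show "(\<integral>x. x ^ n \<partial>P f) = enn2real (\<integral>\<^sup>+x. ennreal (exp (- real (Suc n) * x)) * f x \<partial>lborel)" for n
    proof -
      have "(\<integral>x. x ^ n \<partial>P f) = (\<integral>x. exp (- x) ^ n \<partial>A f)"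
        unfolding P_def by (subst integral_distr) auto
      also have "\<dots> = enn2real (\<integral>\<^sup>+x. ennreal (exp (- x) ^ n) \<partial>A f)"
        by (rule integral_eq_nn_integral) auto
      also have "(\<integral>\<^sup>+x. ennreal (exp (- x) ^ n) \<partial>A f) = (\<integral>\<^sup>+x. ennreal (exp (- x)) * f x * ennreal (exp (- x) ^ n) \<partial>lborel)"
        unfolding A_def by (subst nn_integral_density) auto
      also have "\<dots> = (\<integral>\<^sup>+x. ennreal (exp (- real (Suc n) * x)) * f x \<partial>lborel)"
      proof (rule nn_integral_cong)
        fix x :: real
        have "exp (- real (Suc n) * x) = exp (- x) * exp (- x) ^ n"
          by (simp add: exp_of_nat_mult[symmetric] exp_add[symmetric] algebra_simps)
        then show "ennreal (exp (- x)) * f x * ennreal (exp (- x) ^ n) = ennreal (exp (- real (Suc n) * x)) * f x"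
          by (simp add: ennreal_mult ac_simps)
      qed
      finally show ?thesis .
    qed
    show "A f = distr (P f) borel (\<lambda>x. - ln x)"
      unfolding P_def by (subst distr_distr) (auto simp: comp_def distr_id2 mA)
  qed
  note kf = key[OF f f0, OF _ ord_eq_less_trans[OF eq fin]] and kg = key[OF g g0 fin]
  have "P f = P g"
  proof (rule finite_measure_eqI_moments)
    show "(\<integral>x. x ^ n \<partial>P f) = (\<integral>x. x ^ n \<partial>P g)" for n
      using kf kg eq[of "real (Suc n)"] by (simp only: of_nat_0_less_iff zero_less_Suc)
  qed (use kf kg in blast)+
  then have "A f = A g" using kf kg by metis
  then have "AE x in lborel. ennreal (exp (- x)) * f x = ennreal (exp (- x)) * g x"
    unfolding A_def by (intro sigma_finite_measure.density_unique[OF lborel.sigma_finite_measure_axioms]) auto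
  then show ?thesis
    by eventually_elim (auto simp: ennreal_mult_cancel_left)
qed

section \<open>The Laplace transform of a subordinator\<close>

lemma levy_measure_tail_finite:
  assumes \<nu>: "levy_measure \<nu>" and x: "0 < x"
  shows "emeasure \<nu> {x<..} < \<infinity>"
proof -
  have [measurable_cong]: "sets \<nu> = sets borel" using \<nu> by (simp add: levy_measure_def)
  have "ennreal (min 1 x) * emeasure \<nu> {x<..} = (\<integral>\<^sup>+y. ennreal (min 1 x) * indicator {x<..} y \<partial>\<nu>)"
    by (subst nn_integral_cmult_indicator) auto
  also have "\<dots> \<le> (\<integral>\<^sup>+y. ennreal (min 1 y) \<partial>\<nu>)"
    using x by (intro nn_integral_mono) (auto simp: indicator_def intro!: ennreal_leI)
  also have "\<dots> < \<infinity>" using \<nu> by (simp add: levy_measure_def)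
  finally show ?thesis using x by (auto simp: ennreal_mult_less_top)
qed

text \<open>Needed for every exchange of integrals that involves \<open>\<nu>\<close>, which may have infinite mass near 0.\<close>

lemma levy_measure_sigma_finite:
  assumes \<nu>: "levy_measure \<nu>"
  shows "sigma_finite_measure \<nu>"
proof
  have sets: "sets \<nu> = sets borel" and null: "emeasure \<nu> {..0} = 0" using \<nu> by (auto simp: levy_measure_def)
  define \<A> where "\<A> = insert {..0} (range (\<lambda>n. {1 / real (Suc n)<..}))"
  have "y \<in> \<Union>\<A>" for y :: real
  proof (cases "y \<le> 0")
    case False
    then obtain n where "inverse (real (Suc n)) < y" using reals_Archimedean[of y] by auto
    then show ?thesis by (auto simp: \<A>_def inverse_eq_divide intro!: bexI[of _ n])
  qed (auto simp: \<A>_def)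
  then have "\<Union>\<A> = UNIV" by blast
  moreover have "space \<nu> = UNIV" using sets_eq_imp_space_eq[OF sets] by simp
  moreover have "emeasure \<nu> A \<noteq> \<infinity>" if "A \<in> \<A>" for A
  proof -
    have "emeasure \<nu> {1 / real (Suc n)<..} \<noteq> \<infinity>" for n
      using levy_measure_tail_finite[OF \<nu>, of "1 / real (Suc n)"] by simp
    then show ?thesis using that null by (auto simp: \<A>_def)
  qed
  ultimately show "\<exists>A. countable A \<and> A \<subseteq> sets \<nu> \<and> \<Union> A = space \<nu> \<and> (\<forall>a\<in>A. emeasure \<nu> a \<noteq> \<infinity>)"
    using sets by (intro exI[of _ \<A>] conjI) (auto simp: \<A>_def)
qed

lemma levy_measure_AE_pos:
  assumes \<nu>: "levy_measure \<nu>" shows "AE y in \<nu>. 0 < y"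
proof (rule AE_I')
  show "{..0} \<in> null_sets \<nu>" using \<nu> by (auto simp: levy_measure_def null_sets_def)
qed auto

lemma levy_measure_AE_exp_nonneg:
  assumes \<nu>: "levy_measure \<nu>" and l: "0 < l"
  shows "AE y in \<nu>. 0 \<le> 1 - exp (- l * y)"
  using levy_measure_AE_pos[OF \<nu>] by eventually_elim (use l in auto)

lemma levy_measure_exp_integrable:
  assumes \<nu>: "levy_measure \<nu>" and l: "0 < l"
  shows "integrable \<nu> (\<lambda>y. 1 - exp (- l * y))"
proof (rule integrableI_nonneg)
  have [measurable_cong]: "sets \<nu> = sets borel" using \<nu> by (simp add: levy_measure_def)
  show "(\<lambda>y. 1 - exp (- l * y)) \<in> borel_measurable \<nu>" by measurable
  show "AE y in \<nu>. 0 \<le> 1 - exp (- l * y)" by (rule levy_measure_AE_exp_nonneg[OF \<nu> l])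
  have "(\<integral>\<^sup>+y. ennreal (1 - exp (- l * y)) \<partial>\<nu>) \<le> (\<integral>\<^sup>+y. ennreal (max 1 l) * ennreal (min 1 y) \<partial>\<nu>)"
  proof (rule nn_integral_mono_AE, use levy_measure_AE_pos[OF \<nu>] in eventually_elim)
    case (elim y)
    have "1 - exp (- l * y) \<le> max 1 l * min 1 y"
    proof (cases "y \<le> 1")
      case True
      have "1 - exp (- l * y) \<le> l * y" using exp_ge_add_one_self[of "- l * y"] by simp
      also have "\<dots> \<le> max 1 l * y" using elim by (intro mult_right_mono) auto
      finally show ?thesis using True by simp
    qed (smt (verit) exp_ge_zero mult_cancel_left1 min_def)
    then have "ennreal (1 - exp (- l * y)) \<le> ennreal (max 1 l * min 1 y)" by (rule ennreal_leI)
    then show ?case using elim by (simp add: ennreal_mult)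
  qed
  also have "\<dots> < \<infinity>" using \<nu> by (subst nn_integral_cmult) (auto simp: levy_measure_def ennreal_mult_less_top)
  finally show "(\<integral>\<^sup>+y. ennreal (1 - exp (- l * y)) \<partial>\<nu>) < \<infinity>" .
qed

definition laplace_exponent :: "real \<Rightarrow> real measure \<Rightarrow> real \<Rightarrow> real" where
  "laplace_exponent \<delta> \<nu> l = \<delta> * l + (\<integral>y. 1 - exp (- l * y) \<partial>\<nu>)"

text \<open>A monotone path lies above its left limits.\<close>

lemma subordinator_jump_nonneg:
  assumes "subordinator M X"
  shows "AE \<omega> in M. \<forall>s>0. 0 \<le> jump X s \<omega>"
proof -
  have "AE \<omega> in M. \<forall>t>0. \<exists>l. ((\<lambda>s. X s \<omega>) \<longlongrightarrow> l) (at_left t)" "AE \<omega> in M. mono_on {0..} (\<lambda>t. X t \<omega>)"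
    using assms by (auto simp: subordinator_def levy_process_def)
  then show ?thesis
  proof eventually_elim
    case (elim \<omega>)
    show ?case
    proof (intro allI impI)
      fix s :: real assume s: "0 < s"
      then obtain l where l: "((\<lambda>s. X s \<omega>) \<longlongrightarrow> l) (at_left s)" using elim by blast
      have "\<forall>\<^sub>F r in at_left s. X r \<omega> \<le> X s \<omega>"
        using eventually_at_left_real[OF s]
        by eventually_elim (use elim(2) s in \<open>auto simp: mono_on_def\<close>)
      then have "l \<le> X s \<omega>" by (rule tendsto_upperbound[OF l]) simp
      moreover have "Lim (at_left s) (\<lambda>r. X r \<omega>) = l" by (rule tendsto_Lim[OF _ l]) simp
      ultimately show "0 \<le> jump X s \<omega>" by (simp add: jump_def)
    qed
  qed
qed

lemma nn_integral_count_space_has_sum: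
  fixes f :: "'b \<Rightarrow> real"
  assumes "(f has_sum S) A" "\<And>x. x \<in> A \<Longrightarrow> 0 \<le> f x"
  shows "(\<integral>\<^sup>+x. ennreal (f x) \<partial>count_space A) = ennreal S"
proof -
  have "f summable_on A" using assms(1) summable_on_def by blast
  then have s: "Infinite_Set_Sum.abs_summable_on f A"
    using abs_summable_equivalent summable_on_iff_abs_summable_on_real by blast
  show ?thesis
    using nn_integral_conv_infsetsum[OF s assms(2)] infsetsum_infsum[OF s] infsumI[OF assms(1)] by simp
qed

text \<open>The jump part \<open>X t - \<delta> t\<close> is the integral of \<open>(s, y) \<mapsto> y\<close> over \<open>s \<le> t\<close> against the
  Poisson random measure of the jumps, so the exponential formula gives its Laplace transform.\<close>

lemma subordinator_laplace_transform:
  assumes sub: "subordinator M X" and dl: "has_drift_and_levy_measure M X \<delta> \<nu>"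
    and t: "0 \<le> t" and l: "0 < l"
  shows "(\<integral>\<^sup>+\<omega>. ennreal (exp (- l * X t \<omega>)) \<partial>M) = ennreal (exp (- t * laplace_exponent \<delta> \<nu> l))"
proof -
  interpret prob_space M using sub by (simp add: subordinator_def levy_process_def)
  have [measurable]: "X t \<in> borel_measurable M" using sub t by (simp add: subordinator_def levy_process_def)
  have \<nu>: "levy_measure \<nu>" using dl by (simp add: has_drift_and_levy_measure_def)
  interpret \<nu>: sigma_finite_measure \<nu> by (rule levy_measure_sigma_finite[OF \<nu>])
  have [measurable_cong]: "sets \<nu> = sets borel" using \<nu> by (simp add: levy_measure_def)
  let ?\<mu> = "density lborel (indicator {0<..}) \<Otimes>\<^sub>M \<nu>"
  obtain N where N: "poisson_random_measure M ?\<mu> N" and NJ: "AE \<omega> in M. N \<omega> = jump_measure X \<omega>"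
    using dl by (auto simp: has_drift_and_levy_measure_def)
  define f :: "real \<times> real \<Rightarrow> ennreal" where "f = (\<lambda>(s, y). indicator {0<..t} s * ennreal (l * y))"
  have sets\<mu>: "sets ?\<mu> = sets (borel \<Otimes>\<^sub>M borel)" by (intro sets_pair_measure_cong) (auto simp: \<open>sets \<nu> = sets borel\<close>)
  have fm: "f \<in> borel_measurable (borel \<Otimes>\<^sub>M borel)" unfolding f_def by measurable
  have path: "AE \<omega> in M. (\<integral>\<^sup>+x. f x \<partial>N \<omega>) = ennreal (l * (X t \<omega> - \<delta> * t))"
  proof -
    have "AE \<omega> in M. \<forall>t\<ge>0. ((\<lambda>s. jump X s \<omega>) has_sum (X t \<omega> - \<delta> * t)) {0<..t}"
      using dl by (simp add: has_drift_and_levy_measure_def)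
    with NJ subordinator_jump_nonneg[OF sub] show ?thesis
    proof eventually_elim
      case (elim \<omega>)
      let ?S = "{s. 0 < s \<and> jump X s \<omega> \<noteq> 0}"
      have "(\<integral>\<^sup>+x. f x \<partial>N \<omega>) = (\<integral>\<^sup>+s. f (s, jump X s \<omega>) \<partial>count_space ?S)"
        unfolding elim(1) jump_measure_def
        by (subst nn_integral_distr) (use fm in \<open>auto simp: borel_prod\<close>)
      also have "\<dots> = (\<integral>\<^sup>+s. ennreal (l * jump X s \<omega>) \<partial>count_space {0<..t})"
        by (subst (1 2) nn_integral_count_space_indicator)
           (auto intro!: nn_integral_cong simp: f_def indicator_def)
      also have "\<dots> = ennreal (l * (X t \<omega> - \<delta> * t))"
        using elim t l by (intro nn_integral_count_space_has_sum has_sum_cmult_right) auto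
      finally show ?case .
    qed
  qed
  have pos: "AE \<omega> in M. 0 \<le> X t \<omega> - \<delta> * t"
  proof -
    have "AE \<omega> in M. \<forall>t\<ge>0. ((\<lambda>s. jump X s \<omega>) has_sum (X t \<omega> - \<delta> * t)) {0<..t}"
      using dl by (simp add: has_drift_and_levy_measure_def)
    with subordinator_jump_nonneg[OF sub] show ?thesis
    proof eventually_elim
      case (elim \<omega>)
      then have "((\<lambda>s. jump X s \<omega>) has_sum (X t \<omega> - \<delta> * t)) {0<..t}" using t by blast
      then show ?case by (rule has_sum_nonneg) (use elim in auto)
    qed
  qed
  note nn = levy_measure_AE_exp_nonneg[OF \<nu> l]
  define C where "C = (\<integral>y. 1 - exp (- l * y) \<partial>\<nu>)"
  have C: "(\<integral>\<^sup>+y. ennreal (1 - exp (- l * y)) \<partial>\<nu>) = ennreal C"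
    unfolding C_def
    by (rule nn_integral_eq_integral[OF levy_measure_exp_integrable[OF \<nu> l]])
       (use nn in auto)
  have C0: "0 \<le> C" unfolding C_def
    by (rule integral_nonneg_AE[OF nn])
  have int: "(\<integral>\<^sup>+x. ennreal (1 - exp_neg (f x)) \<partial>?\<mu>) = ennreal (t * C)"
  proof -
    have f\<mu>: "(\<lambda>x. ennreal (1 - exp_neg (f x))) \<in> borel_measurable ?\<mu>"
      using fm by (subst measurable_cong_sets[OF sets\<mu> refl]) measurable
    have inner: "(\<integral>\<^sup>+y. ennreal (1 - exp_neg (f (s, y))) \<partial>\<nu>) = indicator {0<..t} s * ennreal C" for s
    proof -
      have "(\<integral>\<^sup>+y. ennreal (1 - exp_neg (f (s, y))) \<partial>\<nu>) = (\<integral>\<^sup>+y. indicator {0<..t} s * ennreal (1 - exp (- l * y)) \<partial>\<nu>)"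
        by (rule nn_integral_cong_AE, use levy_measure_AE_pos[OF \<nu>] in eventually_elim)
           (use l in \<open>auto simp: f_def indicator_def\<close>)
      then show ?thesis by (simp add: nn_integral_cmult C[simplified])
    qed
    have "(\<integral>\<^sup>+x. ennreal (1 - exp_neg (f x)) \<partial>?\<mu>) =
       (\<integral>\<^sup>+s. indicator {0<..t} s * ennreal C \<partial>density lborel (indicator {0<..}))"
      using \<nu>.nn_integral_fst[OF f\<mu>] by (simp add: inner)
    also have "\<dots> = (\<integral>\<^sup>+s. ennreal C * indicator {0<..t} s \<partial>lborel)"
      by (subst nn_integral_density) (auto intro!: nn_integral_cong simp: indicator_def)
    also have "\<dots> = ennreal (t * C)" using t C0 by (simp add: nn_integral_cmult_indicator ennreal_mult mult.commute)
    finally show ?thesis .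
  qed
  have "(\<integral>\<^sup>+\<omega>. ennreal (exp (- l * X t \<omega>)) \<partial>M) =
     (\<integral>\<^sup>+\<omega>. ennreal (exp (- l * \<delta> * t)) * ennreal (exp (- (l * (X t \<omega> - \<delta> * t)))) \<partial>M)"
    by (simp add: ennreal_mult[symmetric] exp_add[symmetric] algebra_simps)
  also have "\<dots> = ennreal (exp (- l * \<delta> * t)) * (\<integral>\<^sup>+\<omega>. ennreal (exp (- (l * (X t \<omega> - \<delta> * t)))) \<partial>M)"
    by (rule nn_integral_cmult) measurable
  also have "(\<integral>\<^sup>+\<omega>. ennreal (exp (- (l * (X t \<omega> - \<delta> * t)))) \<partial>M) =
     (\<integral>\<^sup>+\<omega>. ennreal (exp_neg (\<integral>\<^sup>+x. f x \<partial>N \<omega>)) \<partial>M)"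
  proof (rule nn_integral_cong_AE, use path pos in eventually_elim)
    case (elim \<omega>)
    then have "0 \<le> l * (X t \<omega> - \<delta> * t)" using l by simp
    then show ?case unfolding elim(1) by simp
  qed
  also have "(\<integral>\<^sup>+\<omega>. ennreal (exp_neg (\<integral>\<^sup>+x. f x \<partial>N \<omega>)) \<partial>M) = ennreal (exp (- (t * C)))"
    using poisson_random_measure_laplace_functional[OF prob_space_axioms N, of f] fm t C0
    by (simp add: int measurable_cong_sets[OF sets\<mu> refl])
  also have "ennreal (exp (- l * \<delta> * t)) * ennreal (exp (- (t * C))) = ennreal (exp (- t * laplace_exponent \<delta> \<nu> l))"
    by (simp add: ennreal_mult[symmetric] exp_add[symmetric] laplace_exponent_def C_def algebra_simps)
  finally show ?thesis .
qed

section \<open>Discounted potential measures\<close>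

text \<open>The paths of \<open>X\<close> are right continuous only outside a null set, so \<open>(t, \<omega>) \<mapsto> X t \<omega>\<close> need
  not be jointly measurable.  The limit of the values at grid points that approach \<open>t\<close> from the right is
  jointly measurable, and off the null set it is the path itself.\<close>

definition path_version :: "(real \<Rightarrow> 'a \<Rightarrow> real) \<Rightarrow> real \<Rightarrow> 'a \<Rightarrow> real" where
  "path_version X t \<omega> = lim (\<lambda>n. X ((real (nat \<lfloor>t * real (Suc n)\<rfloor>) + 1) / real (Suc n)) \<omega>)"

text \<open>For fixed \<open>n\<close> the grid point takes countably many values, and for each of them the value of \<open>X\<close>
  there is measurable in \<open>\<omega>\<close>.\<close>

lemma path_version_measurable:
  assumes X: "levy_process M X"
  shows "(\<lambda>p. path_version X (fst p) (snd p)) \<in> borel_measurable (lborel \<Otimes>\<^sub>M M)"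
proof -
  have X: "X t \<in> borel_measurable M" if "0 \<le> t" for t using X that by (simp add: levy_process_def)
  have "(\<lambda>p. X ((real (nat \<lfloor>fst p * real (Suc n)\<rfloor>) + 1) / real (Suc n)) (snd p)) \<in> borel_measurable (lborel \<Otimes>\<^sub>M M)" for n
  proof (rule measurable_compose_countable[where f = "\<lambda>i p. X ((real i + 1) / real (Suc n)) (snd p)" and g = "\<lambda>p. nat \<lfloor>fst p * real (Suc n)\<rfloor>"])
    show "(\<lambda>p. X ((real i + 1) / real (Suc n)) (snd p)) \<in> borel_measurable (lborel \<Otimes>\<^sub>M M)" for i
      using X[of "(real i + 1) / real (Suc n)"] by (intro measurable_compose[OF measurable_snd]) auto
    show "(\<lambda>p. nat \<lfloor>fst p * real (Suc n)\<rfloor>) \<in> lborel \<Otimes>\<^sub>M M \<rightarrow>\<^sub>M count_space UNIV"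
      by measurable
  qed
  then show ?thesis unfolding path_version_def by (rule borel_measurable_lim_metric)
qed

lemma path_version_eq:
  assumes "levy_process M X"
  shows "AE \<omega> in M. \<forall>t\<ge>0. path_version X t \<omega> = X t \<omega>"
proof -
  have "AE \<omega> in M. \<forall>t\<ge>0. ((\<lambda>s. X s \<omega>) \<longlongrightarrow> X t \<omega>) (at_right t)"
    using assms by (simp add: levy_process_def)
  then show ?thesis
  proof eventually_elim
    case (elim \<omega>)
    show ?case
    proof (intro allI impI)
      fix t :: real assume t: "0 \<le> t"
      define d where "d n = (real (nat \<lfloor>t * real (Suc n)\<rfloor>) + 1) / real (Suc n)" for n
      have lo: "t < d n" and hi: "d n \<le> t + 1 / real (Suc n)" for n
      proof -
        have e: "real (nat \<lfloor>t * real (Suc n)\<rfloor>) = of_int \<lfloor>t * real (Suc n)\<rfloor>" using t by simp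
        have "t * real (Suc n) < real (nat \<lfloor>t * real (Suc n)\<rfloor>) + 1" unfolding e by linarith
        then show "t < d n" by (simp only: d_def pos_less_divide_eq of_nat_0_less_iff zero_less_Suc)
        have "d n \<le> (t * real (Suc n) + 1) / real (Suc n)"
          unfolding d_def e by (intro divide_right_mono add_right_mono) auto
        also have "\<dots> = t + 1 / real (Suc n)" by (simp only: add_divide_distrib) simp
        finally show "d n \<le> t + 1 / real (Suc n)" .
      qed
      have "d \<longlonglongrightarrow> t"
      proof (rule tendsto_sandwich[OF _ _ tendsto_const])
        show "(\<lambda>n. t + 1 / real (Suc n)) \<longlonglongrightarrow> t"
          using tendsto_add[OF tendsto_const[of t] LIMSEQ_Suc[OF lim_const_over_n[of 1]]] by simp
      qed (intro always_eventually allI less_imp_le lo, intro always_eventually allI hi)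
      then have "filterlim d (at_right t) sequentially"
        using less_imp_neq[OF lo] by (simp add: filterlim_at lo eq_commute)
      then have "(\<lambda>n. X (d n) \<omega>) \<longlonglongrightarrow> X t \<omega>"
        using elim t by (auto intro: filterlim_compose)
      then show "path_version X t \<omega> = X t \<omega>" unfolding path_version_def d_def by (rule limI)
    qed
  qed
qed

text \<open>The measure \<open>E [\<integral> e^(- q t) 1{X t \<in> dx} dt]\<close>.  For \<open>q = 0\<close> it is the potential measure; for
  \<open>q = 1\<close> it is the law of \<open>X\<close> at an independent standard exponential time.\<close>

definition discounted_potential :: "'a measure \<Rightarrow> (real \<Rightarrow> 'a \<Rightarrow> real) \<Rightarrow> real \<Rightarrow> real measure" where
  "discounted_potential M X q =
     distr (density (lborel \<Otimes>\<^sub>M M) (\<lambda>(t, \<omega>). indicator {0..} t * ennreal (exp (- q * t)))) borel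
       (\<lambda>(t, \<omega>). path_version X t \<omega>)"

lemma sets_discounted_potential [simp]: "sets (discounted_potential M X q) = sets borel"
  by (simp add: discounted_potential_def)

lemma nn_integral_discounted_potential_pair:
  assumes X: "levy_process M X" and [measurable]: "g \<in> borel_measurable borel"
  shows "(\<integral>\<^sup>+x. g x \<partial>discounted_potential M X q) =
    (\<integral>\<^sup>+p. indicator {0..} (fst p) * ennreal (exp (- q * fst p)) * g (path_version X (fst p) (snd p)) \<partial>(lborel \<Otimes>\<^sub>M M))"
proof -
  note m[measurable] = path_version_measurable[OF X]
  show ?thesis
    unfolding discounted_potential_def
    by (subst nn_integral_distr, simp_all add: case_prod_beta)
       (subst nn_integral_density, auto simp: case_prod_beta)
qed

lemma nn_integral_discounted_potential:
  assumes X: "levy_process M X" and [measurable]: "g \<in> borel_measurable borel"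
  shows "(\<integral>\<^sup>+x. g x \<partial>discounted_potential M X q) =
    (\<integral>\<^sup>+t. indicator {0..} t * ennreal (exp (- q * t)) * (\<integral>\<^sup>+\<omega>. g (X t \<omega>) \<partial>M) \<partial>lborel)"
proof -
  interpret prob_space M using X by (simp add: levy_process_def)
  note m[measurable] = path_version_measurable[OF X]
  have mt: "path_version X t \<in> borel_measurable M" for t
    using measurable_Pair2[OF m, of t] by simp
  have "(\<integral>\<^sup>+x. g x \<partial>discounted_potential M X q) =
     (\<integral>\<^sup>+t. \<integral>\<^sup>+\<omega>. indicator {0..} t * ennreal (exp (- q * t)) * g (path_version X t \<omega>) \<partial>M \<partial>lborel)"
    unfolding nn_integral_discounted_potential_pair[OF assms] by (subst nn_integral_fst[symmetric]) auto
  also have "\<dots> = (\<integral>\<^sup>+t. indicator {0..} t * ennreal (exp (- q * t)) * (\<integral>\<^sup>+\<omega>. g (X t \<omega>) \<partial>M) \<partial>lborel)"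
  proof (rule nn_integral_cong)
    fix t :: real
    have "(\<integral>\<^sup>+\<omega>. indicator {0..} t * ennreal (exp (- q * t)) * g (path_version X t \<omega>) \<partial>M)
        = indicator {0..} t * ennreal (exp (- q * t)) * (\<integral>\<^sup>+\<omega>. g (path_version X t \<omega>) \<partial>M)"
      using mt by (intro nn_integral_cmult) measurable
    also have "\<dots> = indicator {0..} t * ennreal (exp (- q * t)) * (\<integral>\<^sup>+\<omega>. g (X t \<omega>) \<partial>M)"
    proof (cases "t \<ge> 0")
      case True
      have "(\<integral>\<^sup>+\<omega>. g (path_version X t \<omega>) \<partial>M) = (\<integral>\<^sup>+\<omega>. g (X t \<omega>) \<partial>M)"
        by (rule nn_integral_cong_AE, use path_version_eq[OF X] in eventually_elim) (use True in auto)
      then show ?thesis by simp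
    qed simp
    finally show "(\<integral>\<^sup>+\<omega>. indicator {0..} t * ennreal (exp (- q * t)) * g (path_version X t \<omega>) \<partial>M) =
        indicator {0..} t * ennreal (exp (- q * t)) * (\<integral>\<^sup>+\<omega>. g (X t \<omega>) \<partial>M)" .
  qed
  finally show ?thesis .
qed

text \<open>The potential measure is defined from a set function that involves \<open>X\<close> itself.  Replacing the paths by
  their jointly measurable version changes the inner integral only on a null set, and Tonelli's theorem
  then shows that the set function is a measure.\<close>

lemma potential_measure_eq:
  assumes X: "levy_process M X"
  shows "potential_measure M X = discounted_potential M X 0"
proof -
  interpret prob_space M using X by (simp add: levy_process_def)
  let ?U = "discounted_potential M X 0"
  note m[measurable] = path_version_measurable[OF X]
  have "(\<integral>\<^sup>+\<omega>. (\<integral>\<^sup>+t\<in>{0..}. indicator A (X t \<omega>) \<partial>lborel) \<partial>M) = emeasure ?U A" if "A \<in> sets borel" for A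
  proof -
    have [measurable]: "A \<in> sets borel" by fact
    have "(\<integral>\<^sup>+\<omega>. (\<integral>\<^sup>+t\<in>{0..}. indicator A (X t \<omega>) \<partial>lborel) \<partial>M) =
        (\<integral>\<^sup>+\<omega>. (\<integral>\<^sup>+t. indicator {0..} t * indicator A (path_version X t \<omega>) \<partial>lborel) \<partial>M)"
      by (rule nn_integral_cong_AE, use path_version_eq[OF X] in eventually_elim)
         (auto intro!: nn_integral_cong simp: indicator_def)
    also have "\<dots> = (\<integral>\<^sup>+p. indicator {0..} (fst p) * indicator A (path_version X (fst p) (snd p)) \<partial>(lborel \<Otimes>\<^sub>M M))"
    proof -
      interpret pair_sigma_finite lborel M by unfold_locales
      show ?thesis by (subst nn_integral_snd[symmetric]) auto
    qed
    also have "\<dots> = (\<integral>\<^sup>+x. indicator A x \<partial>?U)"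
      by (subst nn_integral_discounted_potential_pair[OF X]) auto
    finally show ?thesis by simp
  qed
  then have "potential_measure M X = measure_of UNIV (sets borel) (emeasure ?U)"
    unfolding potential_measure_def
    by (intro measure_of_eq) (auto simp: sets.sigma_sets_eq[of borel, simplified])
  also have "\<dots> = ?U"
    using measure_of_of_measure[of ?U] sets_eq_imp_space_eq[of ?U borel] by simp
  finally show ?thesis .
qed

text \<open>The discount factors \<open>e^(- q t)\<close> are positive, so they do not affect where the integrand vanishes.\<close>

lemma discounted_potential_null_iff:
  assumes X: "levy_process M X" and A: "A \<in> sets borel"
  shows "emeasure (discounted_potential M X p) A = 0 \<longleftrightarrow> emeasure (discounted_potential M X q) A = 0"
proof -
  note m[measurable] = path_version_measurable[OF X]
  have "emeasure (discounted_potential M X q) A = 0 \<longleftrightarrow>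
    (AE p in lborel \<Otimes>\<^sub>M M. indicator {0..} (fst p) * (indicator A (path_version X (fst p) (snd p)) :: ennreal) = 0)" for q
  proof -
    have [measurable]: "A \<in> sets borel" by fact
    have "emeasure (discounted_potential M X q) A = (\<integral>\<^sup>+x. indicator A x \<partial>discounted_potential M X q)"
      using A by simp
    also have "\<dots> = 0 \<longleftrightarrow> (AE p in lborel \<Otimes>\<^sub>M M. indicator {0..} (fst p) * ennreal (exp (- q * fst p)) * (indicator A (path_version X (fst p) (snd p)) :: ennreal) = 0)"
      by (subst nn_integral_discounted_potential_pair[OF X]) (auto simp: nn_integral_0_iff_AE)
    finally show ?thesis by (simp add: mult.assoc)
  qed
  then show ?thesis by simp
qed

lemma laplace_exponent_pos:
  assumes "levy_measure \<nu>" "0 < \<delta>" "0 < l"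
  shows "0 < laplace_exponent \<delta> \<nu> l"
proof -
  have "0 \<le> (\<integral>y. 1 - exp (- l * y) \<partial>\<nu>)"
    by (rule integral_nonneg_AE[OF levy_measure_AE_exp_nonneg[OF assms(1,3)]])
  then show ?thesis using assms by (simp add: laplace_exponent_def add_pos_nonneg)
qed

lemma nn_integral_exp_atLeast_0:
  assumes c: "0 < (c::real)"
  shows "(\<integral>\<^sup>+t. indicator {0..} t * ennreal (exp (- c * t)) \<partial>lborel) = ennreal (1 / c)"
proof -
  have "(\<integral>\<^sup>+t. ennreal (exp (- c * t)) * indicator {0..} t \<partial>lborel) = ennreal (0 - (- exp (- c * 0) / c))"
  proof (rule nn_integral_FTC_atLeast)
    show "((\<lambda>t. - exp (- c * t) / c) has_real_derivative exp (- c * t)) (at t)" for t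
      using c by (auto intro!: derivative_eq_intros)
    have "((\<lambda>t. exp (- (c * t))) \<longlongrightarrow> 0) at_top"
      by (intro filterlim_compose[OF exp_at_bot] filterlim_uminus_at_top[THEN iffD1]
          filterlim_tendsto_pos_mult_at_top[OF tendsto_const c] filterlim_ident)
    then show "((\<lambda>t. - exp (- c * t) / c) \<longlongrightarrow> 0) at_top"
      using tendsto_divide[OF tendsto_minus, of _ 0 _ "\<lambda>_. c" c] c by fastforce
  qed auto
  then show ?thesis by (simp add: mult.commute)
qed

lemma discounted_potential_laplace:
  assumes sub: "subordinator M X" and dl: "has_drift_and_levy_measure M X \<delta> \<nu>"
    and l: "0 < l" and q: "0 \<le> q" and \<delta>: "0 < \<delta>"
  shows "(\<integral>\<^sup>+x. ennreal (exp (- l * x)) \<partial>discounted_potential M X q) = ennreal (1 / (q + laplace_exponent \<delta> \<nu> l))"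
proof -
  have X: "levy_process M X" using sub by (simp add: subordinator_def)
  have \<phi>: "0 < q + laplace_exponent \<delta> \<nu> l"
    using laplace_exponent_pos[OF _ \<delta> l] dl q by (auto simp: has_drift_and_levy_measure_def add_nonneg_pos)
  have "(\<integral>\<^sup>+x. ennreal (exp (- l * x)) \<partial>discounted_potential M X q) =
     (\<integral>\<^sup>+t. indicator {0..} t * ennreal (exp (- q * t)) * (\<integral>\<^sup>+\<omega>. ennreal (exp (- l * X t \<omega>)) \<partial>M) \<partial>lborel)"
    by (rule nn_integral_discounted_potential[OF X]) measurable
  also have "\<dots> = (\<integral>\<^sup>+t. indicator {0..} t * ennreal (exp (- (q + laplace_exponent \<delta> \<nu> l) * t)) \<partial>lborel)"
  proof (rule nn_integral_cong)
    fix t :: real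
    show "indicator {0..} t * ennreal (exp (- q * t)) * (\<integral>\<^sup>+\<omega>. ennreal (exp (- l * X t \<omega>)) \<partial>M) =
       indicator {0..} t * ennreal (exp (- (q + laplace_exponent \<delta> \<nu> l) * t))"
    proof (cases "0 \<le> t")
      case True
      then show ?thesis
        unfolding subordinator_laplace_transform[OF sub dl True l]
        by (simp add: ennreal_mult[symmetric] exp_add[symmetric] algebra_simps)
    qed simp
  qed
  also have "\<dots> = ennreal (1 / (q + laplace_exponent \<delta> \<nu> l))" by (rule nn_integral_exp_atLeast_0[OF \<phi>])
  finally show ?thesis .
qed

lemma discounted_potential_total_mass:
  assumes X: "levy_process M X"
  shows "emeasure (discounted_potential M X 1) UNIV = 1"
proof -
  interpret prob_space M using X by (simp add: levy_process_def)
  have "emeasure (discounted_potential M X 1) UNIV = (\<integral>\<^sup>+x. 1 \<partial>discounted_potential M X 1)"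
    using sets_eq_imp_space_eq[OF sets_discounted_potential[of M X 1]] by simp
  also have "\<dots> = (\<integral>\<^sup>+t. indicator {0..} t * ennreal (exp (- 1 * t)) \<partial>lborel)"
    by (subst nn_integral_discounted_potential[OF X]) (auto simp: emeasure_space_1)
  finally show ?thesis using nn_integral_exp_atLeast_0[of 1] by simp
qed

text \<open>From \<open>1 - e^(- \<phi>(l)) = E [1 - e^(- l X 1)] \<le> l E \<bar>X 1\<bar>\<close> it follows that \<open>\<phi>(l) = O(l)\<close> as
  \<open>l\<close> decreases to 0.  Hence \<open>\<integral> (1 - e^(- l y)) / l \<nu>(dy)\<close> stays bounded, and Fatou's lemma along
  \<open>l = 1 / n\<close> bounds \<open>\<integral> y \<nu>(dy)\<close>.\<close>

lemma levy_measure_mean_finite: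
  assumes sub: "subordinator M X" and dl: "has_drift_and_levy_measure M X \<delta> \<nu>" and \<delta>: "0 < \<delta>"
    and int: "integrable M (X 1)"
  shows "(\<integral>\<^sup>+y. ennreal y \<partial>\<nu>) < \<infinity>"
proof -
  interpret prob_space M using sub by (simp add: subordinator_def levy_process_def)
  have \<nu>: "levy_measure \<nu>" using dl by (simp add: has_drift_and_levy_measure_def)
  have [measurable_cong]: "sets \<nu> = sets borel" using \<nu> by (simp add: levy_measure_def)
  have [measurable]: "X 1 \<in> borel_measurable M" using int by auto
  define m where "m = (\<integral>\<omega>. \<bar>X 1 \<omega>\<bar> \<partial>M)"
  have m: "0 \<le> m" unfolding m_def by simp
  have bound: "(\<integral>y. 1 - exp (- l * y) \<partial>\<nu>) \<le> 2 * l * m" if l: "0 < l" "l * m \<le> 1 / 2" for l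
  proof -
    let ?\<phi> = "laplace_exponent \<delta> \<nu> l"
    have \<phi>: "0 < ?\<phi>" by (rule laplace_exponent_pos[OF \<nu> \<delta> l(1)])
    have lt: "(\<integral>\<^sup>+\<omega>. ennreal (exp (- l * X 1 \<omega>)) \<partial>M) = ennreal (exp (- ?\<phi>))"
      using subordinator_laplace_transform[OF sub dl, of 1 l] l by simp
    have ie: "integrable M (\<lambda>\<omega>. exp (- l * X 1 \<omega>))"
      by (rule integrableI_nonneg) (use lt in auto)
    have "exp (- ?\<phi>) = (\<integral>\<omega>. exp (- l * X 1 \<omega>) \<partial>M)"
      using nn_integral_eq_integral[OF ie] lt by simp
    also have "\<dots> \<ge> (\<integral>\<omega>. 1 - l * \<bar>X 1 \<omega>\<bar> \<partial>M)"
    proof (rule integral_mono)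
      show "1 - l * \<bar>X 1 \<omega>\<bar> \<le> exp (- l * X 1 \<omega>)" for \<omega>
      proof -
        have "l * X 1 \<omega> \<le> l * \<bar>X 1 \<omega>\<bar>" using l by (intro mult_left_mono) auto
        then show ?thesis using exp_ge_add_one_self[of "- l * X 1 \<omega>"] by simp
      qed
    qed (use int ie in auto)
    also have "(\<integral>\<omega>. 1 - l * \<bar>X 1 \<omega>\<bar> \<partial>M) = 1 - l * m"
      using int by (simp add: m_def prob_space)
    finally have "1 - l * m \<le> exp (- ?\<phi>)" .
    \<comment> \<open>A linear upper bound for \<open>\<phi>\<close> near 0 is obtained without logarithms from \<open>1 + \<phi> \<le> e^\<phi>\<close>.\<close>
    also have "exp (- ?\<phi>) \<le> 1 / (1 + ?\<phi>)"
      using exp_ge_add_one_self[of ?\<phi>] \<phi> by (simp add: exp_minus field_simps)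
    finally have "(1 - l * m) * (1 + ?\<phi>) \<le> 1" using \<phi> by (simp add: field_simps)
    then have "(1 - l * m) * ?\<phi> \<le> l * m" by (simp add: algebra_simps)
    moreover have "1 / 2 * ?\<phi> \<le> (1 - l * m) * ?\<phi>" using l \<phi> by (intro mult_right_mono) auto
    ultimately have "?\<phi> \<le> 2 * l * m" by simp
    then show ?thesis using \<delta> l by (simp add: laplace_exponent_def) (smt (verit) mult_pos_pos)
  qed
  have fat: "(\<integral>\<^sup>+y. ennreal (y / (1 + y / real (Suc n))) \<partial>\<nu>) \<le> ennreal (2 * m)" if n: "real (Suc n) \<ge> 2 * m" for n
  proof -
    define l where "l = 1 / real (Suc n)"
    have l: "0 < l" "l * m \<le> 1 / 2" using n by (auto simp: l_def field_simps)
    note nn = levy_measure_AE_exp_nonneg[OF \<nu> l(1)]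
    have "(\<integral>\<^sup>+y. ennreal (y / (1 + y / real (Suc n))) \<partial>\<nu>) \<le> (\<integral>\<^sup>+y. ennreal (real (Suc n)) * ennreal (1 - exp (- l * y)) \<partial>\<nu>)"
    proof (rule nn_integral_mono_AE, use levy_measure_AE_pos[OF \<nu>] in eventually_elim)
      case (elim y)
      have p: "0 < 1 + l * y" using l elim by (simp add: add_pos_pos)
      \<comment> \<open>The same inequality gives a minorant of \<open>(1 - e^(- l y)) / l\<close> that tends to \<open>y\<close>.\<close>
      have "exp (- l * y) \<le> 1 / (1 + l * y)"
        using exp_ge_add_one_self[of "l * y"] p by (simp add: exp_minus field_simps)
      then have "l * y / (1 + l * y) \<le> 1 - exp (- l * y)"
        using p by (simp add: field_simps)
      then have "real (Suc n) * (l * y / (1 + l * y)) \<le> real (Suc n) * (1 - exp (- l * y))"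
        by (intro mult_left_mono) auto
      moreover have "real (Suc n) * (l * y / (1 + l * y)) = y / (1 + y / real (Suc n))" by (simp add: l_def)
      ultimately show ?case
        by (metis ennreal_leI ennreal_mult' of_nat_0_le_iff)
    qed
    also have "\<dots> = ennreal (real (Suc n)) * ennreal (\<integral>y. 1 - exp (- l * y) \<partial>\<nu>)"
      by (subst nn_integral_cmult, measurable)
         (subst nn_integral_eq_integral[OF levy_measure_exp_integrable[OF \<nu> l(1)] nn], simp)
    also have "\<dots> \<le> ennreal (real (Suc n)) * ennreal (2 * l * m)"
      using bound[OF l] by (intro mult_left_mono ennreal_leI) auto
    also have "\<dots> = ennreal (2 * m)"
      using m l by (subst ennreal_mult[symmetric]) (auto simp: l_def)
    finally show ?thesis .
  qed
  have "(\<integral>\<^sup>+y. ennreal y \<partial>\<nu>) \<le> (\<integral>\<^sup>+y. liminf (\<lambda>n. ennreal (y / (1 + y / real (Suc n)))) \<partial>\<nu>)"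
  proof (rule nn_integral_mono_AE, use levy_measure_AE_pos[OF \<nu>] in eventually_elim)
    case (elim y)
    have "(\<lambda>n. y / (1 + y / real (Suc n))) \<longlonglongrightarrow> y / (1 + 0)"
      by (intro tendsto_intros LIMSEQ_Suc[OF lim_const_over_n]) auto
    then have "(\<lambda>n. ennreal (y / (1 + y / real (Suc n)))) \<longlonglongrightarrow> ennreal y" by (intro tendsto_ennrealI) simp
    then show ?case using lim_imp_Liminf[OF sequentially_bot] by (metis order_refl)
  qed
  also have "\<dots> \<le> liminf (\<lambda>n. \<integral>\<^sup>+y. ennreal (y / (1 + y / real (Suc n))) \<partial>\<nu>)"
    by (rule nn_integral_liminf) measurable
  also have "\<dots> \<le> ennreal (2 * m)"
  proof (rule Liminf_le)
    obtain n0 where "2 * m \<le> real n0" using real_arch_simple by blast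
    then have "\<And>n. n \<ge> n0 \<Longrightarrow> real (Suc n) \<ge> 2 * m" by (simp add: order_trans)
    then show "\<forall>\<^sub>F n in sequentially. (\<integral>\<^sup>+y. ennreal (y / (1 + y / real (Suc n))) \<partial>\<nu>) \<le> ennreal (2 * m)"
      using fat unfolding eventually_sequentially by blast
  qed simp
  also have "\<dots> < \<infinity>" by simp
  finally show ?thesis .
qed

section \<open>Renewal equations\<close>

abbreviation laplace :: "(real \<Rightarrow> ennreal) \<Rightarrow> real \<Rightarrow> ennreal" where
  "laplace f l \<equiv> \<integral>\<^sup>+x. ennreal (exp (- l * x)) * f x \<partial>lborel"

lemma laplace_transform_convolution:
  fixes f g :: "real \<Rightarrow> ennreal"
  assumes [measurable]: "f \<in> borel_measurable borel" "g \<in> borel_measurable borel"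
  shows "(\<integral>\<^sup>+x. ennreal (exp (- l * x)) * (\<integral>\<^sup>+y. f (x - y) * g y \<partial>lborel) \<partial>lborel) =
    laplace f l * laplace g l"
proof -
  have "(\<integral>\<^sup>+x. ennreal (exp (- l * x)) * (\<integral>\<^sup>+y. f (x - y) * g y \<partial>lborel) \<partial>lborel) =
     (\<integral>\<^sup>+x. (\<integral>\<^sup>+y. ennreal (exp (- l * x)) * (f (x - y) * g y) \<partial>lborel) \<partial>lborel)"
    by (intro nn_integral_cong nn_integral_cmult[symmetric]) auto
  also have "\<dots> = (\<integral>\<^sup>+y. (\<integral>\<^sup>+x. ennreal (exp (- l * x)) * (f (x - y) * g y) \<partial>lborel) \<partial>lborel)"
    by (rule lborel_pair.Fubini') measurable
  also have "\<dots> = (\<integral>\<^sup>+y. laplace f l * (ennreal (exp (- l * y)) * g y) \<partial>lborel)"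
  proof (rule nn_integral_cong)
    fix y :: real
    have "(\<integral>\<^sup>+x. ennreal (exp (- l * x)) * (f (x - y) * g y) \<partial>lborel) =
       (\<integral>\<^sup>+x. ennreal (exp (- l * (x + y))) * (f x * g y) \<partial>lborel)"
      by (subst nn_integral_real_affine[where c = 1 and t = y]) (auto simp: ac_simps)
    also have "\<dots> = (\<integral>\<^sup>+x. (ennreal (exp (- l * x)) * f x) * (ennreal (exp (- l * y)) * g y) \<partial>lborel)"
    proof (rule nn_integral_cong)
      fix x
      have "exp (- l * (x + y)) = exp (- l * x) * exp (- l * y)"
        by (simp add: exp_add[symmetric] algebra_simps)
      then show "ennreal (exp (- l * (x + y))) * (f x * g y) = (ennreal (exp (- l * x)) * f x) * (ennreal (exp (- l * y)) * g y)"
        by (simp only: ennreal_mult exp_ge_zero ac_simps)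
    qed
    finally show "(\<integral>\<^sup>+x. ennreal (exp (- l * x)) * (f (x - y) * g y) \<partial>lborel) =
       laplace f l * (ennreal (exp (- l * y)) * g y)"
      by (simp add: nn_integral_multc)
  qed
  also have "\<dots> = laplace f l * laplace g l"
    by (rule nn_integral_cmult) measurable
  finally show ?thesis .
qed

text \<open>Tonelli's theorem on the region \<open>0 < x < y\<close>.  The closed interval on the right-hand side differs from
  the open one in two points and suits the fundamental theorem of calculus.\<close>

lemma nn_integral_levy_tail:
  fixes g :: "real \<Rightarrow> ennreal"
  assumes \<nu>: "levy_measure \<nu>" and [measurable]: "g \<in> borel_measurable borel"
  shows "(\<integral>\<^sup>+x. g x * (indicator {0<..} x * emeasure \<nu> {x<..}) \<partial>lborel) =
    (\<integral>\<^sup>+y. (\<integral>\<^sup>+x. g x * indicator {0..y} x \<partial>lborel) \<partial>\<nu>)"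
proof -
  have sets[measurable_cong]: "sets \<nu> = sets borel" using \<nu> by (simp add: levy_measure_def)
  interpret \<nu>: sigma_finite_measure \<nu> by (rule levy_measure_sigma_finite[OF \<nu>])
  interpret pair_sigma_finite lborel \<nu> by unfold_locales
  have "(\<integral>\<^sup>+x. g x * (indicator {0<..} x * emeasure \<nu> {x<..}) \<partial>lborel) =
     (\<integral>\<^sup>+x. (\<integral>\<^sup>+y. g x * indicator {0<..} x * (if x < y then 1 else 0) \<partial>\<nu>) \<partial>lborel)"
  proof (rule nn_integral_cong)
    fix x :: real
    have "(\<integral>\<^sup>+y. g x * indicator {0<..} x * (if x < y then 1 else 0) \<partial>\<nu>) =
      (\<integral>\<^sup>+y. g x * indicator {0<..} x * indicator {x<..} y \<partial>\<nu>)"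
      by (rule nn_integral_cong) (auto simp: indicator_def)
    also have "\<dots> = g x * indicator {0<..} x * emeasure \<nu> {x<..}"
      by (rule nn_integral_cmult_indicator) (simp add: sets)
    finally show "g x * (indicator {0<..} x * emeasure \<nu> {x<..}) =
       (\<integral>\<^sup>+y. g x * indicator {0<..} x * (if x < y then 1 else 0) \<partial>\<nu>)" by (simp add: mult.assoc)
  qed
  also have "\<dots> = (\<integral>\<^sup>+y. (\<integral>\<^sup>+x. g x * indicator {0<..} x * (if x < y then 1 else 0) \<partial>lborel) \<partial>\<nu>)"
    by (rule Fubini'[symmetric]) measurable
  also have "\<dots> = (\<integral>\<^sup>+y. (\<integral>\<^sup>+x. g x * indicator {0..y} x \<partial>lborel) \<partial>\<nu>)"
  proof (rule nn_integral_cong, rule nn_integral_cong_AE)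
    fix y :: real
    show "AE x in lborel. g x * indicator {0<..} x * (if x < y then 1 else 0) = g x * indicator {0..y} x"
      using AE_lborel_singleton[of "0::real"] AE_lborel_singleton[of y]
      by eventually_elim (auto simp: indicator_def)
  qed
  finally show ?thesis .
qed

lemma laplace_levy_tail:
  assumes \<nu>: "levy_measure \<nu>" and l: "0 < l"
  shows "(\<integral>\<^sup>+x. ennreal (exp (- l * x)) * (indicator {0<..} x * emeasure \<nu> {x<..}) \<partial>lborel) =
    ennreal ((\<integral>y. 1 - exp (- l * y) \<partial>\<nu>) / l)"
proof -
  have sets[measurable_cong]: "sets \<nu> = sets borel" using \<nu> by (simp add: levy_measure_def)
  note nn = levy_measure_AE_exp_nonneg[OF \<nu> l]
  have "(\<integral>\<^sup>+x. ennreal (exp (- l * x)) * (indicator {0<..} x * emeasure \<nu> {x<..}) \<partial>lborel) =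
     (\<integral>\<^sup>+y. (\<integral>\<^sup>+x. ennreal (exp (- l * x)) * indicator {0..y} x \<partial>lborel) \<partial>\<nu>)"
    by (rule nn_integral_levy_tail[OF \<nu>]) measurable
  also have "\<dots> = (\<integral>\<^sup>+y. ennreal (1 / l) * ennreal (1 - exp (- l * y)) \<partial>\<nu>)"
  proof (rule nn_integral_cong_AE, use levy_measure_AE_pos[OF \<nu>] in eventually_elim)
    case (elim y)
    have "(\<integral>\<^sup>+x. ennreal (exp (- l * x)) * indicator {0..y} x \<partial>lborel) = ennreal (- exp (- l * y) / l - - exp (- l * 0) / l)"
      using l elim by (intro nn_integral_FTC_Icc) (auto intro!: derivative_eq_intros simp: has_real_derivative_iff_has_vector_derivative[symmetric])
    also have "\<dots> = ennreal (1 / l) * ennreal (1 - exp (- l * y))"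
      using l elim by (simp add: ennreal_mult[symmetric] diff_divide_distrib)
    finally show ?case .
  qed
  also have "\<dots> = ennreal (1 / l) * ennreal (\<integral>y. 1 - exp (- l * y) \<partial>\<nu>)"
    by (subst nn_integral_cmult, measurable)
       (subst nn_integral_eq_integral[OF levy_measure_exp_integrable[OF \<nu> l] nn], simp)
  also have "\<dots> = ennreal ((\<integral>y. 1 - exp (- l * y) \<partial>\<nu>) / l)"
    using l integral_nonneg_AE[OF nn] by (subst ennreal_mult[symmetric]) auto
  finally show ?thesis .
qed

lemma levy_tail_integral:
  assumes \<nu>: "levy_measure \<nu>"
  shows "(\<integral>\<^sup>+x. indicator {0<..} x * emeasure \<nu> {x<..} \<partial>lborel) = (\<integral>\<^sup>+y. ennreal y \<partial>\<nu>)"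
proof -
  have "(\<integral>\<^sup>+x. indicator {0<..} x * emeasure \<nu> {x<..} \<partial>lborel) = (\<integral>\<^sup>+y. (\<integral>\<^sup>+x. indicator {0..y} x \<partial>lborel) \<partial>\<nu>)"
    using nn_integral_levy_tail[OF \<nu>, of "\<lambda>_. 1"] by simp
  also have "\<dots> = (\<integral>\<^sup>+y. ennreal y \<partial>\<nu>)"
    by (rule nn_integral_cong_AE, use levy_measure_AE_pos[OF \<nu>] in eventually_elim) auto
  finally show ?thesis .
qed

definition conv :: "(real \<Rightarrow> real) \<Rightarrow> (real \<Rightarrow> real) \<Rightarrow> real \<Rightarrow> real" where
  "conv f g x = (LBINT y. f (x - y) * g y)"

lemma conv_integrable_bounded:
  fixes f g :: "real \<Rightarrow> real"
  assumes f: "integrable lborel f" and g[measurable]: "g \<in> borel_measurable borel" and B: "\<And>y. \<bar>g y\<bar> \<le> B"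
  shows "integrable lborel (\<lambda>y. f (x - y) * g y)"
proof (rule Bochner_Integration.integrable_bound)
  have [measurable]: "f \<in> borel_measurable borel" using f by auto
  show "integrable lborel (\<lambda>y. B * f (x - y))"
    using lborel_integrable_real_affine[OF f, of "-1" x] by simp
  show "AE y in lborel. norm (f (x - y) * g y) \<le> norm (B * f (x - y))"
    using B by (auto simp: abs_mult mult.commute intro!: AE_I2 mult_right_mono order_trans[OF B abs_ge_self])
qed (use f in auto)

lemma nn_integral_conv:
  assumes f: "integrable lborel f" and g: "g \<in> borel_measurable borel" and B: "\<And>y. \<bar>g y\<bar> \<le> B"
    and nn: "\<And>y. 0 \<le> f y" "\<And>y. 0 \<le> g y"
  shows "(\<integral>\<^sup>+y. ennreal (f (x - y)) * ennreal (g y) \<partial>lborel) = ennreal (conv f g x)"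
  using nn_integral_eq_integral[OF conv_integrable_bounded[OF f g B, of x]] nn
  by (simp add: conv_def ennreal_mult)

text \<open>Nonnegativity lets the convolution be treated as an integral in \<open>[0, \<infinity>]\<close>, so that its Laplace
  transform is a product and uniqueness of Laplace transforms applies.\<close>

lemma convolution_identity_from_laplace:
  assumes f: "integrable lborel f" "\<And>y. 0 \<le> f y" "\<And>y. y \<le> 0 \<Longrightarrow> f y = 0"
    and v: "v \<in> borel_measurable borel" "\<And>y. \<bar>v y\<bar> \<le> B" "\<And>y. 0 \<le> v y" "\<And>y. y \<le> 0 \<Longrightarrow> v y = 0"
    and a: "a \<in> borel_measurable borel" "\<And>y. 0 \<le> a y" "\<And>y. y < 0 \<Longrightarrow> a y = 0"
    and b: "b \<in> borel_measurable borel" "\<And>y. 0 \<le> b y" "\<And>y. y < 0 \<Longrightarrow> b y = 0"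
    and eq: "\<And>l. 0 < l \<Longrightarrow>
      laplace (\<lambda>x. ennreal (a x)) l +
      laplace (\<lambda>x. ennreal (f x)) l * laplace (\<lambda>x. ennreal (v x)) l
      = laplace (\<lambda>x. ennreal (b x)) l"
    and fin: "\<And>l. 0 < l \<Longrightarrow> laplace (\<lambda>x. ennreal (b x)) l < \<infinity>"
  shows "AE x in lborel. a x + conv f v x = b x"
proof -
  have [measurable]: "f \<in> borel_measurable borel" "v \<in> borel_measurable borel" "a \<in> borel_measurable borel" "b \<in> borel_measurable borel"
    using f v(1) a(1) b(1) by auto
  have c0: "0 \<le> conv f v x" for x unfolding conv_def using f v by (intro integral_nonneg_AE) auto
  have cz: "conv f v x = 0" if "x < 0" for x
  proof -
    have "f (x - y) * v y = 0" for y using f(3)[of "x - y"] v(4)[of y] that by (cases "y \<le> 0") auto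
    then have "(\<lambda>y. f (x - y) * v y) = (\<lambda>_. 0)" by blast
    then show ?thesis unfolding conv_def by simp
  qed
  have cm[measurable]: "conv f v \<in> borel_measurable borel"
    unfolding conv_def[abs_def] by measurable
  have "AE x in lborel. ennreal (a x + conv f v x) = ennreal (b x)"
  proof (rule laplace_transform_unique)
    fix l :: real assume l: "0 < l"
    have "laplace (\<lambda>x. ennreal (a x + conv f v x)) l =
      (\<integral>\<^sup>+x. ennreal (exp (- l * x)) * ennreal (a x) + ennreal (exp (- l * x)) * (\<integral>\<^sup>+y. ennreal (f (x - y)) * ennreal (v y) \<partial>lborel) \<partial>lborel)"
      using c0 a by (intro nn_integral_cong) (simp add: nn_integral_conv[OF f(1) v(1,2) f(2) v(3)] distrib_left)
    also have "\<dots> = laplace (\<lambda>x. ennreal (a x)) l +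
       (\<integral>\<^sup>+x. ennreal (exp (- l * x)) * (\<integral>\<^sup>+y. ennreal (f (x - y)) * ennreal (v y) \<partial>lborel) \<partial>lborel)"
      by (rule nn_integral_add) measurable
    also have "\<dots> = laplace (\<lambda>x. ennreal (b x)) l"
      by (subst laplace_transform_convolution) (use eq[OF l] in auto)
    finally show "laplace (\<lambda>x. ennreal (a x + conv f v x)) l = \<dots>" .
    show "laplace (\<lambda>x. ennreal (b x)) l < \<infinity>" by (rule fin[OF l])
  qed (use a b cz in auto)
  then show ?thesis
    by eventually_elim (subst (asm) ennreal_inj, use a b c0 in auto)
qed

text \<open>Dividing the tail of \<open>\<nu>\<close> by the drift normalises the coefficient of \<open>u\<close> in the renewal equation
  to 1.\<close>

definition scaled_tail :: "real \<Rightarrow> real measure \<Rightarrow> real \<Rightarrow> real" where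
  "scaled_tail \<delta> \<nu> x = (if 0 < x then measure \<nu> {x<..} / \<delta> else 0)"

lemma ennreal_scaled_tail:
  assumes \<nu>: "levy_measure \<nu>" and \<delta>: "0 < \<delta>"
  shows "ennreal (scaled_tail \<delta> \<nu> x) = ennreal (1 / \<delta>) * (indicator {0<..} x * emeasure \<nu> {x<..})"
proof (cases "0 < x")
  case True
  then have "emeasure \<nu> {x<..} = ennreal (measure \<nu> {x<..})"
    using levy_measure_tail_finite[OF \<nu> True] by (intro emeasure_eq_ennreal_measure) auto
  then show ?thesis using True \<delta> by (simp add: scaled_tail_def ennreal_mult[symmetric])
qed (simp add: scaled_tail_def)

lemma scaled_tail_antimono:
  assumes \<nu>: "levy_measure \<nu>" and \<delta>: "0 < \<delta>" and xy: "0 < x" "x \<le> y"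
  shows "scaled_tail \<delta> \<nu> y \<le> scaled_tail \<delta> \<nu> x"
proof -
  have "measure \<nu> {y<..} \<le> measure \<nu> {x<..}"
    using levy_measure_tail_finite[OF \<nu> xy(1)] \<nu> xy
    by (intro measure_mono_fmeasurable) (auto simp: fmeasurable_def levy_measure_def)
  then show ?thesis using xy \<delta> by (simp add: scaled_tail_def divide_right_mono)
qed

lemma scaled_tail_measurable [measurable]:
  assumes \<nu>: "levy_measure \<nu>" and \<delta>: "0 < \<delta>"
  shows "scaled_tail \<delta> \<nu> \<in> borel_measurable borel"
proof -
  have "mono_on {0<..} (\<lambda>x. - scaled_tail \<delta> \<nu> x)"
    using scaled_tail_antimono[OF assms] by (auto simp: mono_on_def)
  then have "(\<lambda>x. - scaled_tail \<delta> \<nu> x) \<in> borel_measurable (restrict_space borel {0<..})"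
    by (rule borel_measurable_mono_on_fnc)
  then have "(\<lambda>x. - (- scaled_tail \<delta> \<nu> x)) \<in> borel_measurable (restrict_space borel {0<..})"
    by (rule borel_measurable_uminus)
  then have "(\<lambda>x. indicator {0<..} x *\<^sub>R scaled_tail \<delta> \<nu> x) \<in> borel_measurable borel"
    by (subst (asm) borel_measurable_restrict_space_iff) auto
  also have "(\<lambda>x. indicator {0<..} x *\<^sub>R scaled_tail \<delta> \<nu> x) = scaled_tail \<delta> \<nu>"
    by (auto simp: scaled_tail_def)
  finally show ?thesis .
qed

lemma levy_tail_measurable:
  assumes \<nu>: "levy_measure \<nu>"
  shows "(\<lambda>x. indicator {0<..} x * emeasure \<nu> {x<..}) \<in> borel_measurable borel"
proof -
  have "(\<lambda>x. ennreal (scaled_tail 1 \<nu> x)) \<in> borel_measurable borel"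
    using scaled_tail_measurable[OF \<nu> zero_less_one] by measurable
  then show ?thesis by (simp add: ennreal_scaled_tail[OF \<nu> zero_less_one])
qed

lemma scaled_tail_integrable:
  assumes \<nu>: "levy_measure \<nu>" and \<delta>: "0 < \<delta>" and mean: "(\<integral>\<^sup>+y. ennreal y \<partial>\<nu>) < \<infinity>"
  shows "integrable lborel (scaled_tail \<delta> \<nu>)"
proof (rule integrableI_nonneg)
  have "(\<integral>\<^sup>+x. ennreal (scaled_tail \<delta> \<nu> x) \<partial>lborel) \<le> ennreal (1 / \<delta>) * (\<integral>\<^sup>+x. indicator {0<..} x * emeasure \<nu> {x<..} \<partial>lborel)"
  proof -
    note [measurable] = levy_tail_measurable[OF \<nu>]
    show ?thesis by (simp add: ennreal_scaled_tail[OF \<nu> \<delta>] nn_integral_cmult)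
  qed
  also have "\<dots> < \<infinity>" using mean by (simp add: levy_tail_integral[OF \<nu>] ennreal_mult_less_top)
  finally show "(\<integral>\<^sup>+x. ennreal (scaled_tail \<delta> \<nu> x) \<partial>lborel) < \<infinity>" .
qed (use scaled_tail_measurable[OF \<nu> \<delta>] \<delta> in \<open>auto simp: scaled_tail_def\<close>)

lemma laplace_scaled_tail:
  assumes \<nu>: "levy_measure \<nu>" and \<delta>: "0 < \<delta>" and l: "0 < l"
  shows "laplace (\<lambda>x. ennreal (scaled_tail \<delta> \<nu> x)) l =
    ennreal (laplace_exponent \<delta> \<nu> l / (\<delta> * l) - 1)"
proof -
  note [measurable] = levy_tail_measurable[OF \<nu>]
  note nn = integral_nonneg_AE[OF levy_measure_AE_exp_nonneg[OF \<nu> l]]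
  have "laplace (\<lambda>x. ennreal (scaled_tail \<delta> \<nu> x)) l =
     (\<integral>\<^sup>+x. ennreal (1 / \<delta>) * (ennreal (exp (- l * x)) * (indicator {0<..} x * emeasure \<nu> {x<..})) \<partial>lborel)"
    by (intro nn_integral_cong) (simp add: ennreal_scaled_tail[OF \<nu> \<delta>] ac_simps)
  also have "\<dots> = ennreal (1 / \<delta>) * ennreal ((\<integral>y. 1 - exp (- l * y) \<partial>\<nu>) / l)"
    by (subst nn_integral_cmult, measurable) (simp only: laplace_levy_tail[OF \<nu> l])
  also have "\<dots> = ennreal (laplace_exponent \<delta> \<nu> l / (\<delta> * l) - 1)"
    using \<delta> l by (subst ennreal_mult''[symmetric])
      (use nn in \<open>auto simp: laplace_exponent_def field_simps\<close>)
  finally show ?thesis .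
qed

text \<open>With the value 0 on \<open>(-\<infinity>, 0]\<close> convolutions over \<open>[0, x]\<close> become convolutions over the line.\<close>

definition extend_zero :: "(real \<Rightarrow> real) \<Rightarrow> real \<Rightarrow> real" where
  "extend_zero u x = (if 0 < x then u x else 0)"

lemma renewal_density_extend_zero:
  assumes "renewal_density M X u"
  obtains B where "extend_zero u \<in> borel_measurable borel" "\<And>x. \<bar>extend_zero u x\<bar> \<le> B"
    "\<And>x. 0 \<le> extend_zero u x"
    "potential_measure M X = density lborel (\<lambda>x. ennreal (extend_zero u x))"
proof -
  have u: "continuous_on {0<..} u" "bounded (u ` {0<..})" "\<And>x. 0 < x \<Longrightarrow> 0 \<le> u x"
    and U: "potential_measure M X = density lborel (\<lambda>x. indicator {0<..} x * ennreal (u x))"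
    using assms by (auto simp: renewal_density_def)
  obtain B where B: "\<And>x. 0 < x \<Longrightarrow> \<bar>u x\<bar> \<le> B" using u(2) by (auto simp: bounded_iff)
  show thesis
  proof
    show "extend_zero u \<in> borel_measurable borel"
    proof -
      have "(\<lambda>x. indicator {0<..} x *\<^sub>R u x) = extend_zero u" by (auto simp: extend_zero_def)
      then show ?thesis using borel_measurable_continuous_on_indicator[OF _ u(1)] by simp
    qed
    show "\<bar>extend_zero u x\<bar> \<le> max B 0" "0 \<le> extend_zero u x" for x
      using B[of x] u(3)[of x] by (auto simp: extend_zero_def)
    have "(\<lambda>x. indicator {0<..} x * ennreal (u x)) = (\<lambda>x. ennreal (extend_zero u x))"
      by (auto simp: extend_zero_def)
    then show "potential_measure M X = density lborel (\<lambda>x. ennreal (extend_zero u x))" using U by simp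
  qed
qed

text \<open>Both identities are read off from Laplace transforms.  The transform of \<open>u\<close> is \<open>1 / \<phi>\<close>, and
  \<open>\<phi>(l) = \<delta> l (1 + k(l))\<close> with \<open>k(l)\<close> the transform of the scaled tail.  The function \<open>r\<close> is the
  density of the law of \<open>X\<close> at an exponential time, whose transform is \<open>1 / (1 + \<phi>)\<close>, and
  \<open>1 / \<phi> = 1 / (1 + \<phi>) + 1 / (1 + \<phi>) * 1 / \<phi>\<close>.  The density exists, and vanishes only where \<open>u\<close>
  does, because the discount factor leaves the null sets of the potential measure unchanged.\<close>

lemma renewal_equation:
  assumes sub: "subordinator M X" and dl: "has_drift_and_levy_measure M X \<delta> \<nu>" and \<delta>: "0 < \<delta>"
    and int: "integrable M (X 1)" and u: "renewal_density M X u"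
  obtains r where "AE x in lborel. 0 < x \<longrightarrow> extend_zero u x + conv (scaled_tail \<delta> \<nu>) (extend_zero u) x = 1 / \<delta>"
    and "r \<in> borel_measurable borel" "\<And>x. 0 \<le> r x" "integrable lborel r" "(LBINT x. r x) = 1"
    and "AE x in lborel. extend_zero u x = r x + conv r (extend_zero u) x"
    and "\<And>A. A \<in> sets borel \<Longrightarrow> (AE x in lborel. x \<in> A \<longrightarrow> r x = 0) \<Longrightarrow>
      (AE x in lborel. x \<in> A \<longrightarrow> extend_zero u x = 0)"
proof -
  let ?v = "extend_zero u" and ?k = "scaled_tail \<delta> \<nu>" and ?\<phi> = "laplace_exponent \<delta> \<nu>"
  have X: "levy_process M X" using sub by (simp add: subordinator_def)
  have \<nu>: "levy_measure \<nu>" using dl by (simp add: has_drift_and_levy_measure_def)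
  obtain B where vm[measurable]: "?v \<in> borel_measurable borel" and B: "\<And>x. \<bar>?v x\<bar> \<le> B"
    and v0: "\<And>x. 0 \<le> ?v x" and U: "potential_measure M X = density lborel (\<lambda>x. ennreal (?v x))"
    using renewal_density_extend_zero[OF u] by blast
  have vz: "?v x = 0" if "x \<le> 0" for x using that by (simp add: extend_zero_def)
  have \<phi>: "0 < ?\<phi> l" if "0 < l" for l by (rule laplace_exponent_pos[OF \<nu> \<delta> that])
  have Lv: "laplace (\<lambda>x. ennreal (?v x)) l = ennreal (1 / ?\<phi> l)" if l: "0 < l" for l
  proof -
    have "(\<integral>\<^sup>+x. ennreal (exp (- l * x)) \<partial>discounted_potential M X 0) = ennreal (1 / ?\<phi> l)"
      using discounted_potential_laplace[OF sub dl l order_refl \<delta>] by simp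
    then show ?thesis
      unfolding potential_measure_eq[OF X, symmetric] U
      by (subst (asm) nn_integral_density) (auto simp: mult.commute)
  qed
  have k: "integrable lborel ?k" "\<And>y. 0 \<le> ?k y" "\<And>y. y \<le> 0 \<Longrightarrow> ?k y = 0"
    using scaled_tail_integrable[OF \<nu> \<delta> levy_measure_mean_finite[OF sub dl \<delta> int]] \<delta>
    by (auto simp: scaled_tail_def)
  have "AE x in lborel. ?v x + conv ?k ?v x = indicator {0..} x * (1 / \<delta>)"
  proof (rule convolution_identity_from_laplace[OF k vm B v0 vz vm v0])
    fix l :: real assume l: "0 < l"
    have "laplace (\<lambda>x. ennreal (indicator {0..} x * (1 / \<delta>))) l =
       (\<integral>\<^sup>+x. ennreal (1 / \<delta>) * (indicator {0..} x * ennreal (exp (- l * x))) \<partial>lborel)"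
      by (intro nn_integral_cong) (auto simp: indicator_def mult.commute)
    also have "\<dots> = ennreal (1 / (\<delta> * l))"
      using \<delta> l by (subst nn_integral_cmult) (auto simp: nn_integral_exp_atLeast_0[OF l, simplified] ennreal_mult[symmetric])
    finally have L: "laplace (\<lambda>x. ennreal (indicator {0..} x * (1 / \<delta>))) l = ennreal (1 / (\<delta> * l))" .
    show "laplace (\<lambda>x. ennreal (indicator {0..} x * (1 / \<delta>))) l < \<infinity>" unfolding L by simp
    have k1: "0 \<le> ?\<phi> l / (\<delta> * l) - 1"
    proof -
      show ?thesis using integral_nonneg_AE[OF levy_measure_AE_exp_nonneg[OF \<nu> l]] \<delta> l by (simp add: laplace_exponent_def field_simps)
    qed
    have "1 / ?\<phi> l + (?\<phi> l / (\<delta> * l) - 1) * (1 / ?\<phi> l) = 1 / (\<delta> * l)"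
      using \<phi>[OF l] \<delta> l by (simp add: field_simps)
    then show "laplace (\<lambda>x. ennreal (?v x)) l +
      laplace (\<lambda>x. ennreal (?k x)) l * laplace (\<lambda>x. ennreal (?v x)) l
      = laplace (\<lambda>x. ennreal (indicator {0..} x * (1 / \<delta>))) l"
      using k1 \<phi>[OF l] unfolding L laplace_scaled_tail[OF \<nu> \<delta> l] Lv[OF l]
      by (subst ennreal_mult[symmetric]) (auto simp del: ennreal_plus simp add: ennreal_plus[symmetric] mult_nonneg_nonneg)
  qed (use \<delta> in \<open>auto simp: extend_zero_def\<close>)
  then have eq: "AE x in lborel. 0 < x \<longrightarrow> ?v x + conv ?k ?v x = 1 / \<delta>" by eventually_elim auto
  let ?R = "discounted_potential M X 1"
  have null: "emeasure ?R A = 0 \<longleftrightarrow> emeasure (density lborel (\<lambda>x. ennreal (?v x))) A = 0" if "A \<in> sets borel" for A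
    using discounted_potential_null_iff[OF X that, of 1 0] by (simp add: potential_measure_eq[OF X, symmetric] U)
  have "absolutely_continuous lborel ?R"
    unfolding absolutely_continuous_def null_sets_def
    using null absolutely_continuousI_density[of "\<lambda>x. ennreal (?v x)" lborel]
    by (auto simp: absolutely_continuous_def null_sets_def)
  then obtain R where Rm[measurable]: "R \<in> borel_measurable lborel" and R: "density lborel R = ?R"
    using sigma_finite_measure.Radon_Nikodym[OF lborel.sigma_finite_measure_axioms, of ?R] by auto
  have "(\<integral>\<^sup>+x. R x \<partial>lborel) = 1"
    using discounted_potential_total_mass[OF X] unfolding R[symmetric] by (simp add: emeasure_density)
  then have Rfin: "AE x in lborel. R x \<noteq> \<infinity>" by (intro nn_integral_noteq_infinite) auto
  have "emeasure ?R {..0} = 0"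
  proof (subst null)
    have "(\<lambda>x. ennreal (?v x) * indicator {..0} x) = (\<lambda>_. 0)" by (auto simp: extend_zero_def indicator_def)
    then show "emeasure (density lborel (\<lambda>x. ennreal (?v x))) {..0} = 0"
      by (subst emeasure_density) (simp_all only:, simp_all)
  qed simp
  then have Rz: "AE x in lborel. x \<le> 0 \<longrightarrow> R x = 0"
    unfolding R[symmetric] by (subst (asm) emeasure_density) (auto simp: nn_integral_0_iff_AE indicator_def)
  define r where "r = extend_zero (\<lambda>x. enn2real (R x))"
  have rm[measurable]: "r \<in> borel_measurable borel" unfolding r_def extend_zero_def[abs_def] by measurable
  have r0: "0 \<le> r x" for x by (simp add: r_def extend_zero_def)
  have rz: "r x = 0" if "x \<le> 0" for x using that by (simp add: r_def extend_zero_def)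
  have rR: "AE x in lborel. ennreal (r x) = R x"
    using Rfin Rz by eventually_elim (auto simp: r_def extend_zero_def less_top)
  have Rr: "?R = density lborel (\<lambda>x. ennreal (r x))"
    unfolding R[symmetric] by (rule density_cong) (use rR in auto)
  have mass: "(\<integral>\<^sup>+x. ennreal (r x) \<partial>lborel) = 1"
    using discounted_potential_total_mass[OF X] unfolding Rr by (simp add: emeasure_density)
  have ri: "integrable lborel r" by (rule integrableI_nonneg) (use mass r0 in auto)
  have r1: "(LBINT x. r x) = 1" using nn_integral_eq_integral[OF ri] mass r0 by simp
  have Lr: "laplace (\<lambda>x. ennreal (r x)) l = ennreal (1 / (1 + ?\<phi> l))" if l: "0 < l" for l
    using discounted_potential_laplace[OF sub dl l zero_le_one \<delta>] unfolding Rr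
    by (subst (asm) nn_integral_density) (auto simp: mult.commute)
  have "AE x in lborel. r x + conv r ?v x = ?v x"
  proof (rule convolution_identity_from_laplace[OF ri r0 rz vm B v0 vz rm r0 _ vm v0])
    fix l :: real assume l: "0 < l"
    have "1 / (1 + ?\<phi> l) + 1 / (1 + ?\<phi> l) * (1 / ?\<phi> l) = 1 / ?\<phi> l"
    proof -
      have "1 + ?\<phi> l \<noteq> 0" "?\<phi> l \<noteq> 0" using \<phi>[OF l] by auto
      then show ?thesis by (simp add: divide_simps)
    qed
    then show "laplace (\<lambda>x. ennreal (r x)) l +
      laplace (\<lambda>x. ennreal (r x)) l * laplace (\<lambda>x. ennreal (?v x)) l
      = laplace (\<lambda>x. ennreal (?v x)) l"
      using \<phi>[OF l] unfolding Lr[OF l] Lv[OF l]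
      by (subst ennreal_mult[symmetric]) (auto simp del: ennreal_plus simp add: ennreal_plus[symmetric])
    show "laplace (\<lambda>x. ennreal (?v x)) l < \<infinity>" unfolding Lv[OF l] by simp
  qed (use rz vz in auto)
  then have re: "AE x in lborel. ?v x = r x + conv r ?v x" by eventually_elim simp
  have "AE x in lborel. x \<in> A \<longrightarrow> ?v x = 0" if A[measurable]: "A \<in> sets borel" and "AE x in lborel. x \<in> A \<longrightarrow> r x = 0" for A
  proof -
    have "emeasure ?R A = 0"
      unfolding Rr using that(2) by (subst emeasure_density) (auto simp: nn_integral_0_iff_AE indicator_def elim: AE_mp)
    then have "AE x in lborel. ennreal (?v x) * indicator A x = 0"
      unfolding null[OF A] by (subst (asm) emeasure_density) (auto simp: nn_integral_0_iff_AE)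
    then show ?thesis by eventually_elim (use v0 in \<open>auto simp: indicator_def order_antisym split: if_splits\<close>)
  qed
  then show thesis by (rule that[OF eq rm r0 ri r1 re])
qed

section \<open>Convolution with a decreasing kernel\<close>

lemma conv_commute: "conv f g x = (LBINT y. f y * g (x - y))"
proof -
  have "(LBINT y. f (x - y) * g y) = (LBINT y. f (x - (x + - 1 * y)) * g (x + - 1 * y))"
    by (subst lborel_integral_real_affine[of "-1" _ x]) auto
  then show ?thesis by (simp add: conv_def)
qed

lemma conv_integrable_bounded':
  fixes f g :: "real \<Rightarrow> real"
  assumes f: "integrable lborel f" and g[measurable]: "g \<in> borel_measurable borel" and B: "\<And>y. \<bar>g y\<bar> \<le> B"
  shows "integrable lborel (\<lambda>y. f y * g (x - y))"
proof (rule Bochner_Integration.integrable_bound)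
  have [measurable]: "f \<in> borel_measurable borel" using f by auto
  show "integrable lborel (\<lambda>y. B * f y)" using f by simp
  show "AE y in lborel. norm (f y * g (x - y)) \<le> norm (B * f y)"
  proof (rule AE_I2)
    fix y
    have "\<bar>f y\<bar> * \<bar>g (x - y)\<bar> \<le> \<bar>f y\<bar> * \<bar>B\<bar>" using B[of "x - y"] by (intro mult_left_mono) auto
    then show "norm (f y * g (x - y)) \<le> norm (B * f y)" by (simp add: abs_mult mult.commute)
  qed
  show "(\<lambda>y. f y * g (x - y)) \<in> borel_measurable lborel" by measurable
qed

text \<open>An integrable kernel on \<open>(0, \<infinity>)\<close>, decreasing and possibly unbounded at 0.  The tail of a Levy measure
  is the motivating example.\<close>

locale tail_kernel =
  fixes k :: "real \<Rightarrow> real"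
  assumes k_measurable [measurable]: "k \<in> borel_measurable borel"
    and k_nonneg: "0 \<le> k x"
    and k_zero: "x \<le> 0 \<Longrightarrow> k x = 0"
    and k_antimono: "0 < x \<Longrightarrow> x \<le> y \<Longrightarrow> k y \<le> k x"
    and k_integrable: "integrable lborel k"
begin

definition K :: "real \<Rightarrow> real" where "K t = (LBINT z. indicator {0..t} z * k z)"

definition mass :: real where "mass = (LBINT z. k z)"

lemma k_indicator_integrable: "A \<in> sets borel \<Longrightarrow> integrable lborel (\<lambda>z. indicator A z * k z)"
  using integrable_mult_indicator[OF _ k_integrable, of A] by simp

lemma K_nonneg: "0 \<le> K t"
  unfolding K_def using k_nonneg by (intro integral_nonneg_AE) auto

lemma K_mono: "s \<le> t \<Longrightarrow> K s \<le> K t"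
  unfolding K_def using k_nonneg
  by (intro integral_mono k_indicator_integrable) (auto simp: indicator_def)

lemma mass_nonneg: "0 \<le> mass"
  unfolding mass_def using k_nonneg by (intro integral_nonneg_AE) auto

lemma K_le_mass: "K t \<le> mass"
  unfolding K_def mass_def using k_nonneg
  by (intro integral_mono k_indicator_integrable k_integrable) (auto simp: indicator_def)

text \<open>Continuity of the primitive at 0, in the form in which it is used: a window on which \<open>k\<close> has little
  mass.\<close>

lemma K_small:
  assumes e: "0 < e" obtains t where "0 < t" "K t < e"
proof -
  have "(\<lambda>n. K (1 / real (Suc n))) \<longlonglongrightarrow> (\<integral>z. 0 \<partial>(lborel :: real measure))"
    unfolding K_def
  proof (rule integral_dominated_convergence[where w = k])
    show "AE z in lborel. (\<lambda>n. indicator {0..1 / real (Suc n)} z * k z) \<longlonglongrightarrow> 0"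
    proof (intro AE_I2)
      fix z :: real
      show "(\<lambda>n. indicator {0..1 / real (Suc n)} z * k z) \<longlonglongrightarrow> 0"
      proof (cases "z \<le> 0")
        case False
        have "(\<lambda>n. 1 / real (Suc n)) \<longlonglongrightarrow> 0" by (rule LIMSEQ_Suc[OF lim_const_over_n])
        then have "\<forall>\<^sub>F n in sequentially. 1 / real (Suc n) < z" using False by (intro order_tendstoD) auto
        then have "\<forall>\<^sub>F n in sequentially. indicator {0..1 / real (Suc n)} z * k z = 0"
          by eventually_elim auto
        then show ?thesis by (rule tendsto_eventually)
      qed (simp add: k_zero)
    qed
  qed (use k_integrable k_nonneg in \<open>auto simp: indicator_def\<close>)
  then have "\<forall>\<^sub>F n in sequentially. K (1 / real (Suc n)) < e"
    using e by (intro order_tendstoD) auto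
  then obtain n where "K (1 / real (Suc n)) < e" by (auto simp: eventually_sequentially)
  then show thesis using that[of "1 / real (Suc n)"] by simp
qed

text \<open>A decreasing function is bounded by its averages over \<open>[0, x]\<close>.\<close>

lemma k_le: "0 < x \<Longrightarrow> x * k x \<le> K x"
proof -
  assume x: "0 < x"
  have ii: "integrable lborel (\<lambda>z. k x * indicator {0<..x} z)"
    using x by (intro integrable_mult_right integrable_real_indicator) auto
  have "x * k x = (LBINT z. k x * indicator {0<..x} z)" using x by simp
  also have "\<dots> \<le> K x"
    unfolding K_def using k_antimono k_nonneg
    by (intro integral_mono ii k_indicator_integrable) (auto simp: indicator_def)
  finally show ?thesis .
qed

lemma k_tendsto_0: "(k \<longlongrightarrow> 0) at_top"
proof (rule tendsto_sandwich[OF _ _ tendsto_const])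
  show "\<forall>\<^sub>F x in at_top. k x \<le> mass / x"
    using eventually_gt_at_top[of 0]
  proof eventually_elim
    case (elim x)
    then show ?case using k_le[OF elim] K_le_mass[of x] by (simp add: field_simps)
  qed
  show "((\<lambda>x. mass / x) \<longlongrightarrow> 0) at_top"
    by (intro tendsto_divide_0[OF tendsto_const] filterlim_at_top_imp_at_infinity filterlim_ident)
qed (simp add: k_nonneg)

text \<open>Monotonicity makes the modulus of continuity in mean explicit: \<open>k (z + t) - k z\<close> has a constant sign
  for \<open>z > 0\<close>, and for \<open>-t < z \<le> 0\<close> only the first term is present.  Each part contributes
  \<open>K t\<close>.\<close>

lemma k_shift_integral:
  assumes t: "0 \<le> t"
  shows "integrable lborel (\<lambda>z. k (z + t) - k z)" "(LBINT z. \<bar>k (z + t) - k z\<bar>) = 2 * K t"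
proof -
  have isk: "integrable lborel (\<lambda>z. k (z + t))" and es: "(LBINT z. k (z + t)) = mass"
    using lborel_integrable_real_affine[OF k_integrable, of 1 t]
      lborel_integral_real_affine[of 1 k t] by (simp_all add: add.commute mass_def)
  show "integrable lborel (\<lambda>z. k (z + t) - k z)" using isk k_integrable by simp
  have eK: "(LBINT z. indicator {0..t} (z + t) * k (z + t)) = K t"
    using lborel_integral_real_affine[of 1 "\<lambda>z. indicator {0..t} z * k z" t] by (simp add: add.commute K_def)
  have iK: "integrable lborel (\<lambda>z. indicator {0..t} (z + t) * k (z + t))"
    using lborel_integrable_real_affine[OF k_indicator_integrable[of "{0..t}"], of 1 t] by (simp add: add.commute)
  have "\<bar>k (z + t) - k z\<bar> = k z - k (z + t) + 2 * (indicator {0..t} (z + t) * k (z + t))" for z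
    using k_antimono[of z "z + t"] t k_nonneg[of "z + t"] k_zero[of z] k_zero[of "z + t"]
    by (cases "0 < z") (auto simp: indicator_def)
  then have "(LBINT z. \<bar>k (z + t) - k z\<bar>) = (LBINT z. k z - k (z + t) + 2 * (indicator {0..t} (z + t) * k (z + t)))"
    by simp
  also have "\<dots> = mass - mass + 2 * K t"
    using isk iK k_integrable by (simp add: es eK mass_def[symmetric])
  finally show "(LBINT z. \<bar>k (z + t) - k z\<bar>) = 2 * K t" by simp
qed

text \<open>The kernel supplies the continuity; \<open>v\<close> may be any bounded function.  By the renewal equation a bounded
  solution is therefore uniformly continuous on \<open>(0, \<infinity>)\<close>.\<close>

lemma conv_k_modulus:
  assumes v[measurable]: "v \<in> borel_measurable borel" and B: "\<And>y. \<bar>v y\<bar> \<le> B" and t: "0 \<le> t"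
  shows "\<bar>conv k v (x + t) - conv k v x\<bar> \<le> 2 * B * K t"
proof -
  have B0: "0 \<le> B" using B[of 0] by simp
  have "conv k v (x + t) - conv k v x = (LBINT y. (k (x - y + t) - k (x - y)) * v y)"
    unfolding conv_def using conv_integrable_bounded[OF k_integrable v B]
    by (subst Bochner_Integration.integral_diff[symmetric]) (auto simp: algebra_simps)
  also have "\<bar>\<dots>\<bar> \<le> (LBINT y. \<bar>(k (x - y + t) - k (x - y)) * v y\<bar>)" by (rule integral_abs_bound)
  also have "\<dots> \<le> (LBINT y. \<bar>k (x - y + t) - k (x - y)\<bar> * B)"
  proof (rule integral_mono)
    show "integrable lborel (\<lambda>y. \<bar>(k (x - y + t) - k (x - y)) * v y\<bar>)"
      using conv_integrable_bounded[OF k_shift_integral(1)[OF t] v B, of x] by (intro integrable_abs)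
    show "integrable lborel (\<lambda>y. \<bar>k (x - y + t) - k (x - y)\<bar> * B)"
      using conv_integrable_bounded[OF k_shift_integral(1)[OF t], of "\<lambda>_. B" B x] B0
      by (auto dest: integrable_abs simp: abs_mult)
  qed (auto simp: abs_mult intro!: mult_left_mono B)
  also have "\<dots> = (LBINT z. \<bar>k (z + t) - k z\<bar> * B)"
    using conv_commute[of "\<lambda>z. \<bar>k (z + t) - k z\<bar>" "\<lambda>_. B" x] by (simp add: conv_def)
  also have "\<dots> = 2 * B * K t" by (simp add: k_shift_integral(2)[OF t])
  finally show ?thesis .
qed

lemma conv_k_continuous:
  assumes v: "v \<in> borel_measurable borel" and B: "\<And>y. \<bar>v y\<bar> \<le> B"
  shows "continuous_on UNIV (conv k v)"
proof (rule continuous_onI)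
  fix x e :: real assume e: "0 < e"
  have B0: "0 \<le> B" using B[of 0] by simp
  obtain t where t: "0 < t" "K t < e / (2 * B + 1)" using K_small[of "e / (2 * B + 1)"] e B0 by auto
  have small: "2 * B * K s \<le> e" if "s \<le> t" for s
  proof -
    have "2 * B * K s \<le> (2 * B + 1) * K t"
      using K_mono[OF that] K_nonneg[of s] B0 by (intro mult_mono) auto
    also have "\<dots> \<le> e" using t(2) B0 by (simp add: field_simps)
    finally show ?thesis .
  qed
  have "dist (conv k v y) (conv k v x) \<le> e" if "dist y x < t" for y
  proof (cases "x \<le> y")
    case True
    then show ?thesis using conv_k_modulus[OF v B, of "y - x" x] small[of "y - x"] that by (simp add: dist_real_def)
  next
    case False
    then show ?thesis using conv_k_modulus[OF v B, of "x - y" y] small[of "x - y"] that by (simp add: dist_real_def)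
  qed
  then show "\<exists>d>0. \<forall>x'\<in>UNIV. dist x' x < d \<longrightarrow> dist (conv k v x') (conv k v x) \<le> e" using t(1) by blast
qed

end

text \<open>The set where a continuous function differs from \<open>c\<close> is open, and a nonempty open set is not
  negligible.\<close>

lemma AE_lborel_eq_continuous:
  fixes f :: "real \<Rightarrow> real"
  assumes f: "continuous_on {0<..} f" and ae: "AE x in lborel. 0 < x \<longrightarrow> f x = c" and x: "0 < x"
  shows "f x = c"
proof (rule ccontr)
  assume "f x \<noteq> c"
  define S where "S = {0<..} \<inter> f -` (- {c})"
  have "open S" unfolding S_def by (rule continuous_open_preimage[OF f]) auto
  moreover have "AE y in lborel. y \<notin> S" using ae by eventually_elim (auto simp: S_def)
  ultimately have "S \<in> null_sets lborel" by (intro AE_iff_null_sets[THEN iffD2]) auto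
  then have "negligible S" by (simp add: negligible_iff_null_sets null_sets_completionI)
  then show False using open_not_negligible[OF \<open>open S\<close>] x \<open>f x \<noteq> c\<close> by (auto simp: S_def)
qed

section \<open>The renewal theorem\<close>

text \<open>The solution \<open>v\<close> of a renewal equation with kernel \<open>k\<close>, compared with averages of itself under the
  probability density \<open>r\<close>.  The comparison is stated as an inequality so that the setting is stable
  under \<open>v \<mapsto> - v\<close>, which turns upper bounds into lower bounds.\<close>

locale renewal_setting = tail_kernel k for k :: "real \<Rightarrow> real" +
  fixes v r :: "real \<Rightarrow> real" and B d \<epsilon> :: real
  assumes v_measurable [measurable]: "v \<in> borel_measurable borel"
    and v_bound: "\<bar>v x\<bar> \<le> B"
    and v_eq: "0 < x \<Longrightarrow> v x + conv k v x = d"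
    and r_measurable [measurable]: "r \<in> borel_measurable borel"
    and r_nonneg: "0 \<le> r x"
    and r_integrable: "integrable lborel r"
    and r_mass: "(LBINT x. r x) = 1"
    and r_eq: "AE x in lborel. \<bar>v x - conv r v x\<bar> \<le> r x"
    and \<epsilon>_pos: "0 < \<epsilon>"
    and r_charges: "0 < a \<Longrightarrow> a < b \<Longrightarrow> b < \<epsilon> \<Longrightarrow> 0 < (LBINT x. indicator {a<..<b} x * r x)"
begin

lemma B_nonneg: "0 \<le> B"
  using v_bound[of 0] by simp

lemma r_indicator_integrable: "A \<in> sets borel \<Longrightarrow> integrable lborel (\<lambda>z. indicator A z * r z)"
  using integrable_mult_indicator[OF _ r_integrable, of A] by simp

lemma v_modulus:
  assumes x: "0 < x" and t: "0 \<le> t"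
  shows "\<bar>v (x + t) - v x\<bar> \<le> 2 * B * K t"
proof -
  have "v (x + t) - v x = - (conv k v (x + t) - conv k v x)"
    using v_eq[OF x] v_eq[of "x + t"] x t by simp
  then show ?thesis using conv_k_modulus[OF v_measurable v_bound t, of x] by simp
qed

definition tail :: "real \<Rightarrow> real" where "tail x = (LBINT y. indicator {x..} y * r y)"

lemma tail_tendsto_0: "(tail \<longlongrightarrow> 0) at_top"
proof -
  have "tail x = 1 - (LBINT y. indicator {..x} y * r y)" for x
  proof -
    have "tail x = (LBINT y. r y - indicator {..x} y * r y)"
      unfolding tail_def
      by (rule integral_cong_AE, measurable, use AE_lborel_singleton[of x] in eventually_elim)
         (auto simp: indicator_def)
    then show ?thesis using r_integrable r_indicator_integrable[of "{..x}"] by (simp add: r_mass)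
  qed
  moreover have "((\<lambda>x. 1 - (LBINT y. indicator {..x} y * r y)) \<longlongrightarrow> 1 - 1) at_top"
    using tendsto_integral_at_top[OF _ r_integrable] by (intro tendsto_intros) (auto simp: r_mass)
  moreover have "tail = (\<lambda>x. 1 - (LBINT y. indicator {..x} y * r y))" using calculation(1) by blast
  ultimately show ?thesis by simp
qed

lemma conv_r_modulus:
  assumes x: "0 < x" and t: "0 \<le> t"
  shows "\<bar>conv r v (x + t) - conv r v x\<bar> \<le> 2 * B * K t + 2 * B * tail x"
proof -
  have i: "integrable lborel (\<lambda>y. r y * v (x - y))" for x
    by (rule conv_integrable_bounded'[OF r_integrable v_measurable v_bound])
  have "conv r v (x + t) - conv r v x = (LBINT y. r y * v (x + t - y) - r y * v (x - y))"
    unfolding conv_commute using i by simp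
  also have "\<bar>\<dots>\<bar> \<le> (LBINT y. \<bar>r y * v (x + t - y) - r y * v (x - y)\<bar>)" by (rule integral_abs_bound)
  also have "\<dots> \<le> (LBINT y. 2 * B * K t * r y + 2 * B * (indicator {x..} y * r y))"
  proof (rule integral_mono)
    show "integrable lborel (\<lambda>y. 2 * B * K t * r y + 2 * B * (indicator {x..} y * r y))"
      using r_integrable r_indicator_integrable[of "{x..}"] by simp
    fix y
    have "\<bar>v (x + t - y) - v (x - y)\<bar> \<le> 2 * B * K t + 2 * B * indicator {x..} y"
    proof (cases "y < x")
      case True
      then show ?thesis using v_modulus[of "x - y" t] t by (simp add: algebra_simps)
    next
      case False
      then show ?thesis using v_bound[of "x + t - y"] v_bound[of "x - y"] mult_nonneg_nonneg[OF B_nonneg K_nonneg[of t]] by simp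
    qed
    then have "r y * \<bar>v (x + t - y) - v (x - y)\<bar> \<le> r y * (2 * B * K t + 2 * B * indicator {x..} y)"
      by (rule mult_left_mono) (rule r_nonneg)
    moreover have "\<bar>r y * v (x + t - y) - r y * v (x - y)\<bar> = r y * \<bar>v (x + t - y) - v (x - y)\<bar>"
      by (simp add: right_diff_distrib[symmetric] abs_mult r_nonneg)
    ultimately show "\<bar>r y * v (x + t - y) - r y * v (x - y)\<bar> \<le> 2 * B * K t * r y + 2 * B * (indicator {x..} y * r y)"
      by (simp add: algebra_simps)
  qed (use i in auto)
  also have "\<dots> = 2 * B * K t + 2 * B * tail x"
    using r_integrable r_indicator_integrable[of "{x..}"] by (simp add: r_mass tail_def)
  finally show ?thesis .
qed

text \<open>Almost everywhere \<open>\<bar>defect x\<bar> \<le> r x\<close>.  An integrable function need not tend to 0, but \<open>defect\<close>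
  also inherits the uniform continuity of \<open>v\<close>, and therefore does.\<close>

definition defect :: "real \<Rightarrow> real" where "defect x = v x - conv r v x"

text \<open>Compare \<open>defect x\<close> with its values on the window \<open>[x, x + t]\<close>, where the integral of \<open>r\<close> is at most
  \<open>tail x\<close>.\<close>

lemma defect_bound:
  assumes x: "0 < x" and t: "0 < t"
  shows "\<bar>defect x\<bar> \<le> tail x / t + (4 * B * K t + 2 * B * tail x)"
proof -
  let ?c = "4 * B * K t + 2 * B * tail x"
  have i: "integrable lborel (\<lambda>s. indicator {x..x + t} s * r s)" by (rule r_indicator_integrable) simp
  have j: "integrable lborel (\<lambda>s. c * indicator {x..x + t} s)" for c :: real
    using t by (intro integrable_mult_right integrable_real_indicator) auto
  have "t * \<bar>defect x\<bar> = (LBINT s. \<bar>defect x\<bar> * indicator {x..x + t} s)" using t by simp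
  also have "\<dots> \<le> (LBINT s. indicator {x..x + t} s * r s + ?c * indicator {x..x + t} s)"
  proof (rule integral_mono_AE)
    show "AE s in lborel. \<bar>defect x\<bar> * indicator {x..x + t} s \<le> indicator {x..x + t} s * r s + ?c * indicator {x..x + t} s"
      using r_eq
    proof eventually_elim
      case (elim s)
      have "\<bar>defect x\<bar> \<le> r s + ?c" if s: "x \<le> s" "s \<le> x + t"
      proof -
        have "\<bar>defect s\<bar> \<le> r s" using elim by (simp add: defect_def)
        moreover have "\<bar>v s - v x\<bar> \<le> 2 * B * K (s - x)" using v_modulus[OF x, of "s - x"] s by simp
        moreover have "\<bar>conv r v s - conv r v x\<bar> \<le> 2 * B * K (s - x) + 2 * B * tail x"
          using conv_r_modulus[OF x, of "s - x"] s by simp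
        moreover have "2 * B * K (s - x) \<le> 2 * B * K t" using s B_nonneg by (intro mult_left_mono K_mono) auto
        ultimately show ?thesis using r_nonneg[of s] unfolding defect_def by linarith
      qed
      then show ?case by (simp add: indicator_def)
    qed
  qed (use i j in auto)
  also have "\<dots> = (LBINT s. indicator {x..x + t} s * r s) + ?c * t" using i j t by simp
  also have "(LBINT s. indicator {x..x + t} s * r s) \<le> tail x"
    unfolding tail_def using r_nonneg by (intro integral_mono r_indicator_integrable) (auto simp: indicator_def)
  finally have "t * \<bar>defect x\<bar> \<le> tail x + ?c * t" by simp
  then show ?thesis using t by (simp add: field_simps)
qed

lemma defect_tendsto_0: "(defect \<longlongrightarrow> 0) at_top"
proof (rule tendstoI)
  fix e :: real assume e: "0 < e"
  obtain t where t: "0 < t" "K t < e / (2 * (4 * B + 1))" using K_small[of "e / (2 * (4 * B + 1))"] e B_nonneg by auto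
  have "4 * B * K t \<le> (4 * B + 1) * K t" using K_nonneg[of t] by (simp add: algebra_simps)
  also have "\<dots> < e / 2" using t(2) B_nonneg by (simp add: field_simps)
  finally have Kt: "4 * B * K t < e / 2" .
  have "((\<lambda>x. tail x / t + (4 * B * K t + 2 * B * tail x)) \<longlongrightarrow> 0 / t + (4 * B * K t + 2 * B * 0)) at_top"
    using t by (intro tendsto_intros tail_tendsto_0) auto
  then have "\<forall>\<^sub>F x in at_top. tail x / t + (4 * B * K t + 2 * B * tail x) < e"
    by (rule order_tendstoD(2)) (use Kt e in simp)
  then show "\<forall>\<^sub>F x in at_top. dist (defect x) 0 < e"
    using eventually_gt_at_top[of 0]
    by eventually_elim (use defect_bound[OF _ t(1)] in \<open>fastforce simp: dist_real_def\<close>)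
qed

text \<open>The maximum principle.  Up to the defect, \<open>v (z n)\<close> is the average of \<open>v (z n - w)\<close> with weight
  \<open>r w\<close>.  An average of values that are asymptotically at most \<open>m\<close> can approach \<open>m\<close> only if the
  values themselves do so in the mean.  Near \<open>y\<close> the density \<open>r\<close> has positive mass and \<open>v\<close> is
  uniformly continuous, so the value at \<open>y\<close> itself tends to \<open>m\<close>.\<close>

lemma limsup_point_spreads_step:
  assumes z: "filterlim z at_top sequentially" and vz: "(\<lambda>n. v (z n)) \<longlonglongrightarrow> m"
    and ub: "\<And>\<eta>. 0 < \<eta> \<Longrightarrow> \<forall>\<^sub>F x in at_top. v x \<le> m + \<eta>"
    and y: "0 < y" "y < \<epsilon>"
  shows "(\<lambda>n. v (z n - y)) \<longlonglongrightarrow> m"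
proof -
  define g where "g n w = m - v (z n - w)" for n w
  have gm[measurable]: "g n \<in> borel_measurable borel" for n unfolding g_def by measurable
  have gb: "\<bar>g n w\<bar> \<le> \<bar>m\<bar> + B" for n w using v_bound[of "z n - w"] by (simp add: g_def)
  have gi: "integrable lborel (\<lambda>w. r w * h (g n w))" if [measurable]: "h \<in> borel_measurable borel" and "\<And>x. \<bar>h x\<bar> \<le> \<bar>x\<bar>" for h :: "real \<Rightarrow> real" and n
  proof (rule Bochner_Integration.integrable_bound[where f = "\<lambda>w. (\<bar>m\<bar> + B) * r w"])
    show "AE w in lborel. norm (r w * h (g n w)) \<le> norm ((\<bar>m\<bar> + B) * r w)"
    proof (rule AE_I2)
      fix w
      have "\<bar>h (g n w)\<bar> \<le> \<bar>m\<bar> + B" using that(2)[of "g n w"] gb[of n w] by linarith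
      then have "\<bar>r w\<bar> * \<bar>h (g n w)\<bar> \<le> \<bar>r w\<bar> * (\<bar>m\<bar> + B)" by (rule mult_left_mono) simp
      then show "norm (r w * h (g n w)) \<le> norm ((\<bar>m\<bar> + B) * r w)"
        using B_nonneg by (simp add: abs_mult mult.commute)
    qed
  qed (use r_integrable in auto)
  have g1: "(\<lambda>n. LBINT w. r w * g n w) \<longlonglongrightarrow> 0"
  proof -
    have "(LBINT w. r w * g n w) = m - v (z n) + defect (z n)" for n
      unfolding g_def defect_def conv_commute right_diff_distrib
      using r_integrable conv_integrable_bounded'[OF r_integrable v_measurable v_bound, of "z n"]
      by (simp add: r_mass)
    moreover have "(\<lambda>n. m - v (z n) + defect (z n)) \<longlonglongrightarrow> m - m + 0"
      by (intro tendsto_intros vz filterlim_compose[OF defect_tendsto_0 z])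
    ultimately show ?thesis by simp
  qed
  have g2: "(\<lambda>n. LBINT w. r w * max 0 (- g n w)) \<longlonglongrightarrow> (\<integral>w. 0 \<partial>(lborel :: real measure))"
  proof (rule integral_dominated_convergence[where w = "\<lambda>w. (\<bar>m\<bar> + B) * r w"])
    show "AE w in lborel. (\<lambda>n. r w * max 0 (- g n w)) \<longlonglongrightarrow> 0"
    proof (intro AE_I2)
      fix w
      have "(\<lambda>n. max 0 (- g n w)) \<longlonglongrightarrow> 0"
      proof (rule tendstoI)
        fix e :: real assume e: "0 < e"
        have "filterlim (\<lambda>n. z n - w) at_top sequentially"
          using filterlim_tendsto_add_at_top[OF tendsto_const[of "- w"] z] by simp
        then have "\<forall>\<^sub>F n in sequentially. v (z n - w) \<le> m + e / 2"
          using ub[of "e / 2"] e by (auto simp: filterlim_iff)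
        then show "\<forall>\<^sub>F n in sequentially. dist (max 0 (- g n w)) 0 < e"
          by eventually_elim (use e in \<open>auto simp: g_def dist_real_def\<close>)
      qed
      then show "(\<lambda>n. r w * max 0 (- g n w)) \<longlonglongrightarrow> 0" by (rule tendsto_mult_right_zero)
    qed
    show "AE w in lborel. norm (r w * max 0 (- g n w)) \<le> (\<bar>m\<bar> + B) * r w" for n
    proof (intro AE_I2)
      fix w
      have "r w * max 0 (- g n w) \<le> r w * (\<bar>m\<bar> + B)" using gb[of n w] r_nonneg[of w] by (intro mult_left_mono) auto
      then show "norm (r w * max 0 (- g n w)) \<le> (\<bar>m\<bar> + B) * r w" using r_nonneg[of w] by (simp add: abs_mult mult.commute)
    qed
  qed (use r_integrable in auto)
  \<comment> \<open>The integral of \<open>g\<close> and that of its negative part tend to 0, hence so does that of \<open>\<bar>g\<bar>\<close>.\<close>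
  have "(\<lambda>n. (LBINT w. r w * g n w) + 2 * (LBINT w. r w * max 0 (- g n w))) \<longlonglongrightarrow> 0 + 2 * 0"
    using g1 g2 by (intro tendsto_intros) auto
  moreover have "(LBINT w. r w * g n w) + 2 * (LBINT w. r w * max 0 (- g n w)) = (LBINT w. r w * \<bar>g n w\<bar>)" for n
  proof -
    have "(LBINT w. r w * \<bar>g n w\<bar>) = (LBINT w. r w * g n w + 2 * (r w * max 0 (- g n w)))"
      by (intro Bochner_Integration.integral_cong) (auto simp: algebra_simps max_def abs_if)
    also have "\<dots> = (LBINT w. r w * g n w) + 2 * (LBINT w. r w * max 0 (- g n w))"
      using gi[of "\<lambda>x. x" n] gi[of "\<lambda>x. max 0 (- x)" n] by (simp add: max_def)
    finally show ?thesis by simp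
  qed
  ultimately have g3: "(\<lambda>n. LBINT w. r w * \<bar>g n w\<bar>) \<longlonglongrightarrow> 0" by simp
  show ?thesis
  proof (rule tendstoI)
    fix e :: real assume e: "0 < e"
    obtain t where t: "0 < t" "K t < e / (2 * (2 * B + 1))" using K_small[of "e / (2 * (2 * B + 1))"] e B_nonneg by auto
    have "2 * B * K t \<le> (2 * B + 1) * K t" using K_nonneg[of t] by (simp add: algebra_simps)
    also have "\<dots> < e / 2" using t(2) B_nonneg by (simp add: field_simps)
    finally have Kt: "2 * B * K t < e / 2" .
    \<comment> \<open>The window around \<open>y\<close> lies in \<open>(0, \<epsilon>)\<close>, and \<open>v\<close> oscillates by less than \<open>e / 2\<close> over half its length.\<close>
    define a where "a = min t (min y (\<epsilon> - y)) / 2"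
    have a: "0 < a" "a < t" "a < y" "y + a < \<epsilon>" using t y by (auto simp: a_def min_def field_simps)
    let ?I = "{y - a<..<y + a}"
    define q where "q = (LBINT x. indicator ?I x * r x)"
    have q: "0 < q" unfolding q_def using a by (intro r_charges) auto
    have "\<forall>\<^sub>F n in sequentially. (LBINT w. r w * \<bar>g n w\<bar>) < q * (e / 2)"
      using q e by (intro order_tendstoD(2)[OF g3]) simp
    moreover have "\<forall>\<^sub>F n in sequentially. \<epsilon> < z n" using z by (simp add: filterlim_at_top_dense)
    ultimately show "\<forall>\<^sub>F n in sequentially. dist (v (z n - y)) m < e"
    proof eventually_elim
      case (elim n)
      have "q * \<bar>g n y\<bar> = (LBINT w. \<bar>g n y\<bar> * (indicator ?I w * r w))" by (simp add: q_def)
      also have "\<dots> \<le> (LBINT w. r w * \<bar>g n w\<bar> + 2 * B * K t * (indicator ?I w * r w))"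
      proof (rule integral_mono)
        show "integrable lborel (\<lambda>w. r w * \<bar>g n w\<bar> + 2 * B * K t * (indicator ?I w * r w))"
          using gi[of abs n] r_indicator_integrable[of ?I] by simp
        fix w
        have "\<bar>g n y\<bar> \<le> \<bar>g n w\<bar> + 2 * B * K t" if w: "w \<in> ?I"
        proof -
          have "\<bar>v (z n - y) - v (z n - w)\<bar> \<le> 2 * B * K \<bar>y - w\<bar>"
          proof (cases "y \<le> w")
            case True
            then show ?thesis using v_modulus[of "z n - w" "w - y"] w a elim by simp
          next
            case False
            then show ?thesis using v_modulus[of "z n - y" "y - w"] w a elim y by (simp add: abs_minus_commute)
          qed
          also have "\<dots> \<le> 2 * B * K t" using w a B_nonneg by (intro mult_left_mono K_mono) auto
          finally show ?thesis unfolding g_def by linarith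
        qed
        then have "\<bar>g n y\<bar> * r w \<le> (\<bar>g n w\<bar> + 2 * B * K t) * r w" if "w \<in> ?I"
          using that by (intro mult_right_mono r_nonneg) auto
        then show "\<bar>g n y\<bar> * (indicator ?I w * r w) \<le> r w * \<bar>g n w\<bar> + 2 * B * K t * (indicator ?I w * r w)"
          using r_nonneg[of w] by (cases "w \<in> ?I") (auto simp: algebra_simps)
      qed (use r_indicator_integrable[of ?I] in simp)
      also have "\<dots> = (LBINT w. r w * \<bar>g n w\<bar>) + 2 * B * K t * q"
        using gi[of abs n] r_indicator_integrable[of ?I] by (simp add: q_def)
      also have "\<dots> < q * (e / 2) + e / 2 * q" using elim Kt q by (intro add_strict_mono) auto
      finally have "q * \<bar>g n y\<bar> < q * e" by (simp add: field_simps)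
      then show ?case using q by (simp add: g_def dist_real_def abs_minus_commute)
    qed
  qed
qed

text \<open>Divide \<open>y\<close> into steps shorter than \<open>\<epsilon>\<close>.\<close>

lemma limsup_point_spreads:
  assumes z: "filterlim z at_top sequentially" and vz: "(\<lambda>n. v (z n)) \<longlonglongrightarrow> m"
    and ub: "\<And>\<eta>. 0 < \<eta> \<Longrightarrow> \<forall>\<^sub>F x in at_top. v x \<le> m + \<eta>" and y: "0 \<le> y"
  shows "(\<lambda>n. v (z n - y)) \<longlonglongrightarrow> m"
proof (cases "y = 0")
  case False
  obtain j :: nat where j: "y / \<epsilon> < real j" using reals_Archimedean2 by blast
  define s where "s = y / real j"
  have j0: "0 < real j" using j y False \<epsilon>_pos by (metis divide_nonneg_pos le_less_trans)
  have s: "0 < s" "s < \<epsilon>" using y False j j0 \<epsilon>_pos by (auto simp: s_def field_simps)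
  have "(\<lambda>n. v (z n - real i * s)) \<longlonglongrightarrow> m" for i
  proof (induction i)
    case (Suc i)
    have "filterlim (\<lambda>n. z n - real i * s) at_top sequentially"
      using filterlim_tendsto_add_at_top[OF tendsto_const[of "- (real i * s)"] z] by simp
    from limsup_point_spreads_step[OF this Suc ub s] show ?case by (simp add: algebra_simps)
  qed (use vz in simp)
  from this[of j] show ?thesis using j0 by (simp add: s_def)
qed (use vz in simp)

text \<open>Let \<open>m\<close> be the upper limit of \<open>v\<close> and \<open>z n\<close> a sequence along which it is attained.  Then
  \<open>v (z n - y)\<close> tends to \<open>m\<close> for every \<open>y \<ge> 0\<close>, and the limit of \<open>v + conv k v = d\<close> along the
  sequence is \<open>m (1 + mass) = d\<close>.\<close>

lemma eventually_v_le:
  assumes \<eta>: "0 < \<eta>"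
  shows "\<forall>\<^sub>F x in at_top. v x \<le> d / (1 + mass) + \<eta>"
proof -
  define S where "S = {b. \<forall>\<^sub>F x in at_top. v x \<le> b}"
  define m where "m = Inf S"
  have "B \<in> S" using v_bound by (auto simp: S_def abs_le_iff)
  have bb: "bdd_below S"
  proof (rule bdd_belowI[of _ "- B"])
    fix b assume "b \<in> S"
    then obtain x where "v x \<le> b" by (auto simp: S_def eventually_at_top_linorder)
    then show "- B \<le> b" using v_bound[of x] by (simp add: abs_le_iff)
  qed
  have ub: "\<forall>\<^sub>F x in at_top. v x \<le> m + \<eta>" if \<eta>: "0 < \<eta>" for \<eta>
  proof -
    have "Inf S < m + \<eta>" using \<eta> by (simp add: m_def)
    then obtain b where "b \<in> S" "b < m + \<eta>" using cInf_lessD[of S "m + \<eta>"] \<open>B \<in> S\<close> by blast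
    then show ?thesis by (auto simp: S_def elim: eventually_mono)
  qed
  have "\<exists>x. real n \<le> x \<and> m - 1 / real (Suc n) < v x" for n
  proof (rule ccontr)
    assume "\<not> ?thesis"
    then have "\<forall>\<^sub>F x in at_top. v x \<le> m - 1 / real (Suc n)"
      unfolding eventually_at_top_linorder by (auto simp: not_less)
    then have "m - 1 / real (Suc n) \<in> S" by (simp add: S_def)
    then have "m \<le> m - 1 / real (Suc n)" unfolding m_def using bb by (rule cInf_lower)
    then show False by simp
  qed
  then obtain z where z: "\<And>n. real n \<le> z n" "\<And>n. m - 1 / real (Suc n) < v (z n)" by metis
  have zt: "filterlim z at_top sequentially"
    using z(1) by (intro filterlim_at_top_mono[OF filterlim_real_sequentially]) auto
  have vz: "(\<lambda>n. v (z n)) \<longlonglongrightarrow> m"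
  proof (rule LIMSEQ_I)
    fix e :: real assume e: "0 < e"
    have "\<forall>\<^sub>F n in sequentially. v (z n) \<le> m + e / 2" using ub[of "e / 2"] zt e by (auto simp: filterlim_iff)
    moreover have "(\<lambda>n. 1 / real (Suc n)) \<longlonglongrightarrow> 0" by (rule LIMSEQ_Suc[OF lim_const_over_n])
    then have "\<forall>\<^sub>F n in sequentially. 1 / real (Suc n) < e" using e by (intro order_tendstoD) auto
    ultimately have "\<forall>\<^sub>F n in sequentially. norm (v (z n) - m) < e"
    proof eventually_elim
      case (elim n) then show ?case using z(2)[of n] e by (simp add: abs_less_iff)
    qed
    then show "\<exists>no. \<forall>n\<ge>no. norm (v (z n) - m) < e" by (simp add: eventually_sequentially)
  qed
  have "(\<lambda>n. v (z n) + conv k v (z n)) \<longlonglongrightarrow> m + (LBINT y. k y * m)"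
  proof (intro tendsto_intros vz)
    show "(\<lambda>n. conv k v (z n)) \<longlonglongrightarrow> (LBINT y. k y * m)"
      unfolding conv_commute
    proof (rule integral_dominated_convergence[where w = "\<lambda>y. B * k y"])
      show "AE y in lborel. (\<lambda>n. k y * v (z n - y)) \<longlonglongrightarrow> k y * m"
      proof (intro AE_I2)
        fix y show "(\<lambda>n. k y * v (z n - y)) \<longlonglongrightarrow> k y * m"
          using limsup_point_spreads[OF zt vz ub, of y] k_zero[of y] by (cases "0 \<le> y") (auto intro!: tendsto_intros)
      qed
      show "AE y in lborel. norm (k y * v (z n - y)) \<le> B * k y" for n
      proof (rule AE_I2)
        fix y
        have "k y * \<bar>v (z n - y)\<bar> \<le> k y * B" by (intro mult_left_mono v_bound k_nonneg)
        then show "norm (k y * v (z n - y)) \<le> B * k y" using k_nonneg[of y] by (simp add: abs_mult mult.commute)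
      qed
    qed (use k_integrable in auto)
  qed
  moreover have "(\<lambda>n. v (z n) + conv k v (z n)) \<longlonglongrightarrow> d"
  proof (rule tendsto_eventually)
    have "\<forall>\<^sub>F n in sequentially. 0 < z n" using zt by (simp add: filterlim_at_top_dense)
    then show "\<forall>\<^sub>F n in sequentially. v (z n) + conv k v (z n) = d" by eventually_elim (rule v_eq)
  qed
  ultimately have "m + (LBINT y. k y * m) = d" by (rule LIMSEQ_unique)
  then have "m * (1 + mass) = d" by (simp add: mass_def algebra_simps)
  then have "m = d / (1 + mass)" using mass_nonneg by (simp add: field_simps)
  then show ?thesis using ub[OF \<eta>] by simp
qed

end

lemma conv_uminus_right: "conv f (\<lambda>x. - g x) x = - conv f g x"
  by (simp add: conv_def)

text \<open>The bound for the upper limit applies to \<open>- v\<close> as well, which satisfies the same assumptions with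
  \<open>- d\<close> in place of \<open>d\<close>.\<close>

theorem (in renewal_setting) renewal_theorem: "(v \<longlongrightarrow> d / (1 + mass)) at_top"
proof (rule tendstoI)
  interpret neg: renewal_setting k "\<lambda>x. - v x" r B "- d" \<epsilon>
  proof
    show "AE x in lborel. \<bar>- v x - conv r (\<lambda>x. - v x) x\<bar> \<le> r x"
      using r_eq by eventually_elim (simp add: conv_uminus_right)
    show "- v x + conv k (\<lambda>x. - v x) x = - d" if "0 < x" for x
      using v_eq[OF that] by (simp add: conv_uminus_right)
  qed (use v_bound r_nonneg r_integrable r_mass \<epsilon>_pos r_charges in auto)
  fix e :: real assume "0 < e"
  then have "\<forall>\<^sub>F x in at_top. v x \<le> d / (1 + mass) + e / 2" "\<forall>\<^sub>F x in at_top. - v x \<le> - d / (1 + mass) + e / 2"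
    using eventually_v_le[of "e / 2"] neg.eventually_v_le[of "e / 2"] by auto
  then show "\<forall>\<^sub>F x in at_top. dist (v x) (d / (1 + mass)) < e"
    by eventually_elim (use \<open>0 < e\<close> in \<open>simp add: dist_real_def abs_less_iff\<close>)
qed

section \<open>The resolvent of a kernel with a power bound\<close>

text \<open>On \<open>(-\<infinity>, T]\<close> every application of the equation improves a bound on \<open>p\<close> by the factor
  \<open>mass\<close>.\<close>

lemma (in tail_kernel) volterra_homogeneous_zero:
  assumes small: "mass \<le> 1 / 2" and p[measurable]: "p \<in> borel_measurable borel" and p0: "\<And>y. y \<le> 0 \<Longrightarrow> p y = 0"
    and S: "\<And>y. y \<le> T \<Longrightarrow> \<bar>p y\<bar> \<le> S" and eq: "\<And>x. 0 < x \<Longrightarrow> x \<le> T \<Longrightarrow> p x + conv k p x = 0"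
    and x: "x \<le> T"
  shows "p x = 0"
proof -
  note m1 = mass_nonneg small
  have bd: "\<bar>p y\<bar> \<le> S * mass ^ n" if "y \<le> T" for n y
    using that
  proof (induction n arbitrary: y)
    case (Suc n)
    have S0: "0 \<le> S * mass ^ n" using Suc.IH[OF Suc.prems] by linarith
    show ?case
    proof (cases "0 < y")
      case True
      let ?p = "\<lambda>z. indicator {..y} z * p z"
      have pb: "\<bar>?p z\<bar> \<le> S * mass ^ n" for z
        using Suc.IH[of z] Suc.prems S0 by (cases "z \<le> y") auto
      have "conv k p y = conv k ?p y"
        unfolding conv_def by (intro Bochner_Integration.integral_cong) (use k_zero in \<open>auto simp: indicator_def\<close>)
      then have "\<bar>conv k p y\<bar> = \<bar>conv k ?p y\<bar>" by simp
      also have "\<dots> \<le> (LBINT z. \<bar>k (y - z) * ?p z\<bar>)" unfolding conv_def by (rule integral_abs_bound)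
      also have "\<dots> \<le> (LBINT z. k (y - z) * (S * mass ^ n))"
      proof (rule integral_mono)
        show "integrable lborel (\<lambda>z. \<bar>k (y - z) * ?p z\<bar>)"
          by (rule integrable_abs, rule conv_integrable_bounded[OF k_integrable _ pb]) measurable
        show "integrable lborel (\<lambda>z. k (y - z) * (S * mass ^ n))"
          by (rule conv_integrable_bounded[OF k_integrable, of _ "S * mass ^ n"]) (use S0 in auto)
        show "\<bar>k (y - z) * ?p z\<bar> \<le> k (y - z) * (S * mass ^ n)" for z
          using mult_left_mono[OF pb k_nonneg] by (simp only: abs_mult abs_of_nonneg[OF k_nonneg])
      qed
      also have "\<dots> = S * mass ^ Suc n"
        using lborel_integral_real_affine[of "-1" k y] by (simp add: mass_def)
      finally show ?thesis using eq[OF True Suc.prems] by simp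
    next
      case False
      then show ?thesis using p0[of y] mult_nonneg_nonneg[OF S0 m1(1)] by (simp add: ac_simps)
    qed
  qed (use S in simp)
  have "(\<lambda>n. S * mass ^ n) \<longlonglongrightarrow> S * 0" using m1 by (intro tendsto_intros LIMSEQ_power_zero) auto
  then have "\<bar>p x\<bar> \<le> 0" using bd[OF x] by (intro LIMSEQ_le_const[of "\<lambda>n. S * mass ^ n"]) auto
  then show ?thesis by simp
qed

text \<open>The mass condition makes the factor that \<open>conv_k_w\<close> produces at most \<open>1 / 2\<close>.\<close>

locale small_kernel = tail_kernel k for k :: "real \<Rightarrow> real" +
  fixes \<gamma> C :: real
  assumes \<gamma>: "0 < \<gamma>" "\<gamma> < 1"
    and k_power_bound: "0 < x \<Longrightarrow> k x \<le> C * x powr - \<gamma>"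
    and mass_small: "2 * mass * (1 + 1 / (1 - \<gamma>)) \<le> 1 / 2"
begin

text \<open>The singularity that the power bound permits at 0.  Convolution with \<open>k\<close> reproduces it with the factor
  \<open>1 / 2\<close>.\<close>

definition w :: "real \<Rightarrow> real" where "w y = (if 0 < y then y powr - \<gamma> else 0)"

lemma w_measurable [measurable]: "w \<in> borel_measurable borel"
  unfolding w_def[abs_def] by measurable

lemma w_nonneg: "0 \<le> w y"
  by (simp add: w_def)

lemma w_antimono: "0 < x \<Longrightarrow> x \<le> y \<Longrightarrow> w y \<le> w x"
  using \<gamma> by (simp add: w_def powr_mono2')

lemma C_nonneg: "0 \<le> C"
  using k_power_bound[of 1] k_nonneg[of 1] by simp

lemma k_le_w: "k x \<le> C * w x"
  using k_power_bound[of x] k_zero[of x] by (simp add: w_def)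

lemma w_integral:
  assumes a: "0 \<le> a"
  shows "integrable lborel (\<lambda>y. indicator {0..a} y * w y)"
    and "(LBINT y. indicator {0..a} y * w y) = a powr (1 - \<gamma>) / (1 - \<gamma>)"
proof -
  have "((\<lambda>y. y powr - \<gamma>) has_integral a powr (- \<gamma> + 1) / (- \<gamma> + 1)) {0..a}"
    using \<gamma> a by (intro has_integral_powr_from_0) auto
  then have "((\<lambda>y. if y \<in> {0..a} then y powr - \<gamma> else 0) has_integral a powr (1 - \<gamma>) / (1 - \<gamma>)) UNIV"
    by (simp only: has_integral_restrict_UNIV) (simp add: add.commute)
  moreover have "(\<lambda>y. if y \<in> {0..a} then y powr - \<gamma> else 0) = (\<lambda>y. indicator {0..a} y * w y)"
    by (auto simp: w_def indicator_def)
  ultimately have hi: "((\<lambda>y. indicator {0..a} y * w y) has_integral a powr (1 - \<gamma>) / (1 - \<gamma>)) UNIV" by simp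
  have "(\<integral>\<^sup>+y. ennreal (indicator {0..a} y * w y) \<partial>lborel) = ennreal (a powr (1 - \<gamma>) / (1 - \<gamma>))"
    by (rule nn_integral_has_integral_lborel[OF _ _ hi]) (auto simp: w_nonneg)
  moreover have "0 \<le> a powr (1 - \<gamma>) / (1 - \<gamma>)" using \<gamma> by simp
  ultimately show "integrable lborel (\<lambda>y. indicator {0..a} y * w y)"
    and "(LBINT y. indicator {0..a} y * w y) = a powr (1 - \<gamma>) / (1 - \<gamma>)"
    using nn_integral_eq_integrable[of "\<lambda>y. indicator {0..a} y * w y" lborel "a powr (1 - \<gamma>) / (1 - \<gamma>)"]
    by (auto simp: w_nonneg)
qed

lemma w_half: "0 < x \<Longrightarrow> w (x / 2) \<le> 2 * w x"
proof -
  assume x: "0 < x"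
  have "w (x / 2) = 2 powr \<gamma> * w x" using x by (simp add: w_def powr_divide powr_minus field_simps)
  also have "\<dots> \<le> 2 powr 1 * w x" using \<gamma> by (intro mult_right_mono w_nonneg powr_mono) auto
  finally show ?thesis by simp
qed

text \<open>Split at \<open>y = x / 2\<close>.  Above, \<open>w y \<le> 2 w x\<close> and the kernel integrates to at most \<open>mass\<close>.
  Below, the kernel is at most \<open>2 mass / x\<close> by monotonicity, and \<open>w\<close> is integrable at 0 because
  \<open>\<gamma> < 1\<close>.\<close>

lemma conv_k_w:
  shows "integrable lborel (\<lambda>y. k (x - y) * w y)" and "conv k w x \<le> 1 / 2 * w x"
proof -
  have z: "k (x - y) * w y = 0" if "x \<le> 0" for y
    using that k_zero[of "x - y"] by (cases "0 < y") (auto simp: w_def)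
  let ?R = "\<lambda>y. 2 * w x * k (x - y) + 2 * mass / x * (indicator {0..x / 2} y * w y)"
  have ik: "integrable lborel (\<lambda>y. k (x - y))" and ek: "(LBINT y. k (x - y)) = mass"
    using lborel_integrable_real_affine[OF k_integrable, of "-1" x]
      lborel_integral_real_affine[of "-1" k x] by (simp_all add: mass_def)
  have le: "k (x - y) * w y \<le> ?R y" if x: "0 < x" for y
  proof -
    have nn: "0 \<le> 2 * w x * k (x - y)" "0 \<le> 2 * mass / x * (indicator {0..x / 2} y * w y)"
      using mass_nonneg x by (auto simp: w_nonneg k_nonneg intro!: mult_nonneg_nonneg divide_nonneg_pos)
    consider "y \<le> 0" | "x \<le> y" | "0 < y" "y \<le> x / 2" | "x / 2 < y" "y < x" by linarith
    then show ?thesis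
    proof cases
      case 1 then show ?thesis using nn by (simp add: w_def)
    next
      case 2 then show ?thesis using nn k_zero[of "x - y"] by simp
    next
      case 3
      have "k (x - y) \<le> k (x / 2)" using 3 x by (intro k_antimono) auto
      also have "\<dots> \<le> 2 * mass / x"
        using k_le[of "x / 2"] K_le_mass[of "x / 2"] x by (simp add: field_simps)
      finally have "k (x - y) * w y \<le> 2 * mass / x * w y" by (rule mult_right_mono) (rule w_nonneg)
      then show ?thesis using 3 nn by simp
    next
      case 4
      have "w y \<le> w (x / 2)" using 4 x by (intro w_antimono) auto
      also have "\<dots> \<le> 2 * w x" by (rule w_half[OF x])
      finally have "k (x - y) * w y \<le> k (x - y) * (2 * w x)" by (rule mult_left_mono) (rule k_nonneg)
      then show ?thesis using nn by (simp add: mult.commute)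
    qed
  qed
  have iR: "integrable lborel ?R" if "0 < x" using ik w_integral(1)[of "x / 2"] that by simp
  show i: "integrable lborel (\<lambda>y. k (x - y) * w y)"
  proof (cases "0 < x")
    case True
    show ?thesis
    proof (rule Bochner_Integration.integrable_bound[OF iR[OF True]])
      show "AE y in lborel. norm (k (x - y) * w y) \<le> norm (?R y)"
      proof (rule AE_I2)
        fix y
        have "\<bar>k (x - y) * w y\<bar> = k (x - y) * w y" by (simp add: k_nonneg w_nonneg)
        also have "\<dots> \<le> ?R y" by (rule le[OF True])
        also have "\<dots> \<le> \<bar>?R y\<bar>" by (rule abs_ge_self)
        finally show "norm (k (x - y) * w y) \<le> norm (?R y)" by (simp only: real_norm_def)
      qed
    qed measurable
  next
    case False
    then have "(\<lambda>y. k (x - y) * w y) = (\<lambda>_. 0)" using z by (simp add: fun_eq_iff)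
    then show ?thesis by simp
  qed
  show "conv k w x \<le> 1 / 2 * w x"
  proof (cases "0 < x")
    case True
    have "conv k w x \<le> (LBINT y. ?R y)"
      unfolding conv_def by (rule integral_mono[OF i iR[OF True] le[OF True]])
    also have "\<dots> = 2 * w x * mass + 2 * mass / x * ((x / 2) powr (1 - \<gamma>) / (1 - \<gamma>))"
      using ik w_integral[of "x / 2"] True by (simp add: ek)
    also have "(x / 2) powr (1 - \<gamma>) = x / 2 * w (x / 2)"
      using True by (simp add: w_def powr_diff powr_minus field_simps)
    also have "2 * mass / x * (x / 2 * w (x / 2) / (1 - \<gamma>)) = mass / (1 - \<gamma>) * w (x / 2)"
      using True \<gamma> by (simp add: field_simps)
    also have "\<dots> \<le> mass / (1 - \<gamma>) * (2 * w x)"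
      using \<gamma> mass_nonneg by (intro mult_left_mono w_half[OF True]) auto
    also have "2 * w x * mass + mass / (1 - \<gamma>) * (2 * w x) = 2 * mass * (1 + 1 / (1 - \<gamma>)) * w x"
      by (simp add: algebra_simps)
    also have "\<dots> \<le> 1 / 2 * w x" by (rule mult_right_mono[OF mass_small w_nonneg])
    finally show ?thesis by simp
  next
    case False
    then have "(\<lambda>y. k (x - y) * w y) = (\<lambda>_. 0)" using z by (simp add: fun_eq_iff)
    then show ?thesis using False by (simp add: conv_def w_def)
  qed
qed

lemma conv_k_weighted:
  assumes p[measurable]: "p \<in> borel_measurable borel" and A: "\<And>y. \<bar>p y\<bar> \<le> A * w y"
  shows "integrable lborel (\<lambda>y. k (x - y) * p y)" and "\<bar>conv k p x\<bar> \<le> A / 2 * w x"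
proof -
  have A0: "0 \<le> A" using A[of 1] by (simp add: w_def)
  have le: "\<bar>k (x - y) * p y\<bar> \<le> A * (k (x - y) * w y)" for y
    using mult_left_mono[OF A[of y] k_nonneg[of "x - y"]] by (simp add: abs_mult k_nonneg ac_simps)
  show i: "integrable lborel (\<lambda>y. k (x - y) * p y)"
  proof (rule Bochner_Integration.integrable_bound)
    show "integrable lborel (\<lambda>y. A * (k (x - y) * w y))" using conv_k_w(1) by simp
    show "AE y in lborel. norm (k (x - y) * p y) \<le> norm (A * (k (x - y) * w y))"
      unfolding real_norm_def by (intro AE_I2 order_trans[OF le abs_ge_self])
  qed measurable
  have "\<bar>conv k p x\<bar> \<le> (LBINT y. \<bar>k (x - y) * p y\<bar>)" unfolding conv_def by (rule integral_abs_bound)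
  also have "\<dots> \<le> (LBINT y. A * (k (x - y) * w y))"
    using i conv_k_w(1) le by (intro integral_mono) auto
  also have "\<dots> = A * conv k w x" by (simp add: conv_def)
  also have "\<dots> \<le> A * (1 / 2 * w x)" by (rule mult_left_mono[OF conv_k_w(2) A0])
  finally show "\<bar>conv k p x\<bar> \<le> A / 2 * w x" by simp
qed

primrec iter :: "nat \<Rightarrow> real \<Rightarrow> real" where
  "iter 0 = k"
| "iter (Suc n) = conv k (iter n)"

lemma conv_measurable [measurable]:
  assumes [measurable]: "f \<in> borel_measurable borel" "g \<in> borel_measurable borel"
  shows "conv f g \<in> borel_measurable borel"
  unfolding conv_def[abs_def] by measurable

lemma iter_measurable [measurable]: "iter n \<in> borel_measurable borel"
  by (induction n) auto

lemma iter_bound: "\<bar>iter n x\<bar> \<le> C * (1 / 2) ^ n * w x"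
proof (induction n arbitrary: x)
  case 0
  then show ?case using k_le_w[of x] k_nonneg[of x] by simp
next
  case (Suc n)
  then show ?case using conv_k_weighted(2)[OF iter_measurable Suc, of x] by simp
qed

text \<open>The Neumann series of \<open>h + conv k h = - k\<close>.  It converges pointwise because the \<open>n\<close>-th term is at
  most \<open>C w x / 2 ^ n\<close>.\<close>

definition resolvent :: "real \<Rightarrow> real" where
  "resolvent x = (\<Sum>n. (- 1) ^ Suc n * iter n x)"

lemma summable_iter: "summable (\<lambda>n. \<bar>iter n x\<bar>)"
proof (rule summable_comparison_test')
  show "summable (\<lambda>n. C * w x * (1 / 2) ^ n)" by (intro summable_mult summable_geometric) simp
  show "norm \<bar>iter n x\<bar> \<le> C * w x * (1 / 2) ^ n" for n using iter_bound[of n x] by (simp add: ac_simps)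
qed

lemma summable_resolvent: "summable (\<lambda>n. (- 1) ^ Suc n * iter n x)"
  by (rule summable_norm_cancel) (simp add: abs_mult summable_iter)

lemma resolvent_measurable [measurable]: "resolvent \<in> borel_measurable borel"
  unfolding resolvent_def[abs_def] by measurable

lemma resolvent_bound: "\<bar>resolvent x\<bar> \<le> 2 * C * w x"
proof -
  have "\<bar>resolvent x\<bar> \<le> (\<Sum>n. \<bar>(- 1) ^ Suc n * iter n x\<bar>)"
    unfolding resolvent_def by (rule summable_rabs) (simp add: abs_mult summable_iter)
  also have "\<dots> \<le> (\<Sum>n. C * w x * (1 / 2) ^ n)"
    using iter_bound[of _ x] by (intro suminf_le summable_mult summable_geometric) (auto simp: abs_mult summable_iter ac_simps)
  also have "\<dots> = 2 * C * w x" by (subst suminf_mult) (auto simp: suminf_geometric)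
  finally show ?thesis .
qed

lemma resolvent_equation: "resolvent x + conv k resolvent x = - k x"
proof -
  let ?f = "\<lambda>n y. k (x - y) * ((- 1) ^ Suc n * iter n y)"
  have i: "integrable lborel (?f n)" for n
  proof -
    have "integrable lborel (\<lambda>y. (- 1) ^ Suc n * (k (x - y) * iter n y))"
      by (rule integrable_mult_right) (rule conv_k_weighted(1)[OF iter_measurable iter_bound])
    then show ?thesis by (simp only: mult.left_commute)
  qed
  have s1: "summable (\<lambda>n. LBINT y. norm (?f n y))"
  proof (rule summable_comparison_test')
    show "summable (\<lambda>n. C * w x * (1 / 2) ^ Suc n)" by (intro summable_mult summable_geometric summable_Suc_iff[THEN iffD2]) simp
    show "norm (LBINT y. norm (?f n y)) \<le> C * w x * (1 / 2) ^ Suc n" for n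
    proof -
      have "(LBINT y. norm (?f n y)) = conv k (\<lambda>y. \<bar>iter n y\<bar>) x"
        by (simp add: conv_def abs_mult k_nonneg)
      then show ?thesis
        using conv_k_weighted(2)[of "\<lambda>y. \<bar>iter n y\<bar>" "C * (1 / 2) ^ n" x] iter_bound[of n] by (simp add: ac_simps)
    qed
  qed
  have s2: "AE y in lborel. summable (\<lambda>n. norm (?f n y))"
    by (intro AE_I2) (simp add: abs_mult summable_mult summable_iter)
  have "conv k resolvent x = (LBINT y. (\<Sum>n. ?f n y))"
    unfolding conv_def resolvent_def by (simp add: suminf_mult[OF summable_resolvent] del: power_Suc)
  also have "\<dots> = (\<Sum>n. LBINT y. ?f n y)"
    by (rule integral_suminf[OF i s2 s1])
  also have "\<dots> = (\<Sum>n. (- 1) ^ Suc n * iter (Suc n) x)"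
    by (intro suminf_cong) (simp add: conv_def mult.left_commute[of "k _"] del: power_Suc)
  finally have c: "conv k resolvent x = (\<Sum>n. (- 1) ^ Suc n * iter (Suc n) x)" .
  have "resolvent x = (- 1) ^ Suc 0 * iter 0 x + (\<Sum>n. (- 1) ^ Suc (Suc n) * iter (Suc n) x)"
    unfolding resolvent_def using suminf_split_head[OF summable_resolvent[of x]] by simp
  also have "(\<Sum>n. (- 1) ^ Suc (Suc n) * iter (Suc n) x) = - (\<Sum>n. (- 1) ^ Suc n * iter (Suc n) x)"
  proof -
    have "summable (\<lambda>n. (- 1) ^ Suc n * iter (Suc n) x)"
    proof (rule summable_norm_cancel)
      show "summable (\<lambda>n. norm ((- 1) ^ Suc n * iter (Suc n) x))"
        using summable_Suc_iff[of "\<lambda>n. \<bar>iter n x\<bar>"] summable_iter[of x]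
        by (simp add: abs_mult del: iter.simps)
    qed
    from suminf_minus[OF this] show ?thesis by simp
  qed
  finally show ?thesis unfolding c by simp
qed

text \<open>Cutting off the singularity of \<open>p\<close> at 0 leaves a bounded function, whose convolution with \<open>k\<close> is
  continuous.  On \<open>(c, \<infinity>)\<close> the error is at most \<open>k (c / 2)\<close> times the integral of the part cut off,
  so the convergence is locally uniform.\<close>

lemma conv_k_weighted_continuous:
  assumes p[measurable]: "p \<in> borel_measurable borel" and A: "\<And>y. \<bar>p y\<bar> \<le> A * w y"
  shows "continuous_on {0<..} (conv k p)"
proof -
  have A0: "0 \<le> A" using A[of 1] by (simp add: w_def)
  define \<eta> where "\<eta> n = 1 / real (Suc n)" for n
  have \<eta>0: "0 < \<eta> n" for n by (simp add: \<eta>_def)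
  define p2 where "p2 n y = indicator {\<eta> n<..} y * p y" for n y
  have p2m[measurable]: "p2 n \<in> borel_measurable borel" for n unfolding p2_def by measurable
  have p2b: "\<bar>p2 n y\<bar> \<le> A * w (\<eta> n)" for n y
  proof (cases "\<eta> n < y")
    case True
    then have "w y \<le> w (\<eta> n)" using \<eta>0[of n] by (intro w_antimono) auto
    then show ?thesis using A[of y] True mult_left_mono[of "w y" "w (\<eta> n)" A] A0 by (simp add: p2_def)
  qed (use A0 w_nonneg in \<open>simp add: p2_def\<close>)
  have cont: "continuous_on UNIV (conv k (p2 n))" for n by (rule conv_k_continuous[OF p2m p2b])
  have est: "\<bar>conv k p x - conv k (p2 n) x\<bar> \<le> k (c / 2) * A * (\<eta> n powr (1 - \<gamma>) / (1 - \<gamma>))"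
    if c: "0 < c" "c < x" "\<eta> n < c / 2" for n x c
  proof -
    have i1: "integrable lborel (\<lambda>y. k (x - y) * p y)" by (rule conv_k_weighted(1)[OF p A])
    have i2: "integrable lborel (\<lambda>y. k (x - y) * p2 n y)" by (rule conv_integrable_bounded[OF k_integrable p2m p2b])
    have "\<bar>conv k p x - conv k (p2 n) x\<bar> = \<bar>LBINT y. k (x - y) * p y - k (x - y) * p2 n y\<bar>"
      unfolding conv_def using i1 i2 by simp
    also have "\<dots> \<le> (LBINT y. \<bar>k (x - y) * p y - k (x - y) * p2 n y\<bar>)" by (rule integral_abs_bound)
    also have "\<dots> \<le> (LBINT y. k (c / 2) * A * (indicator {0..\<eta> n} y * w y))"
    proof (rule integral_mono)
      show "integrable lborel (\<lambda>y. k (c / 2) * A * (indicator {0..\<eta> n} y * w y))"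
        using w_integral(1)[of "\<eta> n"] \<eta>0[of n] by simp
      fix y
      show "\<bar>k (x - y) * p y - k (x - y) * p2 n y\<bar> \<le> k (c / 2) * A * (indicator {0..\<eta> n} y * w y)"
      proof -
        consider "y \<le> 0" | "\<eta> n < y" | "0 < y" "y \<le> \<eta> n" by linarith
        then show ?thesis
        proof cases
          case 1
          then have "p y = 0" using A[of y] by (simp add: w_def)
          then show ?thesis using 1 \<eta>0[of n] by (simp add: p2_def w_def)
        next
          case 2
          then show ?thesis by (simp add: p2_def)
        next
          case 3
          have "k (x - y) \<le> k (c / 2)" using 3 c by (intro k_antimono) auto
          then have "k (x - y) * \<bar>p y\<bar> \<le> k (c / 2) * (A * w y)" by (intro mult_mono A k_nonneg) auto
          then show ?thesis using 3 by (simp add: p2_def abs_mult k_nonneg)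
        qed
      qed
    qed (use i1 i2 in auto)
    also have "\<dots> = k (c / 2) * A * (\<eta> n powr (1 - \<gamma>) / (1 - \<gamma>))"
      using w_integral(2)[of "\<eta> n"] \<eta>0[of n] by simp
    finally show ?thesis .
  qed
  have cc: "continuous_on {c<..} (conv k p)" if c: "0 < c" for c
  proof (rule uniform_limit_theorem[where F = sequentially and f = "\<lambda>n. conv k (p2 n)"])
    show "\<forall>\<^sub>F n in sequentially. continuous_on {c<..} (conv k (p2 n))"
      by (intro always_eventually allI continuous_on_subset[OF cont]) simp
    show "uniform_limit {c<..} (\<lambda>n. conv k (p2 n)) (conv k p) sequentially"
    proof (rule uniform_limitI)
      fix e :: real assume e: "0 < e"
      have \<eta>t: "\<eta> \<longlonglongrightarrow> 0" unfolding \<eta>_def by (rule LIMSEQ_Suc[OF lim_const_over_n])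
      have "(\<lambda>n. \<eta> n powr (1 - \<gamma>)) \<longlonglongrightarrow> 0"
        using \<gamma> by (intro tendsto_zero_powrI[OF \<eta>t tendsto_const]) (auto simp: \<eta>_def)
      then have "(\<lambda>n. k (c / 2) * A * (\<eta> n powr (1 - \<gamma>) / (1 - \<gamma>))) \<longlonglongrightarrow> k (c / 2) * A * (0 / (1 - \<gamma>))"
        using \<gamma> by (intro tendsto_intros) auto
      then have "\<forall>\<^sub>F n in sequentially. k (c / 2) * A * (\<eta> n powr (1 - \<gamma>) / (1 - \<gamma>)) < e"
        by (rule order_tendstoD(2)) (use e in simp)
      moreover have "\<forall>\<^sub>F n in sequentially. \<eta> n < c / 2" by (rule order_tendstoD(2)[OF \<eta>t]) (use c in simp)
      ultimately show "\<forall>\<^sub>F n in sequentially. \<forall>x\<in>{c<..}. dist (conv k (p2 n) x) (conv k p x) < e"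
      proof eventually_elim
        case (elim n)
        show ?case
        proof
          fix x assume "x \<in> {c<..}"
          then show "dist (conv k (p2 n) x) (conv k p x) < e"
            using est[OF c _ elim(2), of x] elim(1) by (simp add: dist_real_def abs_minus_commute)
        qed
      qed
    qed
  qed simp
  show ?thesis
  proof (rule continuous_at_imp_continuous_on, rule ballI)
    fix x :: real assume "x \<in> {0<..}"
    then have "continuous_on {x / 2<..} (conv k p)" "x \<in> {x / 2<..}" using cc[of "x / 2"] by auto
    then show "isCont (conv k p) x" by (simp add: continuous_on_eq_continuous_at)
  qed
qed

end

text \<open>Exponential tilting commutes with convolution.  It is the means of making the mass of a kernel small
  without changing the solutions of Volterra equations, up to the factor \<open>e^(- l x)\<close>.\<close>

lemma conv_exp_tilt:
  "conv (\<lambda>x. exp (- l * x) * f x) (\<lambda>y. exp (- l * y) * g y) x = exp (- l * x) * conv f g x"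
proof -
  have "exp (- l * (x - y)) * f (x - y) * (exp (- l * y) * g y) = exp (- l * x) * (f (x - y) * g y)" for y
  proof -
    have "exp (- l * (x - y)) * exp (- l * y) = exp (- l * x)"
      by (simp add: exp_add[symmetric] algebra_simps)
    then show ?thesis by (metis (no_types, lifting) mult.assoc mult.left_commute)
  qed
  then show ?thesis unfolding conv_def by (simp only: integral_mult_right_zero)
qed

context tail_kernel
begin

lemma tilt_tail_kernel: "0 < l \<Longrightarrow> tail_kernel (\<lambda>x. exp (- l * x) * k x)"
proof
  assume l: "0 < l"
  show "exp (- l * y) * k y \<le> exp (- l * x) * k x" if "0 < x" "x \<le> y" for x y
    using that l by (intro mult_mono k_antimono) (auto simp: k_nonneg)
  show "integrable lborel (\<lambda>x. exp (- l * x) * k x)"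
  proof (rule Bochner_Integration.integrable_bound[OF k_integrable])
    show "AE x in lborel. norm (exp (- l * x) * k x) \<le> norm (k x)"
    proof (rule AE_I2)
      fix x
      have "exp (- l * x) * k x \<le> 1 * k x" if "0 < x"
        using that l by (intro mult_right_mono k_nonneg) auto
      then show "norm (exp (- l * x) * k x) \<le> norm (k x)"
        using k_zero[of x] k_nonneg[of x] by (cases "0 < x") (auto simp: abs_mult)
    qed
  qed measurable
qed (auto simp: k_nonneg k_zero)

lemma tilt_mass_small:
  assumes e: "0 < e"
  obtains l where "0 < l" "(LBINT x. exp (- l * x) * k x) < e"
proof -
  have "(\<lambda>n. LBINT x. exp (- real (Suc n) * x) * k x) \<longlonglongrightarrow> (\<integral>x. 0 \<partial>(lborel :: real measure))"
  proof (rule integral_dominated_convergence[where w = k])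
    show "AE x in lborel. (\<lambda>n. exp (- real (Suc n) * x) * k x) \<longlonglongrightarrow> 0"
    proof (rule AE_I2)
      fix x :: real
      show "(\<lambda>n. exp (- real (Suc n) * x) * k x) \<longlonglongrightarrow> 0"
      proof (cases "0 < x")
        case True
        have "(\<lambda>n. exp (- x) ^ n) \<longlonglongrightarrow> 0" using True by (intro LIMSEQ_power_zero) auto
        from tendsto_mult_left_zero[OF LIMSEQ_Suc[OF this], of "k x"] show ?thesis
          by (simp only: exp_of_nat_mult[symmetric]) (simp only: mult_minus_right mult_minus_left)
      qed (simp add: k_zero)
    qed
    show "AE x in lborel. norm (exp (- real (Suc n) * x) * k x) \<le> k x" for n
    proof (rule AE_I2)
      fix x
      have "exp (- real (Suc n) * x) * k x \<le> 1 * k x" if "0 < x"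
      proof (rule mult_right_mono[OF _ k_nonneg])
        have "0 \<le> real (Suc n) * x" using that by (intro mult_nonneg_nonneg) auto
        then show "exp (- real (Suc n) * x) \<le> 1" by (simp only: mult_minus_left exp_le_one_iff neg_le_0_iff_le)
      qed
      then show "norm (exp (- real (Suc n) * x) * k x) \<le> k x"
        using k_zero[of x] k_nonneg[of x] by (cases "0 < x") (auto simp: abs_mult)
    qed
  qed (use k_integrable in auto)
  then have "\<forall>\<^sub>F n in sequentially. (LBINT x. exp (- real (Suc n) * x) * k x) < e"
    by (rule order_tendstoD(2)) (use e in simp)
  then obtain n where "(LBINT x. exp (- real (Suc n) * x) * k x) < e" by (auto simp: eventually_sequentially)
  then show thesis using that[of "real (Suc n)"] by simp
qed

lemma volterra_unique:
  assumes p[measurable]: "p \<in> borel_measurable borel" and p0: "\<And>y. y \<le> 0 \<Longrightarrow> p y = 0"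
    and S: "\<And>y. y \<le> T \<Longrightarrow> \<bar>p y\<bar> \<le> S" and eq: "\<And>x. 0 < x \<Longrightarrow> x \<le> T \<Longrightarrow> p x + conv k p x = 0"
    and x: "x \<le> T"
  shows "p x = 0"
proof -
  obtain l where l: "0 < l" "(LBINT x. exp (- l * x) * k x) < 1 / 2" using tilt_mass_small[of "1 / 2"] by auto
  interpret kt: tail_kernel "\<lambda>x. exp (- l * x) * k x" by (rule tilt_tail_kernel[OF l(1)])
  have "exp (- l * x) * p x = 0"
  proof (rule kt.volterra_homogeneous_zero[OF _ _ _ _ _ x])
    show "kt.mass \<le> 1 / 2" using l(2) unfolding kt.mass_def by simp
    show "\<bar>exp (- l * y) * p y\<bar> \<le> S" if "y \<le> T" for y
    proof (cases "0 < y")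
      case True
      then have "exp (- l * y) * \<bar>p y\<bar> \<le> 1 * S" using l S[OF that] by (intro mult_mono) auto
      then show ?thesis by (simp add: abs_mult)
    next
      case False
      then show ?thesis using p0[of y] S[OF that] by simp
    qed
    show "exp (- l * x) * p x + conv (\<lambda>x. exp (- l * x) * k x) (\<lambda>x. exp (- l * x) * p x) x = 0"
      if "0 < x" "x \<le> T" for x
      using eq[OF that] unfolding conv_exp_tilt by (simp add: distrib_left[symmetric])
  qed (use p0 in auto)
  then show ?thesis by simp
qed

text \<open>A tilt by a large \<open>l\<close> makes the Neumann series converge; tilting the solution back gives a resolvent of
  the original kernel,
  with bounds that grow exponentially at infinity but stay finite on compact subsets of \<open>(0, \<infinity>)\<close>.\<close>

lemma ex_resolvent:
  assumes \<gamma>: "0 < \<gamma>" "\<gamma> < 1" and C: "\<And>x. 0 < x \<Longrightarrow> k x \<le> C * x powr - \<gamma>"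
  obtains h where "h \<in> borel_measurable borel" "\<And>x. x \<le> 0 \<Longrightarrow> h x = 0"
    "\<And>T. integrable lborel (\<lambda>y. indicator {0..T} y * h y)"
    "\<And>x. h x + conv k h x = - k x" "continuous_on {0<..} (conv k h)"
    "\<And>a T. 0 < a \<Longrightarrow> \<exists>b. \<forall>x\<in>{a..T}. \<bar>h x\<bar> \<le> b"
proof -
  \<comment> \<open>The largest mass that the contraction argument tolerates.\<close>
  define q where "q = 1 / 2 / (2 * (1 + 1 / (1 - \<gamma>)))"
  have p0: "0 < 2 * (1 + 1 / (1 - \<gamma>))" using \<gamma> by (simp add: add_pos_pos)
  then have q: "0 < q" by (simp add: q_def)
  obtain l where l: "0 < l" "(LBINT x. exp (- l * x) * k x) < q" using tilt_mass_small[OF q] by auto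
  let ?k = "\<lambda>x. exp (- l * x) * k x"
  interpret kt: tail_kernel ?k by (rule tilt_tail_kernel[OF l(1)])
  interpret kt: small_kernel ?k \<gamma> C
  proof
    show "exp (- l * x) * k x \<le> C * x powr - \<gamma>" if "0 < x" for x
    proof -
      have "exp (- l * x) * k x \<le> 1 * k x" using that l by (intro mult_right_mono k_nonneg) auto
      then show ?thesis using C[OF that] by simp
    qed
    have "kt.mass \<le> q" using l(2) unfolding kt.mass_def by simp
    then have "kt.mass * (2 * (1 + 1 / (1 - \<gamma>))) \<le> q * (2 * (1 + 1 / (1 - \<gamma>)))" using p0 by (intro mult_right_mono) auto
    also have "\<dots> = 1 / 2" using p0 by (simp add: q_def)
    finally show "2 * kt.mass * (1 + 1 / (1 - \<gamma>)) \<le> 1 / 2" by (simp only: ac_simps)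
  qed (use \<gamma> in auto)
  define h where "h x = exp (l * x) * kt.resolvent x" for x
  have tilt: "(\<lambda>x. exp (- l * x) * h x) = kt.resolvent"
    by (simp add: h_def exp_minus field_simps fun_eq_iff)
  have ch: "conv k h x = exp (l * x) * conv ?k kt.resolvent x" for x
    using conv_exp_tilt[of l k h x] unfolding tilt by (simp add: exp_minus field_simps)
  have hm[measurable]: "h \<in> borel_measurable borel" unfolding h_def[abs_def] by measurable
  have hb: "\<bar>h x\<bar> \<le> exp (l * x) * (2 * C * kt.w x)" for x
    using mult_left_mono[OF kt.resolvent_bound[of x] exp_ge_zero[of "l * x"]]
    by (simp only: h_def abs_mult abs_exp_cancel)
  have C0: "0 \<le> C" by (rule kt.C_nonneg)
  show thesis
  proof (rule that[OF hm])
    show "h x = 0" if "x \<le> 0" for x using hb[of x] that by (simp add: kt.w_def)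
    show "integrable lborel (\<lambda>y. indicator {0..T} y * h y)" for T
    proof (cases "0 \<le> T")
      case True
      show ?thesis
      proof (rule Bochner_Integration.integrable_bound)
        show "integrable lborel (\<lambda>y. exp (l * T) * (2 * C) * (indicator {0..T} y * kt.w y))"
          using kt.w_integral(1)[OF True] by simp
        show "AE y in lborel. norm (indicator {0..T} y * h y) \<le> norm (exp (l * T) * (2 * C) * (indicator {0..T} y * kt.w y))"
        proof (rule AE_I2)
          fix y
          have "\<bar>h y\<bar> \<le> exp (l * T) * (2 * C * kt.w y)" if "y \<le> T"
            using that l C0 kt.w_nonneg[of y] by (intro order_trans[OF hb] mult_right_mono) auto
          then show "norm (indicator {0..T} y * h y) \<le> norm (exp (l * T) * (2 * C) * (indicator {0..T} y * kt.w y))"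
            using C0 kt.w_nonneg[of y] by (simp add: indicator_def abs_mult mult.assoc)
        qed
      qed measurable
    qed simp
    show "h x + conv k h x = - k x" for x
    proof -
      have "h x + conv k h x = exp (l * x) * (kt.resolvent x + conv ?k kt.resolvent x)"
        unfolding ch by (simp add: h_def distrib_left)
      also have "\<dots> = - k x" unfolding kt.resolvent_equation by (simp add: exp_minus)
      finally show ?thesis .
    qed
    show "continuous_on {0<..} (conv k h)"
      unfolding ch[abs_def]
      by (intro continuous_intros kt.conv_k_weighted_continuous[OF kt.resolvent_measurable kt.resolvent_bound])
    show "\<exists>b. \<forall>x\<in>{a..T}. \<bar>h x\<bar> \<le> b" if a: "0 < a" for a T
    proof (intro exI ballI)
      fix x assume x: "x \<in> {a..T}"
      have "exp (l * x) * (2 * C * kt.w x) \<le> exp (l * T) * (2 * C * kt.w a)"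
        using x a l C0 by (intro mult_mono kt.w_antimono) (auto simp: kt.w_nonneg)
      then show "\<bar>h x\<bar> \<le> exp (l * T) * (2 * C * kt.w a)" using hb[of x] by linarith
    qed
  qed
qed

end

text \<open>Fubini's theorem in the form in which a convolution is moved from one factor to another.\<close>

lemma integral_conv_swap:
  fixes \<phi> f g :: "real \<Rightarrow> real"
  assumes [measurable]: "\<phi> \<in> borel_measurable borel" "f \<in> borel_measurable borel"
    and g: "integrable lborel g"
    and i: "\<And>y. integrable lborel (\<lambda>s. \<phi> s * f (s - y))"
    and D: "\<And>y. (LBINT s. \<bar>\<phi> s * f (s - y)\<bar>) \<le> D"
  shows "(LBINT s. \<phi> s * conv f g s) = (LBINT y. g y * (LBINT s. \<phi> s * f (s - y)))"
proof -
  have [measurable]: "g \<in> borel_measurable borel" using g by auto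
  let ?F = "\<lambda>y s. \<phi> s * f (s - y) * g y"
  have nF: "(LBINT s. norm (?F y s)) = \<bar>g y\<bar> * (LBINT s. \<bar>\<phi> s * f (s - y)\<bar>)" for y
    by (simp add: abs_mult mult.commute)
  have "integrable (lborel \<Otimes>\<^sub>M lborel) (case_prod ?F)"
  proof (rule lborel_pair.Fubini_integrable)
    show "case_prod ?F \<in> borel_measurable (lborel \<Otimes>\<^sub>M lborel)" by measurable
    show "integrable lborel (\<lambda>y. LBINT s. norm (case (y, s) of (y, s) \<Rightarrow> ?F y s))"
      unfolding prod.case nF
    proof (rule Bochner_Integration.integrable_bound)
      show "integrable lborel (\<lambda>y. D * g y)" using g by simp
      show "AE y in lborel. norm (\<bar>g y\<bar> * (LBINT s. \<bar>\<phi> s * f (s - y)\<bar>)) \<le> norm (D * g y)"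
      proof (rule AE_I2)
        fix y
        have "0 \<le> (LBINT s. \<bar>\<phi> s * f (s - y)\<bar>)" by simp
        then have "\<bar>g y\<bar> * \<bar>LBINT s. \<bar>\<phi> s * f (s - y)\<bar>\<bar> \<le> \<bar>g y\<bar> * \<bar>D\<bar>"
          using D[of y] by (intro mult_left_mono) auto
        then show "norm (\<bar>g y\<bar> * (LBINT s. \<bar>\<phi> s * f (s - y)\<bar>)) \<le> norm (D * g y)"
          by (simp add: abs_mult mult.commute)
      qed
    qed measurable
    show "AE y in lborel. integrable lborel (\<lambda>s. case (y, s) of (y, s) \<Rightarrow> ?F y s)"
      using i by (auto intro!: AE_I2 integrable_mult_left)
  qed
  from lborel_pair.Fubini_integral[OF this]
  have "(LBINT s. (LBINT y. ?F y s)) = (LBINT y. (LBINT s. ?F y s))" .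
  moreover have "(LBINT y. ?F y s) = \<phi> s * conv f g s" for s
    unfolding conv_def mult.assoc by (rule integral_mult_right_zero)
  ultimately show ?thesis by (simp add: mult.commute)
qed

section \<open>Representation of the solution and its one-sided derivatives\<close>

text \<open>A kernel with its resolvent \<open>h\<close>, the solution of \<open>h + conv k h = - k\<close>.  Formally \<open>1 + H\<close>, with
  \<open>H\<close> the primitive of \<open>h\<close>, solves the renewal equation with right-hand side 1.\<close>

locale kernel_resolvent = tail_kernel k for k :: "real \<Rightarrow> real" +
  fixes h :: "real \<Rightarrow> real"
  assumes h_measurable [measurable]: "h \<in> borel_measurable borel"
    and h_zero: "x \<le> 0 \<Longrightarrow> h x = 0"
    and h_integrable: "integrable lborel (\<lambda>y. indicator {0..T} y * h y)"
    and h_eq: "h x + conv k h x = - k x"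
    and conv_k_h_continuous: "continuous_on {0<..} (conv k h)"
    and h_locally_bounded: "0 < a \<Longrightarrow> \<exists>b. \<forall>x\<in>{a..T}. \<bar>h x\<bar> \<le> b"
begin

definition H :: "real \<Rightarrow> real" where "H x = (LBINT y. (if 0 \<le> y \<and> y \<le> x then h y else 0))"

lemma H_indicator: "H x = (LBINT y. indicator {0..x} y * h y)"
  unfolding H_def by (intro Bochner_Integration.integral_cong) (auto simp: indicator_def)

lemma H_measurable [measurable]: "H \<in> borel_measurable borel"
  unfolding H_def[abs_def] by measurable

lemma H_nonpos: "x \<le> 0 \<Longrightarrow> H x = 0"
proof -
  assume "x \<le> 0"
  then have "(\<lambda>y. if 0 \<le> y \<and> y \<le> x then h y else 0) = (\<lambda>_. 0)" using h_zero by (auto simp: fun_eq_iff)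
  then show ?thesis by (simp add: H_def)
qed

lemma H_bound: "x \<le> T \<Longrightarrow> \<bar>H x\<bar> \<le> (LBINT y. \<bar>indicator {0..T} y * h y\<bar>)"
proof -
  assume "x \<le> T"
  have "\<bar>H x\<bar> \<le> (LBINT y. \<bar>indicator {0..x} y * h y\<bar>)" unfolding H_indicator by (rule integral_abs_bound)
  also have "\<dots> \<le> (LBINT y. \<bar>indicator {0..T} y * h y\<bar>)"
    using \<open>x \<le> T\<close> by (intro integral_mono integrable_abs h_integrable) (auto simp: indicator_def)
  finally show ?thesis .
qed

lemma H_diff:
  assumes "0 \<le> a" "a \<le> b"
  shows "integrable lborel (\<lambda>y. indicator {a<..b} y * h y)"
    and "H b - H a = (LBINT y. indicator {a<..b} y * h y)"
proof -
  have e: "indicator {a<..b} y * h y = indicator {0..b} y * h y - indicator {0..a} y * h y" for y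
    using assms by (auto simp: indicator_def)
  show "integrable lborel (\<lambda>y. indicator {a<..b} y * h y)"
    unfolding e by (intro Bochner_Integration.integrable_diff h_integrable)
  show "H b - H a = (LBINT y. indicator {a<..b} y * h y)"
    unfolding e H_indicator using h_integrable by simp
qed

text \<open>The integrated resolvent equation.  Integrating \<open>h = - k - conv k h\<close> over \<open>[0, x]\<close>, the claim is
  that the integral of \<open>conv k h\<close> equals \<open>conv k H x\<close>; by Fubini's theorem both are
  \<open>\<integral> h y * K (x - y) dy\<close>.\<close>

lemma H_volterra: "H x + K x + conv k H x = 0"
proof -
  let ?h = "\<lambda>y. indicator {0..x} y * h y"
  have ihx: "integrable lborel ?h" by (rule h_integrable)
  have ck: "conv k ?h s = conv k h s" if "s \<le> x" for s
    unfolding conv_def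
  proof (rule Bochner_Integration.integral_cong[OF refl])
    fix y show "k (s - y) * ?h y = k (s - y) * h y"
      using that k_zero[of "s - y"] h_zero[of y] by (cases "0 \<le> y"; cases "y \<le> x") auto
  qed
  have iks: "integrable lborel (\<lambda>s. k (s - y))" "(LBINT s. k (s - y)) = mass" for y
    using lborel_integrable_real_affine[OF k_integrable, of 1 "- y"]
      lborel_integral_real_affine[of 1 k "- y"] by (simp_all add: mass_def)
  have ikx: "integrable lborel (\<lambda>s. k (x - s))" "(LBINT s. k (x - s)) = mass"
    using lborel_integrable_real_affine[OF k_integrable, of "-1" x]
      lborel_integral_real_affine[of "-1" k x] by (simp_all add: mass_def)
  have i1: "integrable lborel (\<lambda>s. indicator {0..x} s * k (s - y))" for y
    using integrable_mult_indicator[OF _ iks(1)[of y], of "{0..x}"] by simp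
  have i2: "integrable lborel (\<lambda>s. k (x - s) * indicator {0..} (s - y))" for y
    by (rule Bochner_Integration.integrable_bound[OF ikx(1)]) (auto simp: indicator_def)
  have s1: "(LBINT s. indicator {0..x} s * conv k ?h s) = (LBINT y. ?h y * (LBINT s. indicator {0..x} s * k (s - y)))"
  proof (rule integral_conv_swap[OF _ _ ihx i1])
    show "(LBINT s. \<bar>indicator {0..x} s * k (s - y)\<bar>) \<le> mass" for y
      unfolding iks(2)[of y, symmetric]
      by (intro integral_mono integrable_abs i1 iks) (auto simp: indicator_def k_nonneg)
  qed measurable
  have s2: "(LBINT s. k (x - s) * conv (indicator {0..}) ?h s) = (LBINT y. ?h y * (LBINT s. k (x - s) * indicator {0..} (s - y)))"
  proof (rule integral_conv_swap[OF _ _ ihx i2])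
    show "(LBINT s. \<bar>k (x - s) * indicator {0..} (s - y)\<bar>) \<le> mass" for y
      unfolding ikx(2)[symmetric]
      by (intro integral_mono integrable_abs i2 ikx) (auto simp: indicator_def k_nonneg)
  qed measurable
  have inner: "?h y * (LBINT s. indicator {0..x} s * k (s - y)) = ?h y * (LBINT s. k (x - s) * indicator {0..} (s - y))" for y
  proof (cases "0 \<le> y \<and> y \<le> x")
    case True
    have "(LBINT s. indicator {0..x} s * k (s - y)) = (LBINT z. indicator {0..x} (z + y) * k z)"
      by (subst lborel_integral_real_affine[of 1 _ y]) (auto simp: add.commute)
    also have "\<dots> = K (x - y)"
      unfolding K_def using True k_zero
      by (intro Bochner_Integration.integral_cong) (auto simp: indicator_def not_le)
    also have "\<dots> = (LBINT z. k z * indicator {0..} (x - z - y))"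
      unfolding K_def using True k_zero
      by (intro Bochner_Integration.integral_cong) (auto simp: indicator_def not_le)
    also have "\<dots> = (LBINT s. k (x - s) * indicator {0..} (s - y))"
      by (subst lborel_integral_real_affine[of "-1" _ x]) auto
    finally show ?thesis by simp
  qed auto
  have cH: "k (x - s) * conv (indicator {0..}) ?h s = k (x - s) * H s" for s
  proof (cases "s < x")
    case True
    have "conv (indicator {0..}) ?h s = H s"
      unfolding conv_def H_indicator using True
      by (intro Bochner_Integration.integral_cong) (auto simp: indicator_def)
    then show ?thesis by simp
  qed (simp add: k_zero)
  have "conv k H x = (LBINT s. indicator {0..x} s * conv k ?h s)"
    unfolding s1 inner s2[symmetric] cH by (simp add: conv_def)
  also have "\<dots> = (LBINT s. - (indicator {0..x} s * h s) - indicator {0..x} s * k s)"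
  proof (rule Bochner_Integration.integral_cong[OF refl])
    fix s
    show "indicator {0..x} s * conv k ?h s = - (indicator {0..x} s * h s) - indicator {0..x} s * k s"
      using ck[of s] h_eq[of s] by (simp add: indicator_def)
  qed
  also have "\<dots> = - H x - K x"
    using h_integrable k_indicator_integrable[of "{0..x}"] by (simp add: H_indicator K_def)
  finally show ?thesis by simp
qed

text \<open>By the integrated resolvent equation \<open>d * (1 + H x)\<close> solves the same Volterra equation as \<open>v\<close>, and
  locally bounded solutions are unique.\<close>

lemma solution_representation:
  assumes v[measurable]: "v \<in> borel_measurable borel" and B: "\<And>y. \<bar>v y\<bar> \<le> B" and v0: "\<And>y. y \<le> 0 \<Longrightarrow> v y = 0"
    and eq: "\<And>x. 0 < x \<Longrightarrow> v x + conv k v x = d" and x: "0 < x"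
  shows "v x = d * (1 + H x)"
proof -
  define V where "V y = d * (indicator {0<..} y + H y)" for y
  define S where "S = (LBINT y. \<bar>indicator {0..x} y * h y\<bar>)"
  have Vm[measurable]: "V \<in> borel_measurable borel" unfolding V_def[abs_def] by measurable
  have cV: "V y + conv k V y = d" if y: "0 < y" "y \<le> x" for y
  proof -
    let ?H = "\<lambda>z. indicator {..x} z * H z"
    have Hb: "\<bar>?H z\<bar> \<le> S" for z using H_bound[of z x] by (auto simp: S_def indicator_def)
    have iH: "integrable lborel (\<lambda>z. k (y - z) * H z)"
    proof -
      have "integrable lborel (\<lambda>z. k (y - z) * ?H z)"
        by (rule conv_integrable_bounded[OF k_integrable _ Hb]) measurable
      also have "(\<lambda>z. k (y - z) * ?H z) = (\<lambda>z. k (y - z) * H z)"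
        using y k_zero by (auto simp: fun_eq_iff indicator_def not_le)
      finally show ?thesis .
    qed
    have i1: "integrable lborel (\<lambda>z. k (y - z) * indicator {0<..} z)"
      by (rule conv_integrable_bounded[OF k_integrable, of _ 1]) (auto simp: indicator_def)
    have "(LBINT z. k (y - z) * indicator {0<..} z) = (LBINT z. k z * indicator {0<..} (y - z))"
      using conv_commute[of k "indicator {0<..}" y] by (simp add: conv_def)
    also have "\<dots> = K y"
      unfolding K_def
      by (rule integral_cong_AE, measurable, use AE_lborel_singleton[of y] in eventually_elim)
         (use k_zero in \<open>auto simp: indicator_def not_le\<close>)
    finally have k1: "(LBINT z. k (y - z) * indicator {0<..} z) = K y" .
    have "conv k V y = (LBINT z. d * (k (y - z) * indicator {0<..} z + k (y - z) * H z))"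
      unfolding conv_def V_def by (simp add: algebra_simps)
    also have "\<dots> = d * (K y + conv k H y)"
      using i1 iH by (simp add: k1 conv_def)
    also have "K y + conv k H y = - H y" using H_volterra[of y] by linarith
    finally have e: "conv k V y = d * - H y" .
    show ?thesis unfolding e using y by (simp add: V_def algebra_simps)
  qed
  have "v x - V x = 0"
  proof (rule volterra_unique[of "\<lambda>y. v y - V y" x "B + \<bar>d\<bar> * (1 + S)"])
    show "(\<lambda>y. v y - V y) \<in> borel_measurable borel" by measurable
    show "v y - V y = 0" if "y \<le> 0" for y using that v0[OF that] H_nonpos[OF that] by (simp add: V_def)
    have Vb: "\<bar>V y\<bar> \<le> \<bar>d\<bar> * (1 + S)" if "y \<le> x" for y
      using H_bound[OF that] unfolding V_def abs_mult S_def by (intro mult_left_mono) (auto simp: indicator_def)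
    show "\<bar>v y - V y\<bar> \<le> B + \<bar>d\<bar> * (1 + S)" if "y \<le> x" for y using B[of y] Vb[OF that] by linarith
    show "(v y - V y) + conv k (\<lambda>y. v y - V y) y = 0" if y: "0 < y" "y \<le> x" for y
    proof -
      let ?V = "\<lambda>z. indicator {..x} z * V z"
      have V'b: "\<bar>?V z\<bar> \<le> \<bar>d\<bar> * (1 + S)" for z
        using Vb[of z] Vb[of x] by (auto simp: indicator_def)
      have "integrable lborel (\<lambda>z. k (y - z) * ?V z)"
        by (rule conv_integrable_bounded[OF k_integrable _ V'b]) measurable
      also have "(\<lambda>z. k (y - z) * ?V z) = (\<lambda>z. k (y - z) * V z)"
        using y k_zero by (auto simp: fun_eq_iff indicator_def not_le)
      finally have "conv k (\<lambda>y. v y - V y) y = conv k v y - conv k V y"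
        using conv_integrable_bounded[OF k_integrable v B, of y] by (simp add: conv_def right_diff_distrib)
      then show ?thesis using eq[OF y(1)] cV[OF y] by simp
    qed
  qed simp
  then show ?thesis using x by (simp add: V_def)
qed

text \<open>Both one-sided derivatives of \<open>H\<close> come from this estimate on an interval with endpoint \<open>x\<close>.  It does
  not involve the values of \<open>h\<close> at the endpoints.\<close>

lemma H_increment:
  assumes ab: "0 \<le> a" "a < b" and L: "\<And>s. a < s \<Longrightarrow> s < b \<Longrightarrow> \<bar>h s - L\<bar> \<le> e"
  shows "\<bar>(H b - H a) / (b - a) - L\<bar> \<le> e"
proof -
  have i: "integrable lborel (\<lambda>s. c * indicator {a<..b} s)" for c :: real
    using ab by (intro integrable_mult_right integrable_real_indicator) auto
  note hi = H_diff[OF ab(1) less_imp_le[OF ab(2)]]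
  have "H b - H a - L * (b - a) = (LBINT s. indicator {a<..b} s * h s - L * indicator {a<..b} s)"
    using hi i[of L] ab by simp
  also have "\<bar>\<dots>\<bar> \<le> (LBINT s. \<bar>indicator {a<..b} s * h s - L * indicator {a<..b} s\<bar>)" by (rule integral_abs_bound)
  also have "\<dots> \<le> (LBINT s. e * indicator {a<..b} s)"
  proof (rule integral_mono_AE)
    show "AE s in lborel. \<bar>indicator {a<..b} s * h s - L * indicator {a<..b} s\<bar> \<le> e * indicator {a<..b} s"
      using AE_lborel_singleton[of b] by eventually_elim (use L in \<open>auto simp: indicator_def\<close>)
  qed (use hi(1) i in auto)
  also have "\<dots> = e * (b - a)" using ab by simp
  finally have "\<bar>(H b - H a) - L * (b - a)\<bar> / (b - a) \<le> e" using ab by (simp add: divide_le_eq)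
  moreover have "(H b - H a) / (b - a) - L = ((H b - H a) - L * (b - a)) / (b - a)" using ab by (simp add: field_simps)
  ultimately show ?thesis using ab by (simp add: abs_divide)
qed

lemma H_right_derivative:
  assumes x: "0 < x" and L: "(h \<longlongrightarrow> L) (at_right x)"
  shows "(H has_real_derivative L) (at_right x)"
  unfolding has_field_derivative_iff
proof (rule tendstoI)
  fix e :: real assume e: "0 < e"
  have "\<forall>\<^sub>F s in at_right x. dist (h s) L < e / 2" using L e by (intro tendstoD) auto
  then obtain b where b: "x < b" "\<And>s. x < s \<Longrightarrow> s < b \<Longrightarrow> dist (h s) L < e / 2"
    unfolding eventually_at_right_field by blast
  have "dist ((H y - H x) / (y - x)) L < e" if y: "x < y" "y < b" for y
  proof -
    have "\<bar>(H y - H x) / (y - x) - L\<bar> \<le> e / 2"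
      using x y b(2) by (intro H_increment) (auto simp: dist_real_def intro: less_imp_le)
    then show ?thesis using e by (simp add: dist_real_def)
  qed
  then show "\<forall>\<^sub>F y in at_right x. dist ((H y - H x) / (y - x)) L < e"
    unfolding eventually_at_right_field using b(1) by blast
qed

lemma H_left_derivative:
  assumes x: "0 < x" and L: "(h \<longlongrightarrow> L) (at_left x)"
  shows "(H has_real_derivative L) (at_left x)"
  unfolding has_field_derivative_iff
proof (rule tendstoI)
  fix e :: real assume e: "0 < e"
  have "\<forall>\<^sub>F s in at_left x. dist (h s) L < e / 2" using L e by (intro tendstoD) auto
  then obtain b where b: "b < x" "\<And>s. b < s \<Longrightarrow> s < x \<Longrightarrow> dist (h s) L < e / 2"
    unfolding eventually_at_left_field by blast
  have "dist ((H y - H x) / (y - x)) L < e" if y: "max 0 b < y" "y < x" for y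
  proof -
    have "\<bar>(H x - H y) / (x - y) - L\<bar> \<le> e / 2"
      using x y b(2) by (intro H_increment) (auto simp: dist_real_def intro: less_imp_le)
    moreover have "(H x - H y) / (x - y) = (H y - H x) / (y - x)" using y by (simp add: field_simps)
    ultimately show ?thesis using e by (simp add: dist_real_def)
  qed
  then show "\<forall>\<^sub>F y in at_left x. dist ((H y - H x) / (y - x)) L < e"
    unfolding eventually_at_left_field using b(1) x by (intro exI[of _ "max 0 b"]) auto
qed

lemma k_right_limit: "0 < x \<Longrightarrow> \<exists>L. (k \<longlongrightarrow> L) (at_right x)"
proof -
  assume x: "0 < x"
  have "((\<lambda>y. - k y) \<longlongrightarrow> Inf ((\<lambda>y. - k y) ` ({x<..} \<inter> UNIV))) (at x within ({x<..} \<inter> UNIV))"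
    by (rule Lim_right_bound[where K = "- k x"]) (use k_antimono x in auto)
  from tendsto_minus[OF this] show ?thesis by auto
qed

lemma k_left_limit: "0 < x \<Longrightarrow> \<exists>L. (k \<longlongrightarrow> L) (at_left x)"
proof -
  assume x: "0 < x"
  have "((\<lambda>y. - k y) \<longlongrightarrow> Sup ((\<lambda>y. - k y) ` ({..<x} \<inter> {0<..}))) (at x within ({..<x} \<inter> {0<..}))"
    by (rule Lim_left_bound[where K = "- k x"]) (use k_antimono in auto)
  from tendsto_minus[OF this] have "\<exists>L. (k \<longlongrightarrow> L) (at x within ({..<x} \<inter> {0<..}))" by auto
  moreover have "at x within ({..<x} \<inter> {0<..}) = at_left x"
    by (rule at_within_nhd[of _ "{0<..}"]) (use x in auto)
  ultimately show ?thesis by simp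
qed

text \<open>In \<open>h = - k - conv k h\<close> the first term is monotone and the second is continuous.\<close>

lemma h_one_sided_limits:
  assumes x: "0 < x"
  shows "\<exists>L. (h \<longlongrightarrow> L) (at_right x)" "\<exists>L. (h \<longlongrightarrow> L) (at_left x)"
proof -
  have "isCont (conv k h) x" using conv_k_h_continuous x by (simp add: continuous_on_eq_continuous_at)
  then have c: "(conv k h \<longlongrightarrow> conv k h x) (at x)" by (simp add: isCont_def)
  have h: "h = (\<lambda>y. - k y - conv k h y)"
  proof
    fix y show "h y = - k y - conv k h y" using h_eq[of y] by simp
  qed
  obtain L where "(k \<longlongrightarrow> L) (at_right x)" using k_right_limit[OF x] by blast
  then have "((\<lambda>y. - k y - conv k h y) \<longlongrightarrow> - L - conv k h x) (at_right x)"
    by (intro tendsto_intros tendsto_within_subset[OF c]) auto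
  then show "\<exists>L. (h \<longlongrightarrow> L) (at_right x)" by (subst h) blast
  obtain L where "(k \<longlongrightarrow> L) (at_left x)" using k_left_limit[OF x] by blast
  then have "((\<lambda>y. - k y - conv k h y) \<longlongrightarrow> - L - conv k h x) (at_left x)"
    by (intro tendsto_intros tendsto_within_subset[OF c]) auto
  then show "\<exists>L. (h \<longlongrightarrow> L) (at_left x)" by (subst h) blast
qed

section \<open>Decay of the resolvent\<close>

text \<open>For fixed \<open>x\<close> the function \<open>y \<mapsto> k (x - y)\<close> is increasing, so the second mean value theorem
  expresses the integral through increments of \<open>H\<close>.  On \<open>[0, x / 2]\<close> these are bounded and the
  factors \<open>k x\<close>, \<open>k (x / 2)\<close> tend to 0; on \<open>[x / 2, x - \<eta>]\<close> the increments tend to 0, since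
  \<open>H\<close> converges, and the factors are at most \<open>k \<eta>\<close>.\<close>

lemma far_part_tendsto_0:
  assumes \<eta>: "0 < \<eta>" and Hlim: "(H \<longlongrightarrow> c) at_top"
  shows "((\<lambda>x. LBINT y. indicator {0..x - \<eta>} y * (k (x - y) * h y)) \<longlongrightarrow> 0) at_top"
proof -
  have hk: "h integrable_on {a..b}" "integral {a..b} h = H b - H a" if "0 \<le> a" "a \<le> b" for a b
  proof -
    have s: "set_integrable lborel {a..b} h"
    proof -
      have "integrable lborel (\<lambda>y. indicator {a..b} y *\<^sub>R (indicator {0..b} y * h y))"
        by (rule integrable_mult_indicator[OF _ h_integrable]) simp
      also have "(\<lambda>y. indicator {a..b} y *\<^sub>R (indicator {0..b} y * h y)) = (\<lambda>y. indicator {a..b} y *\<^sub>R h y)"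
        using that by (auto simp: indicator_def fun_eq_iff)
      finally show ?thesis by (simp add: set_integrable_def)
    qed
    show "h integrable_on {a..b}" by (rule set_borel_integral_eq_integral(1)[OF s])
    have "integral {a..b} h = (LBINT y. indicator {a..b} y * h y)"
      using set_borel_integral_eq_integral(2)[OF s] by (simp add: set_lebesgue_integral_def)
    also have "\<dots> = (LBINT y. indicator {a<..b} y * h y)"
      by (rule integral_cong_AE, measurable, use AE_lborel_singleton[of a] in eventually_elim)
         (auto simp: indicator_def)
    finally show "integral {a..b} h = H b - H a" using H_diff(2)[OF that] by simp
  qed
  \<comment> \<open>second mean value theorem\<close>
  have smv: "\<exists>m\<in>{a..b}. integrable lborel (\<lambda>y. indicator {a..b} y * (k (x - y) * h y)) \<and>
      (LBINT y. indicator {a..b} y * (k (x - y) * h y)) = k (x - a) * (H m - H a) + k (x - b) * (H b - H m)"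
    if ab: "0 \<le> a" "a \<le> b" "b < x" for a b x
  proof -
    obtain m where m: "m \<in> {a..b}"
      and hi: "((\<lambda>y. k (x - y) * h y) has_integral (k (x - a) * integral {a..m} h + k (x - b) * integral {m..b} h)) {a..b}"
      using ab by (rule_tac second_mean_value_theorem_full[OF hk(1)[OF ab(1,2)] ab(2), of "\<lambda>y. k (x - y)"])
        (auto intro: k_antimono)
    have s: "set_integrable lborel {a..b} (\<lambda>y. k (x - y) * h y)"
      unfolding set_integrable_def
    proof (rule Bochner_Integration.integrable_bound)
      show "integrable lborel (\<lambda>y. k (x - b) * (indicator {0..b} y * h y))" using h_integrable[of b] by simp
      show "AE y in lborel. norm (indicator {a..b} y *\<^sub>R (k (x - y) * h y)) \<le> norm (k (x - b) * (indicator {0..b} y * h y))"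
      proof (rule AE_I2)
        fix y
        have "k (x - y) * \<bar>h y\<bar> \<le> k (x - b) * \<bar>h y\<bar>" if "y \<le> b"
          using that ab by (intro mult_right_mono k_antimono) auto
        then show "norm (indicator {a..b} y *\<^sub>R (k (x - y) * h y)) \<le> norm (k (x - b) * (indicator {0..b} y * h y))"
          using ab by (auto simp: indicator_def abs_mult k_nonneg)
      qed
    qed measurable
    have "(LBINT y. indicator {a..b} y * (k (x - y) * h y)) = integral {a..b} (\<lambda>y. k (x - y) * h y)"
      using set_borel_integral_eq_integral(2)[OF s] by (simp add: set_lebesgue_integral_def)
    also have "\<dots> = k (x - a) * (H m - H a) + k (x - b) * (H b - H m)"
      using integral_unique[OF hi] m ab by (simp add: hk)
    finally show ?thesis using m s by (auto simp: set_integrable_def)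
  qed
  show ?thesis
  proof (rule tendstoI)
    fix e :: real assume e: "0 < e"
    obtain X where X: "\<And>x. X \<le> x \<Longrightarrow> \<bar>H x - c\<bar> < 1"
      using tendstoD[OF Hlim zero_less_one] by (auto simp: eventually_at_top_linorder dist_real_def)
    define D where "D = (LBINT y. \<bar>indicator {0..X} y * h y\<bar>) + \<bar>c\<bar> + 1"
    have D: "\<bar>H x\<bar> \<le> D" for x
    proof (cases "X \<le> x")
      case True
      have "0 \<le> (LBINT y. \<bar>indicator {0..X} y * h y\<bar>)" by simp
      then show ?thesis using X[OF True] unfolding D_def by linarith
    next
      case False then show ?thesis using H_bound[of x X] by (simp add: D_def)
    qed
    \<comment> \<open>Increments of \<open>H\<close> of size \<open>2 * \<kappa>\<close>, weighted by \<open>k \<eta>\<close>, contribute at most \<open>e / 4\<close>.\<close>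
    define \<kappa> where "\<kappa> = e / (8 * (k \<eta> + 1))"
    have k1: "0 < 8 * (k \<eta> + 1)" using k_nonneg[of \<eta>] by simp
    have \<kappa>: "0 < \<kappa>" using e k1 by (simp add: \<kappa>_def)
    have "\<forall>\<^sub>F x in at_top. dist (H x) c < \<kappa>" by (rule tendstoD[OF Hlim \<kappa>])
    then obtain Y where Y: "\<And>x. Y \<le> x \<Longrightarrow> \<bar>H x - c\<bar> < \<kappa>" by (auto simp: eventually_at_top_linorder dist_real_def)
    have "((\<lambda>x. k (x / 2) * (4 * D)) \<longlongrightarrow> 0 * (4 * D)) at_top"
      by (intro tendsto_intros filterlim_compose[OF k_tendsto_0]
          filterlim_at_top_mult_tendsto_pos[OF tendsto_const _ filterlim_ident, of "1 / 2", simplified])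
    then have "\<forall>\<^sub>F x in at_top. k (x / 2) * (4 * D) < e / 2" by (rule order_tendstoD(2)) (use e in simp)
    then show "\<forall>\<^sub>F x in at_top. dist (LBINT y. indicator {0..x - \<eta>} y * (k (x - y) * h y)) 0 < e"
      using eventually_ge_at_top[of "max (2 * Y) (2 * \<eta> + 1)"]
    proof eventually_elim
      case (elim x)
      have x: "0 < x" "0 \<le> x / 2" "x / 2 \<le> x - \<eta>" "x / 2 < x" "x - \<eta> < x" "Y \<le> x / 2"
        using elim \<eta> by auto
      obtain m1 where m1: "m1 \<in> {0..x / 2}"
        and i1: "integrable lborel (\<lambda>y. indicator {0..x / 2} y * (k (x - y) * h y))"
        and e1: "(LBINT y. indicator {0..x / 2} y * (k (x - y) * h y)) = k (x - 0) * (H m1 - H 0) + k (x - x / 2) * (H (x / 2) - H m1)"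
        using smv[OF order_refl x(2) x(4)] by blast
      obtain m2 where m2: "m2 \<in> {x / 2..x - \<eta>}"
        and i2: "integrable lborel (\<lambda>y. indicator {x / 2..x - \<eta>} y * (k (x - y) * h y))"
        and e2: "(LBINT y. indicator {x / 2..x - \<eta>} y * (k (x - y) * h y)) = k (x - x / 2) * (H m2 - H (x / 2)) + k (x - (x - \<eta>)) * (H (x - \<eta>) - H m2)"
        using smv[OF x(2) x(3) x(5)] by blast
      have b1: "\<bar>k (x - 0) * (H m1 - H 0) + k (x - x / 2) * (H (x / 2) - H m1)\<bar> \<le> k (x / 2) * (4 * D)"
      proof -
        have "\<bar>k x * (H m1 - H 0)\<bar> \<le> k (x / 2) * (2 * D)"
          unfolding abs_mult using D[of m1] D[of 0] x
          by (intro mult_mono) (auto simp: k_nonneg intro!: k_antimono)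
        moreover have "\<bar>k (x / 2) * (H (x / 2) - H m1)\<bar> \<le> k (x / 2) * (2 * D)"
          unfolding abs_mult using D[of m1] D[of "x / 2"]
          by (intro mult_mono) (auto simp: k_nonneg)
        ultimately show ?thesis by simp
      qed
      have b2: "\<bar>k (x - x / 2) * (H m2 - H (x / 2)) + k (x - (x - \<eta>)) * (H (x - \<eta>) - H m2)\<bar> \<le> e / 2"
      proof -
        have "k (x / 2) \<le> k \<eta>" using \<eta> elim by (intro k_antimono) auto
        then have "\<bar>k (x / 2) * (H m2 - H (x / 2))\<bar> \<le> k \<eta> * (2 * \<kappa>)"
          unfolding abs_mult using Y[of m2] Y[of "x / 2"] x m2
          by (intro mult_mono) (auto simp: k_nonneg)
        moreover have "\<bar>k \<eta> * (H (x - \<eta>) - H m2)\<bar> \<le> k \<eta> * (2 * \<kappa>)"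
          unfolding abs_mult using Y[of m2] Y[of "x - \<eta>"] x m2
          by (intro mult_mono) (auto simp: k_nonneg)
        moreover have "k \<eta> * (2 * \<kappa>) \<le> e / 4"
        proof -
          have "k \<eta> * (2 * \<kappa>) \<le> (k \<eta> + 1) * (2 * \<kappa>)" using \<kappa> by (intro mult_right_mono) auto
          also have "\<dots> = e / 4" using k1 by (simp add: \<kappa>_def field_simps)
          finally show ?thesis .
        qed
        moreover have "x - x / 2 = x / 2" "x - (x - \<eta>) = \<eta>" by simp_all
        ultimately show ?thesis by (simp only:)
      qed
      have "(LBINT y. indicator {0..x - \<eta>} y * (k (x - y) * h y)) =
        (LBINT y. indicator {0..x / 2} y * (k (x - y) * h y) + indicator {x / 2..x - \<eta>} y * (k (x - y) * h y))"
        by (rule integral_cong_AE, measurable, use AE_lborel_singleton[of "x / 2"] in eventually_elim)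
           (use x in \<open>auto simp: indicator_def\<close>)
      also have "\<dots> = (LBINT y. indicator {0..x / 2} y * (k (x - y) * h y)) + (LBINT y. indicator {x / 2..x - \<eta>} y * (k (x - y) * h y))"
        by (rule Bochner_Integration.integral_add[OF i1 i2])
      finally show ?case using b1 b2 elim(1) unfolding e1 e2 dist_real_def by linarith
    qed
  qed
qed

text \<open>Here \<open>k\<close> may be unbounded, but its mass over the window is only \<open>K \<eta>\<close>.\<close>

lemma near_part_bound:
  assumes \<eta>: "0 < \<eta>" "\<eta> < x" and b: "\<And>y. x - \<eta> \<le> y \<Longrightarrow> y \<le> x \<Longrightarrow> \<bar>h y\<bar> \<le> b"
  shows "\<bar>conv k h x - (LBINT y. indicator {0..x - \<eta>} y * (k (x - y) * h y))\<bar> \<le> b * K \<eta>"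
proof -
  have b0: "0 \<le> b" using b[of x] \<eta> by simp
  let ?g = "\<lambda>y. indicator {x - \<eta><..x} y * h y"
  have gb: "\<bar>?g y\<bar> \<le> b" for y using b[of y] b0 by (auto simp: indicator_def)
  have i2: "integrable lborel (\<lambda>y. k (x - y) * ?g y)"
    by (rule conv_integrable_bounded[OF k_integrable _ gb]) measurable
  have i1: "integrable lborel (\<lambda>y. indicator {0..x - \<eta>} y * (k (x - y) * h y))"
  proof (rule Bochner_Integration.integrable_bound)
    show "integrable lborel (\<lambda>y. k \<eta> * (indicator {0..x} y * h y))" using h_integrable by simp
    show "AE y in lborel. norm (indicator {0..x - \<eta>} y * (k (x - y) * h y)) \<le> norm (k \<eta> * (indicator {0..x} y * h y))"
    proof (rule AE_I2)
      fix y
      have "k (x - y) * \<bar>h y\<bar> \<le> k \<eta> * \<bar>h y\<bar>" if "y \<le> x - \<eta>"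
        using that \<eta> by (intro mult_right_mono k_antimono) auto
      then show "norm (indicator {0..x - \<eta>} y * (k (x - y) * h y)) \<le> norm (k \<eta> * (indicator {0..x} y * h y))"
        using \<eta> by (auto simp: indicator_def abs_mult k_nonneg)
    qed
  qed measurable
  have split: "k (x - y) * h y = indicator {0..x - \<eta>} y * (k (x - y) * h y) + k (x - y) * ?g y" for y
    using h_zero[of y] k_zero[of "x - y"] by (cases "0 \<le> y"; cases "y \<le> x") (auto simp: indicator_def)
  have "conv k h x = (LBINT y. indicator {0..x - \<eta>} y * (k (x - y) * h y) + k (x - y) * ?g y)"
    unfolding conv_def by (subst split) (rule refl)
  also have "\<dots> = (LBINT y. indicator {0..x - \<eta>} y * (k (x - y) * h y)) + conv k ?g x"
    using i1 i2 by (simp add: conv_def)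
  finally have "conv k h x - (LBINT y. indicator {0..x - \<eta>} y * (k (x - y) * h y)) = conv k ?g x" by simp
  also have "\<bar>conv k ?g x\<bar> \<le> (LBINT y. \<bar>k (x - y) * ?g y\<bar>)" unfolding conv_def by (rule integral_abs_bound)
  also have "\<dots> \<le> (LBINT y. b * (indicator {0..\<eta>} (x - y) * k (x - y)))"
  proof (rule integral_mono)
    show "integrable lborel (\<lambda>y. b * (indicator {0..\<eta>} (x - y) * k (x - y)))"
      using lborel_integrable_real_affine[OF k_indicator_integrable[of "{0..\<eta>}"], of "-1" x] by simp
    show "\<bar>k (x - y) * ?g y\<bar> \<le> b * (indicator {0..\<eta>} (x - y) * k (x - y))" for y
      using mult_left_mono[OF b[of y] k_nonneg[of "x - y"]] mult_nonneg_nonneg[OF b0 k_nonneg[of "x - y"]]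
      by (auto simp: indicator_def abs_mult k_nonneg mult.commute)
  qed (use i2 in auto)
  also have "\<dots> = b * K \<eta>"
    using lborel_integral_real_affine[of "-1" "\<lambda>z. indicator {0..\<eta>} z * k z" x] by (simp add: K_def)
  finally show ?thesis .
qed

end

text \<open>The contraction first gives a bound: the supremum \<open>S\<close> over a bounded interval satisfies
  \<open>S \<le> max b (1 + S / 4)\<close>, with \<open>b\<close> independent of the interval.  Then the upper limit \<open>m\<close> of
  \<open>\<bar>f\<bar>\<close> satisfies \<open>m \<le> m / 4\<close>.\<close>

lemma tendsto_0_from_delayed_contraction:
  fixes f g :: "real \<Rightarrow> real"
  assumes g: "(g \<longlongrightarrow> 0) at_top" and \<eta>: "0 < \<eta>"
    and loc: "\<And>a T. 0 < a \<Longrightarrow> \<exists>b. \<forall>x\<in>{a..T}. \<bar>f x\<bar> \<le> b"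
    and contr: "\<And>x b. \<eta> < x \<Longrightarrow> (\<And>y. x - \<eta> \<le> y \<Longrightarrow> y \<le> x \<Longrightarrow> \<bar>f y\<bar> \<le> b) \<Longrightarrow> \<bar>f x\<bar> \<le> \<bar>g x\<bar> + b / 4"
  shows "(f \<longlongrightarrow> 0) at_top"
proof -
  have bounded: "\<exists>X b. \<forall>x\<ge>X. \<bar>f x\<bar> \<le> b"
  proof -
    obtain X0 where X0: "\<And>x. X0 \<le> x \<Longrightarrow> \<bar>g x\<bar> < 1"
      using tendstoD[OF g zero_less_one] by (auto simp: eventually_at_top_linorder)
    define X where "X = max X0 (2 * \<eta>)"
    have X: "X0 \<le> X" "2 * \<eta> \<le> X" by (auto simp: X_def)
    have "\<exists>b. \<forall>x\<in>{X - \<eta>..X}. \<bar>f x\<bar> \<le> b" using X \<eta> by (intro loc) linarith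
    then obtain b0 where b0: "\<And>x. x \<in> {X - \<eta>..X} \<Longrightarrow> \<bar>f x\<bar> \<le> b0" by blast
    define m where "m = max b0 2"
    have "\<bar>f x\<bar> \<le> m" if x: "X - \<eta> \<le> x" for x
    proof -
      let ?I = "{X - \<eta>..max x X}"
      let ?S = "(SUP y\<in>?I. \<bar>f y\<bar>)"
      have bdd: "bdd_above ((\<lambda>y. \<bar>f y\<bar>) ` ?I)"
        using loc[of "X - \<eta>" "max x X"] X \<eta> by (auto simp: bdd_above_def)
      have le: "\<bar>f y\<bar> \<le> ?S" if "y \<in> ?I" for y using cSUP_upper[OF that bdd] .
      have "\<bar>f y\<bar> \<le> max b0 (1 + ?S / 4)" if y: "y \<in> ?I" for y
      proof (cases "y \<le> X")
        case True then show ?thesis using b0[of y] y by auto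
      next
        case False
        have "\<bar>f y\<bar> \<le> \<bar>g y\<bar> + ?S / 4"
          using False y X \<eta> by (intro contr le) auto
        then show ?thesis using X0[of y] False X by auto
      qed
      then have "?S \<le> max b0 (1 + ?S / 4)" using \<eta> by (intro cSUP_least) auto
      then have "?S \<le> m" by (auto simp: m_def max_def split: if_splits)
      then show ?thesis using le[of x] x by auto
    qed
    then show ?thesis by blast
  qed
  define S where "S = {b. \<forall>\<^sub>F x in at_top. \<bar>f x\<bar> \<le> b}"
  define m where "m = Inf S"
  have ne: "S \<noteq> {}" using bounded by (auto simp: S_def eventually_at_top_linorder)
  have S0: "0 \<le> b" if b: "b \<in> S" for b
  proof -
    obtain X where "\<And>x. X \<le> x \<Longrightarrow> \<bar>f x\<bar> \<le> b" using b by (auto simp: S_def eventually_at_top_linorder)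
    from this[of X] show ?thesis by linarith
  qed
  then have bb: "bdd_below S" by (auto simp: bdd_below_def)
  have m0: "0 \<le> m" unfolding m_def by (rule cInf_greatest[OF ne S0])
  have "m = 0"
  proof (rule ccontr)
    assume "m \<noteq> 0"
    then have mp: "0 < m" using m0 by simp
    then obtain b where b: "b \<in> S" "b < 2 * m" using cInf_lessD[OF ne, of "2 * m"] by (auto simp: m_def)
    obtain X where X: "\<And>x. X \<le> x \<Longrightarrow> \<bar>f x\<bar> \<le> b" using b by (auto simp: S_def eventually_at_top_linorder)
    have "\<forall>\<^sub>F x in at_top. dist (g x) 0 < m / 4" using mp by (intro tendstoD[OF g]) auto
    then have "\<forall>\<^sub>F x in at_top. \<bar>f x\<bar> \<le> m / 4 + b / 4"
      using eventually_ge_at_top[of "max (X + \<eta>) (2 * \<eta>)"]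
    proof eventually_elim
      case (elim x)
      have "\<bar>f x\<bar> \<le> \<bar>g x\<bar> + b / 4" using elim \<eta> by (intro contr X) auto
      then show ?case using elim(1) by simp
    qed
    then have "m / 4 + b / 4 \<in> S" by (simp add: S_def)
    then have "m \<le> m / 4 + b / 4" unfolding m_def using bb by (rule cInf_lower)
    then show False using b(2) mp by linarith
  qed
  show ?thesis
  proof (rule tendstoI)
    fix e :: real assume e: "0 < e"
    then obtain b where "b \<in> S" "b < e" using cInf_lessD[OF ne, of e] \<open>m = 0\<close> by (auto simp: m_def)
    then show "\<forall>\<^sub>F x in at_top. dist (f x) 0 < e" by (auto simp: S_def elim!: eventually_mono)
  qed
qed

text \<open>For a window on which \<open>k\<close> has mass less than \<open>1 / 4\<close> the near part of \<open>conv k h\<close> is a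
  contraction, and everything else in the resolvent equation tends to 0.\<close>

lemma (in kernel_resolvent) h_tendsto_0:
  assumes Hlim: "(H \<longlongrightarrow> c) at_top"
  shows "(h \<longlongrightarrow> 0) at_top"
proof -
  obtain \<eta> where \<eta>: "0 < \<eta>" "K \<eta> < 1 / 4" using K_small[of "1 / 4"] by auto
  define g where "g x = - k x - (LBINT y. indicator {0..x - \<eta>} y * (k (x - y) * h y))" for x
  have "(g \<longlongrightarrow> - 0 - 0) at_top"
    unfolding g_def by (intro tendsto_intros k_tendsto_0 far_part_tendsto_0[OF \<eta>(1) Hlim])
  then have g: "(g \<longlongrightarrow> 0) at_top" by simp
  show ?thesis
  proof (rule tendsto_0_from_delayed_contraction[OF g \<eta>(1) h_locally_bounded])
    fix x b assume x: "\<eta> < x" and b: "\<And>y. x - \<eta> \<le> y \<Longrightarrow> y \<le> x \<Longrightarrow> \<bar>h y\<bar> \<le> b"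
    have "0 \<le> b" using b[of x] \<eta> by simp
    then have "b * K \<eta> \<le> b * (1 / 4)" using \<eta> by (intro mult_left_mono) auto
    then show "\<bar>h x\<bar> \<le> \<bar>g x\<bar> + b / 4"
      using near_part_bound[OF \<eta>(1) x b] h_eq[of x] unfolding g_def by (simp add: abs_le_iff abs_if split: if_splits)
  qed
qed

section \<open>One-sided derivatives of the renewal density\<close>

text \<open>The infimum is taken over a nonempty set: the exponent 1 belongs to it by the integrability condition on
  a Levy measure.\<close>

lemma blumenthal_getoor_exponent:
  assumes \<nu>: "levy_measure \<nu>" and idx: "blumenthal_getoor_index \<nu> < 1"
  obtains \<gamma> where "0 < \<gamma>" "\<gamma> < 1" "(\<integral>\<^sup>+x\<in>{0<..1}. ennreal (x powr \<gamma>) \<partial>\<nu>) < \<infinity>"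
proof -
  let ?S = "{\<gamma>. 0 < \<gamma> \<and> (\<integral>\<^sup>+x\<in>{0<..1}. ennreal (x powr \<gamma>) \<partial>\<nu>) < \<infinity>}"
  have "(\<integral>\<^sup>+x\<in>{0<..1}. ennreal (x powr 1) \<partial>\<nu>) \<le> (\<integral>\<^sup>+x. ennreal (min 1 x) \<partial>\<nu>)"
    by (intro nn_integral_mono) (auto simp: indicator_def)
  also have "\<dots> < \<infinity>" using \<nu> by (simp add: levy_measure_def)
  finally have "1 \<in> ?S" by simp
  then have "?S \<noteq> {}" by blast
  moreover have "Inf ?S < 1" using idx by (simp add: blumenthal_getoor_index_def)
  ultimately obtain \<gamma> where "\<gamma> \<in> ?S" "\<gamma> < 1" using cInf_lessD[of ?S 1] by blast
  then show thesis using that by blast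
qed

text \<open>Markov's inequality for \<open>y powr \<gamma>\<close> on \<open>(x, 1]\<close>; the constant mass beyond 1 is absorbed since
  \<open>x powr - \<gamma> \<ge> 1\<close>.\<close>

lemma levy_tail_power_bound:
  assumes \<nu>: "levy_measure \<nu>" and \<gamma>: "0 < \<gamma>" and fin: "(\<integral>\<^sup>+x\<in>{0<..1}. ennreal (x powr \<gamma>) \<partial>\<nu>) < \<infinity>"
  obtains C where "0 \<le> C" "\<And>x. 0 < x \<Longrightarrow> x \<le> 1 \<Longrightarrow> measure \<nu> {x<..} \<le> C * x powr - \<gamma>"
proof -
  have sets[measurable_cong]: "sets \<nu> = sets borel" using \<nu> by (simp add: levy_measure_def)
  obtain I where I: "0 \<le> I" "(\<integral>\<^sup>+x\<in>{0<..1}. ennreal (x powr \<gamma>) \<partial>\<nu>) = ennreal I"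
    using fin by (cases "\<integral>\<^sup>+x\<in>{0<..1}. ennreal (x powr \<gamma>) \<partial>\<nu>") auto
  define N where "N = measure \<nu> {1<..}"
  have "measure \<nu> {x<..} \<le> (I + N) * x powr - \<gamma>" if x: "0 < x" "x \<le> 1" for x
  proof -
    have fm: "{x<..} \<in> fmeasurable \<nu>" "{1<..} \<in> fmeasurable \<nu>"
      using levy_measure_tail_finite[OF \<nu>] x by (auto simp: fmeasurable_def sets)
    have fm3: "{x<..1} \<in> fmeasurable \<nu>" by (rule fmeasurableI2[OF fm(1)]) (auto simp: sets)
    have "ennreal (x powr \<gamma>) * emeasure \<nu> {x<..1} = (\<integral>\<^sup>+y. ennreal (x powr \<gamma>) * indicator {x<..1} y \<partial>\<nu>)"
      by (subst nn_integral_cmult_indicator) (auto simp: sets)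
    also have "\<dots> \<le> (\<integral>\<^sup>+y\<in>{0<..1}. ennreal (y powr \<gamma>) \<partial>\<nu>)"
      using x \<gamma> by (intro nn_integral_mono) (auto simp: indicator_def intro!: ennreal_leI powr_mono2)
    finally have "ennreal (x powr \<gamma> * measure \<nu> {x<..1}) \<le> ennreal I"
      using fmeasurableD2[OF fm3] by (simp add: I(2) emeasure_eq_ennreal_measure ennreal_mult less_top)
    then have "x powr \<gamma> * measure \<nu> {x<..1} \<le> I" using I by simp
    then have a: "measure \<nu> {x<..1} \<le> I * x powr - \<gamma>" using x by (simp add: powr_minus field_simps)
    have "1 powr - \<gamma> \<le> x powr - \<gamma>" using x \<gamma> by (intro powr_mono2') auto
    then have b: "N \<le> N * x powr - \<gamma>" using mult_left_mono[of 1 "x powr - \<gamma>" N] by (simp add: N_def)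
    have "{x<..} = {x<..1} \<union> {1<..}" using x by auto
    then have "measure \<nu> {x<..} \<le> measure \<nu> {x<..1} + N"
      unfolding N_def using measure_Un_le[of "{x<..1}" \<nu> "{1<..}"] by (simp add: sets)
    then show ?thesis using a b by (simp add: algebra_simps)
  qed
  then show thesis using that[of "I + N"] I by (simp add: N_def)
qed

lemma tail_kernel_scaled_tail:
  assumes \<nu>: "levy_measure \<nu>" and \<delta>: "0 < \<delta>" and mean: "(\<integral>\<^sup>+y. ennreal y \<partial>\<nu>) < \<infinity>"
  shows "tail_kernel (scaled_tail \<delta> \<nu>)"
proof
  show "scaled_tail \<delta> \<nu> \<in> borel_measurable borel" by (rule scaled_tail_measurable[OF \<nu> \<delta>])
  show "0 \<le> scaled_tail \<delta> \<nu> x" for x using \<delta> by (simp add: scaled_tail_def)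
  show "scaled_tail \<delta> \<nu> x = 0" if "x \<le> 0" for x using that by (simp add: scaled_tail_def)
  show "scaled_tail \<delta> \<nu> y \<le> scaled_tail \<delta> \<nu> x" if "0 < x" "x \<le> y" for x y
    by (rule scaled_tail_antimono[OF \<nu> \<delta> that])
  show "integrable lborel (scaled_tail \<delta> \<nu>)" by (rule scaled_tail_integrable[OF \<nu> \<delta> mean])
qed

lemma one_sided_limits_tendsto_0:
  fixes h L :: "real \<Rightarrow> real"
  assumes h: "(h \<longlongrightarrow> 0) at_top"
    and L: "\<And>x. 0 < x \<Longrightarrow> (h \<longlongrightarrow> L x) (F x)"
    and F: "\<And>x y. y < x \<Longrightarrow> \<forall>\<^sub>F z in F x. y < z" "\<And>x. F x \<noteq> bot"
  shows "(L \<longlongrightarrow> 0) at_top"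
proof (rule tendstoI)
  fix e :: real assume e: "0 < e"
  then obtain X where X: "\<And>x. X \<le> x \<Longrightarrow> \<bar>h x\<bar> < e / 2"
    using tendstoD[OF h, of "e / 2"] by (auto simp: eventually_at_top_linorder)
  show "\<forall>\<^sub>F x in at_top. dist (L x) 0 < e"
    using eventually_gt_at_top[of "max X 0"]
  proof eventually_elim
    case (elim x)
    have "\<forall>\<^sub>F z in F x. X < z" using F(1)[of X x] elim by simp
    then have "\<forall>\<^sub>F z in F x. \<bar>h z\<bar> \<le> e / 2"
      by eventually_elim (rule less_imp_le[OF X[OF less_imp_le]])
    moreover have "((\<lambda>z. \<bar>h z\<bar>) \<longlongrightarrow> \<bar>L x\<bar>) (F x)" using L[of x] elim by (intro tendsto_rabs) auto
    ultimately have "\<bar>L x\<bar> \<le> e / 2" using F(2) by (intro tendsto_upperbound[where F = "F x"])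
    then show ?case using e by simp
  qed
qed

theorem theorem6:
  fixes M :: "'a measure" and X :: "real \<Rightarrow> 'a \<Rightarrow> real"
    and \<delta> :: real and \<nu> :: "real measure" and u :: "real \<Rightarrow> real"
  assumes "subordinator M X"
    and "has_drift_and_levy_measure M X \<delta> \<nu>"
    and "\<delta> > 0"
    and "blumenthal_getoor_index \<nu> < 1"
    and "integrable M (X 1)"
    and "renewal_density M X u"
  shows "\<exists>u'_right u'_left.
           (\<forall>x>0. (u has_real_derivative u'_right x) (at_right x)) \<and>
           (\<forall>x>0. (u has_real_derivative u'_left x) (at_left x)) \<and>
           (u'_right \<longlongrightarrow> 0) at_top \<and> (u'_left \<longlongrightarrow> 0) at_top"
proof -
  note sub = assms(1) and dl = assms(2) and \<delta> = assms(3) and idx = assms(4) and int = assms(5) and u = assms(6)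
  have \<nu>: "levy_measure \<nu>" using dl by (simp add: has_drift_and_levy_measure_def)
  define k where "k = scaled_tail \<delta> \<nu>"
  define v where "v = extend_zero u"
  define d where "d = 1 / \<delta>"
  have d: "0 < d" using \<delta> by (simp add: d_def)
  interpret k: tail_kernel k
    unfolding k_def by (rule tail_kernel_scaled_tail[OF \<nu> \<delta> levy_measure_mean_finite[OF sub dl \<delta> int]])
  obtain B where vm[measurable]: "v \<in> borel_measurable borel" and B: "\<And>x. \<bar>v x\<bar> \<le> B" and v0: "\<And>x. 0 \<le> v x"
    by (rule renewal_density_extend_zero[OF u, folded v_def]) (rule that, assumption+)
  have vz: "v x = 0" if "x \<le> 0" for x using that by (simp add: v_def extend_zero_def)
  have B0: "0 \<le> B" using B[of 0] by simp
  have "continuous_on {0<..} v"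
    by (rule continuous_on_eq[of _ u]) (use u in \<open>auto simp: v_def extend_zero_def renewal_density_def\<close>)
  then have cv: "continuous_on {0<..} (\<lambda>x. v x + conv k v x)"
    by (intro continuous_intros continuous_on_subset[OF k.conv_k_continuous[OF vm B]]) auto
  obtain r where ae: "AE x in lborel. 0 < x \<longrightarrow> v x + conv k v x = d"
    and r: "r \<in> borel_measurable borel" "\<And>x. 0 \<le> r x" "integrable lborel r" "(LBINT x. r x) = 1"
      "AE x in lborel. v x = r x + conv r v x"
    and charge: "\<And>A. A \<in> sets borel \<Longrightarrow> (AE x in lborel. x \<in> A \<longrightarrow> r x = 0) \<Longrightarrow> (AE x in lborel. x \<in> A \<longrightarrow> v x = 0)"
    by (rule renewal_equation[OF sub dl \<delta> int u, folded k_def v_def d_def]) (rule that, assumption+)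
  have eq: "v x + conv k v x = d" if "0 < x" for x
    by (rule AE_lborel_eq_continuous[OF cv ae that])
  obtain \<epsilon> where \<epsilon>: "0 < \<epsilon>" "k.K \<epsilon> < d / (2 * B + 1)" using k.K_small[of "d / (2 * B + 1)"] d B0 by auto
  \<comment> \<open>Near 0 the convolution in the renewal equation is small, so \<open>v\<close> is close to \<open>d\<close>.\<close>
  have vpos: "0 < v x" if x: "0 < x" "x < \<epsilon>" for x
  proof -
    have "k (0 - y) * v y = 0" for y using vz[of y] k.k_zero[of "0 - y"] by (cases "y \<le> 0") auto
    then have "(\<lambda>y. k (0 - y) * v y) = (\<lambda>_. 0)" by blast
    then have "conv k v 0 = 0" unfolding conv_def by simp
    then have "conv k v x \<le> 2 * B * k.K x" using k.conv_k_modulus[OF vm B, of x 0] x by simp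
    also have "\<dots> \<le> (2 * B + 1) * k.K \<epsilon>" using B0 k.K_mono[of x \<epsilon>] k.K_nonneg[of x] x by (intro mult_mono) auto
    also have "\<dots> < d" using \<epsilon>(2) B0 by (simp add: field_simps)
    finally show ?thesis using eq[OF x(1)] by simp
  qed
  interpret rs: renewal_setting k v r B d \<epsilon>
  proof
    show "AE x in lborel. \<bar>v x - conv r v x\<bar> \<le> r x" using r(5) by eventually_elim (use r(2) in simp)
    fix a b :: real assume ab: "0 < a" "a < b" "b < \<epsilon>"
    have nn: "0 \<le> (LBINT x. indicator {a<..<b} x * r x)" using r(2) by (intro integral_nonneg_AE) auto
    have i: "integrable lborel (\<lambda>x. indicator {a<..<b} x * r x)"
      using integrable_mult_indicator[OF _ r(3), of "{a<..<b}"] by simp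
    have "(LBINT x. indicator {a<..<b} x * r x) \<noteq> 0"
    proof
      assume "(LBINT x. indicator {a<..<b} x * r x) = 0"
      then have "AE x in lborel. indicator {a<..<b} x * r x = 0"
        using integral_nonneg_eq_0_iff_AE[OF i] r(2) by simp
      then have "AE x in lborel. x \<in> {a<..<b} \<longrightarrow> r x = 0" by eventually_elim auto
      then have "AE x in lborel. x \<in> {a<..<b} \<longrightarrow> v x = 0" by (intro charge) auto
      then have "AE x in lborel. x \<notin> {a<..<b}"
      proof eventually_elim
        case (elim x)
        show ?case using elim vpos[of x] ab by auto
      qed
      then have "emeasure lborel {a<..<b} = 0" by (subst (asm) AE_iff_null_sets[symmetric]) (auto simp: null_sets_def)
      then show False using ab by simp
    qed
    then show "0 < (LBINT x. indicator {a<..<b} x * r x)" using nn by simp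
  qed (use vm B eq r \<epsilon> in auto)
  obtain \<gamma> where \<gamma>: "0 < \<gamma>" "\<gamma> < 1" and fin: "(\<integral>\<^sup>+x\<in>{0<..1}. ennreal (x powr \<gamma>) \<partial>\<nu>) < \<infinity>"
    using blumenthal_getoor_exponent[OF \<nu> idx] by blast
  obtain C where C: "0 \<le> C" "\<And>x. 0 < x \<Longrightarrow> x \<le> 1 \<Longrightarrow> measure \<nu> {x<..} \<le> C * x powr - \<gamma>"
    using levy_tail_power_bound[OF \<nu> \<gamma>(1) fin] by blast
  have kb: "k x \<le> (C / \<delta> + k.mass) * x powr - \<gamma>" if x: "0 < x" for x
  proof (cases "x \<le> 1")
    case True
    have "k x \<le> C * x powr - \<gamma> / \<delta>"
      using C(2)[OF x True] \<delta> x by (simp add: k_def scaled_tail_def divide_right_mono)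
    also have "\<dots> \<le> (C / \<delta> + k.mass) * x powr - \<gamma>" using k.mass_nonneg by (simp add: algebra_simps)
    finally show ?thesis .
  next
    case False
    have "x * k x \<le> k.mass" using k.k_le[OF x] k.K_le_mass[of x] by simp
    then have "k x \<le> k.mass * x powr - 1" using x by (simp add: powr_minus field_simps)
    also have "\<dots> \<le> k.mass * x powr - \<gamma>" using False \<gamma> k.mass_nonneg by (intro mult_left_mono powr_mono) auto
    also have "\<dots> \<le> (C / \<delta> + k.mass) * x powr - \<gamma>" using C(1) \<delta> by (simp add: algebra_simps)
    finally show ?thesis .
  qed
  obtain h where h: "h \<in> borel_measurable borel" "\<And>x. x \<le> 0 \<Longrightarrow> h x = 0"
    "\<And>T. integrable lborel (\<lambda>y. indicator {0..T} y * h y)"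
    "\<And>x. h x + conv k h x = - k x" "continuous_on {0<..} (conv k h)"
    "\<And>a T. 0 < a \<Longrightarrow> \<exists>b. \<forall>x\<in>{a..T}. \<bar>h x\<bar> \<le> b"
    by (rule k.ex_resolvent[OF \<gamma> kb]) (assumption, rule that, assumption+)
  interpret h: kernel_resolvent k h using h by unfold_locales
  have rep: "u x = d * (1 + h.H x)" if "0 < x" for x
    using h.solution_representation[OF vm B vz eq that] that by (simp add: v_def extend_zero_def)
  have "((\<lambda>x. v x / d - 1) \<longlongrightarrow> d / (1 + k.mass) / d - 1) at_top"
    using d by (intro tendsto_intros rs.renewal_theorem) auto
  moreover have "\<forall>\<^sub>F x in at_top. v x / d - 1 = h.H x"
    using eventually_gt_at_top[of 0] by eventually_elim (use rep d in \<open>simp add: v_def extend_zero_def\<close>)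
  ultimately have "(h.H \<longlongrightarrow> d / (1 + k.mass) / d - 1) at_top" by (rule Lim_transform_eventually)
  then have h0: "(h \<longlongrightarrow> 0) at_top" by (rule h.h_tendsto_0)
  have "\<forall>x. \<exists>l. 0 < x \<longrightarrow> (h \<longlongrightarrow> l) (at_right x)" using h.h_one_sided_limits(1) by blast
  from choice[OF this] obtain R where R: "\<And>x. 0 < x \<Longrightarrow> (h \<longlongrightarrow> R x) (at_right x)" by blast
  have "\<forall>x. \<exists>l. 0 < x \<longrightarrow> (h \<longlongrightarrow> l) (at_left x)" using h.h_one_sided_limits(2) by blast
  from choice[OF this] obtain L where L: "\<And>x. 0 < x \<Longrightarrow> (h \<longlongrightarrow> L x) (at_left x)" by blast
  have transfer: "(u has_real_derivative d * D) (at x within S)"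
    if x: "0 < x" and D: "(h.H has_real_derivative D) (at x within S)" for x D S
  proof -
    have "((\<lambda>y. (h.H y - h.H x) / (y - x)) \<longlongrightarrow> D) (at x within S)" using D by (simp add: has_field_derivative_iff)
    then have "((\<lambda>y. d * ((h.H y - h.H x) / (y - x))) \<longlongrightarrow> d * D) (at x within S)" by (intro tendsto_intros)
    moreover have "\<forall>\<^sub>F y in at x within S. 0 < y"
      using order_tendstoD(1)[OF tendsto_ident_at x] .
    then have "\<forall>\<^sub>F y in at x within S. d * ((h.H y - h.H x) / (y - x)) = (u y - u x) / (y - x)"
      by eventually_elim (use x rep in \<open>simp add: algebra_simps\<close>)
    ultimately show ?thesis unfolding has_field_derivative_iff by (rule Lim_transform_eventually)
  qed
  show ?thesis
  proof (intro exI conjI allI impI)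
    show "(u has_real_derivative d * R x) (at_right x)" if "0 < x" for x
      by (rule transfer[OF that h.H_right_derivative[OF that R[OF that]]])
    show "(u has_real_derivative d * L x) (at_left x)" if "0 < x" for x
      by (rule transfer[OF that h.H_left_derivative[OF that L[OF that]]])
    have "(R \<longlongrightarrow> 0) at_top"
    proof (rule one_sided_limits_tendsto_0[OF h0 R])
      show "\<forall>\<^sub>F z in at_right x. y < z" if "y < x" for x y :: real
        using order_tendstoD(1)[OF tendsto_ident_at that] .
    qed auto
    then show "((\<lambda>x. d * R x) \<longlongrightarrow> 0) at_top" by (rule tendsto_mult_right_zero)
    have "(L \<longlongrightarrow> 0) at_top"
    proof (rule one_sided_limits_tendsto_0[OF h0 L])
      show "\<forall>\<^sub>F z in at_left x. y < z" if "y < x" for x y :: real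
        using order_tendstoD(1)[OF tendsto_ident_at that] .
    qed auto
    then show "((\<lambda>x. d * L x) \<longlongrightarrow> 0) at_top" by (rule tendsto_mult_right_zero)
  qed
qed

end
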